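(* Let $\theta>0$, let $\Lambda=\{(2\pi\tilde k,\,2\pi\tilde l\theta): \tilde k,\tilde l\in\mathbb{Z}\}\subset\mathbb{R}^2$, and let $T^2=\mathbb{R}^2/\Lambda$ with the flat metric induced from $\mathbb{R}^2$. Then $T^2$ admits a (full, isometric) proper-biharmonic immersion into the unit sphere $\mathbb{S}^n$ with constant mean curvature $h\in(0,1)$ if and only if $$\theta^2=\frac{q_1^2+q_2^2}{2}\quad\text{and}\quad n\in\{5,7\},$$ where $q_1,q_2\in\mathbb{N}$ and $q_1<q_2$. In this case $$h=\frac{q_2^2-q_1^2}{2(q_1^2+q_2^2)},$$ with $q_1\ge 0$ when $n=5$ and $q_1>0$ when $n=7$. Moreover, the CMC proper-biharmonic immersion $\phi$ of $T^2$ into $\mathbb{S}^n$ corresponds (i.e. $i\circ\phi$, lifted to $\mathbb{R}^2\cong\mathbb{C}$, $z=x+\i y$, where $i:\mathbb{S}^n\to\mathbb{R}^{n+1}$ is the inclusion) to a map $\psi:\mathbb{R}^2\to\mathbb{R}^{n+1}$ of the form $$\psi(z)=\tfrac{1}{\sqrt2}\sum_{k=1}^{m}\sqrt{R_k}\Big(e^{\frac{\sqrt{\lambda_1}}{2}(\mu_k z-\bar\mu_k\bar z)}Z_k+e^{\frac{\sqrt{\lambda_1}}{2}(-\mu_k z+\bar\mu_k\bar z)}\bar Z_k\Big)+\tfrac{1}{\sqrt2}\sum_{j=1}^{m'}\sqrt{R'_j}\Big(e^{\frac{\sqrt{\lambda_2}}{2}(\eta_j z-\bar\eta_j\bar z)}W_j+e^{\frac{\sqrt{\lambda_2}}{2}(-\eta_j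 z+\bar\eta_j\bar z)}\overline{W}_j\Big),$$ where $\{E_1,\dots,E_{2m+2m'}\}$ is an orthonormal basis of $\mathbb{R}^{n+1}$, $n=2m+2m'-1$, $Z_k=(E_{2k-1}-\i E_{2k})/2$, $W_j=(E_{2(m+j)-1}-\i E_{2(m+j)})/2$, $\lambda_1=2(1-h)$, $\lambda_2=2(1+h)$, and the data $(R_k,R'_j,\mu_k,\eta_j)$ are one of the following: - when $n=5$ ($m=1$, $m'=2$), with $h\in(0,1/2]$: $$R_1=1,\quad R'_1=\tfrac12\Big(1-\sqrt{\tfrac{1-2h}{1+2h}}\Big),\quad R'_2=\tfrac12\Big(1+\sqrt{\tfrac{1-2h}{1+2h}}\Big),$$ $$\mu_1=\sqrt{\tfrac{1-2h}{2(1-h)}}+\tfrac{\i}{\sqrt{2(1-h)}},\quad \eta_1=\sqrt{\tfrac{1+2h}{2(1+h)}}+\tfrac{\i}{\sqrt{2(1+h)}},\quad \eta_2=\bar\eta_1;$$ - when $n=7$ ($m=m'=2$), with $h\in(0,1/2)$ and $\omega\in(-\sqrt{1-2h},\sqrt{1-2h})$: $$R_{1,2}=\tfrac12\Big(1\pm\tfrac{\omega}{\sqrt{1-2h}}\Big),\quad R'_{1,2}=\tfrac12\Big(1\mp\tfrac{\omega}{\sqrt{1+2h}}\Big),$$ $$\mu_1=\sqrt{\tfrac{1-2h}{2(1-h)}}+\tfrac{\i}{\sqrt{2(1-h)}},\ \mu_2=\bar\mu_1,\quad \eta_1=\sqrt{\tfrac{1+2h}{2(1+h)}}+\tfrac{\i}{\sqrt{2(1+h)}},\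 \eta_2=\bar\eta_1.$$
   Context: A map $\phi:(M,g)\to(N,\tilde g)$ between Riemannian manifolds is biharmonic if it is a critical point of the bienergy $E_2(\phi)=\frac12\int_M|\tau(\phi)|^2v_g$, equivalently if its bitension field $\tau_2(\phi)=-\Delta\tau(\phi)-\operatorname{trace}R^N(d\phi,\tau(\phi))d\phi$ vanishes, where $\tau(\phi)$ is the tension field; it is proper-biharmonic if it is biharmonic but not harmonic. For an isometric immersion of a surface, the mean curvature is $h=|H|$, $H$ the mean curvature vector field; CMC means $h$ is constant. All immersions of the torus are isometric immersions of the flat torus and are full, i.e. their image does not lie in any totally geodesic sphere $\mathbb{S}^{n'}\subset\mathbb{S}^n$ with $n'<n$. $\mathbb{N}$ includes $0$.
   Formalization: The explicit form of ψ is asserted only up to composing with an isometry of the torus T²; without this it fails for n=5, q₁>0, since ψ(x,−y) is again such an immersion but not of the stated form for any orthonormal basis. *)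

theory Defs
  imports "HOL-Analysis.Analysis"
begin

(* Vectors of R^N are represented as functions nat => real, only the components
   i < N are meaningful.  The domain R^2 is identified with C, z = x + i y. *)

definition vinner :: "nat \<Rightarrow> (nat \<Rightarrow> real) \<Rightarrow> (nat \<Rightarrow> real) \<Rightarrow> real" where
  "vinner N u v = (\<Sum>i<N. u i * v i)"

definition vnorm :: "nat \<Rightarrow> (nat \<Rightarrow> real) \<Rightarrow> real" where
  "vnorm N u = sqrt (vinner N u u)"

definition vzero :: "nat \<Rightarrow> (nat \<Rightarrow> real) \<Rightarrow> bool" where
  "vzero N u \<longleftrightarrow> (\<forall>i<N. u i = 0)"

definition pdir :: "complex \<Rightarrow> (complex \<Rightarrow> nat \<Rightarrow> real) \<Rightarrow> complex \<Rightarrow> nat \<Rightarrow> real" where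
  "pdir d F z i = deriv (\<lambda>t::real. F (z + of_real t * d) i) 0"

definition pds :: "complex list \<Rightarrow> (complex \<Rightarrow> nat \<Rightarrow> real) \<Rightarrow> complex \<Rightarrow> nat \<Rightarrow> real" where
  "pds ds F = foldr pdir ds F"

definition smooth_map :: "nat \<Rightarrow> (complex \<Rightarrow> nat \<Rightarrow> real) \<Rightarrow> bool" where
  "smooth_map N F \<longleftrightarrow>
     (\<forall>ds i. set ds \<subseteq> {1, \<i>} \<and> i < N \<longrightarrow>
        continuous_on UNIV (\<lambda>z. pds ds F z i) \<and>
        (\<forall>z d. d \<in> {1, \<i>} \<longrightarrow> (\<lambda>t::real. pds ds F (z + of_real t * d) i) differentiable (at 0)))"

definition lattice :: "real \<Rightarrow> complex set" where
  "lattice \<theta> = {Complex (2 * pi * of_int k) (2 * pi * of_int l * \<theta>) | k l. True}"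

(* orthogonal projection of v onto the tangent space T_p S^n = p^\<perp> (p a unit vector) *)
definition tproj :: "nat \<Rightarrow> (nat \<Rightarrow> real) \<Rightarrow> (nat \<Rightarrow> real) \<Rightarrow> nat \<Rightarrow> real" where
  "tproj N p v = (\<lambda>i. v i - vinner N v p * p i)"

(* pull-back connection \<nabla>^\<phi>_{\<partial>_d} V of a section V along F (F viewed in S^n \<subseteq> R^N) *)
definition nabla :: "nat \<Rightarrow> (complex \<Rightarrow> nat \<Rightarrow> real) \<Rightarrow> complex \<Rightarrow> (complex \<Rightarrow> nat \<Rightarrow> real) \<Rightarrow> complex \<Rightarrow> nat \<Rightarrow> real" where
  "nabla N F d V z = tproj N (F z) (pdir d V z)"

(* tension field \<tau>(\<phi>) = trace \<nabla> d\<phi>, w.r.t. the orthonormal frame {\<partial>x, \<partial>y} of the flat metric *)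
definition tension :: "nat \<Rightarrow> (complex \<Rightarrow> nat \<Rightarrow> real) \<Rightarrow> complex \<Rightarrow> nat \<Rightarrow> real" where
  "tension N F z = (\<lambda>i. nabla N F 1 (pdir 1 F) z i + nabla N F \<i> (pdir \<i> F) z i)"

(* mean curvature vector H = \<tau>/2 of an isometric immersion of a surface *)
definition meancurv_vec :: "nat \<Rightarrow> (complex \<Rightarrow> nat \<Rightarrow> real) \<Rightarrow> complex \<Rightarrow> nat \<Rightarrow> real" where
  "meancurv_vec N F z = (\<lambda>i. tension N F z i / 2)"

definition sphere_curv :: "nat \<Rightarrow> (nat \<Rightarrow> real) \<Rightarrow> (nat \<Rightarrow> real) \<Rightarrow> (nat \<Rightarrow> real) \<Rightarrow> nat \<Rightarrow> real" where
  "sphere_curv N X Y W = (\<lambda>i. vinner N Y W * X i - vinner N X W * Y i)"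

(* bitension field \<tau>_2 = -\<Delta>\<tau> - trace R(d\<phi>,\<tau>)d\<phi>, where -\<Delta> = trace(\<nabla>\<nabla> - \<nabla>_\<nabla>) *)
definition bitension :: "nat \<Rightarrow> (complex \<Rightarrow> nat \<Rightarrow> real) \<Rightarrow> complex \<Rightarrow> nat \<Rightarrow> real" where
  "bitension N F z = (\<lambda>i.
      nabla N F 1 (nabla N F 1 (tension N F)) z i + nabla N F \<i> (nabla N F \<i> (tension N F)) z i
    - sphere_curv N (pdir 1 F z) (tension N F z) (pdir 1 F z) i
    - sphere_curv N (pdir \<i> F z) (tension N F z) (pdir \<i> F z) i)"

(* A full isometric immersion of the flat torus T^2 = R^2/\<Lambda> into S^n \<subseteq> R^(n+1),
   given by its lift psi : R^2 = C -> R^(n+1) (= i o \<phi> o \<pi>). *)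
definition torus_immersion :: "real \<Rightarrow> nat \<Rightarrow> (complex \<Rightarrow> nat \<Rightarrow> real) \<Rightarrow> bool" where
  "torus_immersion \<theta> n psi \<longleftrightarrow>
     smooth_map (n+1) psi \<and>
     (\<forall>z. vinner (n+1) (psi z) (psi z) = 1) \<and>
     (\<forall>z w. w \<in> lattice \<theta> \<longrightarrow> (\<forall>i<n+1. psi (z + w) i = psi z i)) \<and>
     (\<forall>z. vinner (n+1) (pdir 1 psi z) (pdir 1 psi z) = 1 \<and>
          vinner (n+1) (pdir \<i> psi z) (pdir \<i> psi z) = 1 \<and>
          vinner (n+1) (pdir 1 psi z) (pdir \<i> psi z) = 0) \<and>
     (\<forall>v. \<not> vzero (n+1) v \<longrightarrow> (\<exists>z. vinner (n+1) v (psi z) \<noteq> 0))"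

definition cmc_pbh_torus :: "real \<Rightarrow> nat \<Rightarrow> (complex \<Rightarrow> nat \<Rightarrow> real) \<Rightarrow> real \<Rightarrow> bool" where
  "cmc_pbh_torus \<theta> n psi h \<longleftrightarrow>
     torus_immersion \<theta> n psi \<and>
     (\<forall>z. vnorm (n+1) (meancurv_vec (n+1) psi z) = h) \<and>
     (\<forall>z. vzero (n+1) (bitension (n+1) psi z)) \<and>
     (\<exists>z. \<not> vzero (n+1) (tension (n+1) psi z))"

(* orthonormal family E_1..E_N in R^N (hence an orthonormal basis) *)
definition orthonormal_basis :: "nat \<Rightarrow> (nat \<Rightarrow> nat \<Rightarrow> real) \<Rightarrow> bool" where
  "orthonormal_basis N E \<longleftrightarrow>
     (\<forall>a\<in>{1..N}. \<forall>b\<in>{1..N}. vinner N (E a) (E b) = (if a = b then 1 else 0))"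

definition psi_form :: "nat \<Rightarrow> nat \<Rightarrow> (nat \<Rightarrow> real) \<Rightarrow> (nat \<Rightarrow> real) \<Rightarrow> (nat \<Rightarrow> complex) \<Rightarrow> (nat \<Rightarrow> complex)
     \<Rightarrow> real \<Rightarrow> real \<Rightarrow> (nat \<Rightarrow> nat \<Rightarrow> real) \<Rightarrow> complex \<Rightarrow> nat \<Rightarrow> complex" where
  "psi_form m m' R R' \<mu> \<eta> lam1 lam2 E z i =
     (let Z = (\<lambda>k. (of_real (E (2*k - 1) i) - \<i> * of_real (E (2*k) i)) / 2);
          W = (\<lambda>j. (of_real (E (2*(m+j) - 1) i) - \<i> * of_real (E (2*(m+j)) i)) / 2)
      in of_real (1 / sqrt 2) * (\<Sum>k=1..m. of_real (sqrt (R k)) *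
            (exp (of_real (sqrt lam1 / 2) * (\<mu> k * z - cnj (\<mu> k) * cnj z)) * Z k
           + exp (of_real (sqrt lam1 / 2) * (- \<mu> k * z + cnj (\<mu> k) * cnj z)) * cnj (Z k)))
       + of_real (1 / sqrt 2) * (\<Sum>j=1..m'. of_real (sqrt (R' j)) *
            (exp (of_real (sqrt lam2 / 2) * (\<eta> j * z - cnj (\<eta> j) * cnj z)) * W j
           + exp (of_real (sqrt lam2 / 2) * (- \<eta> j * z + cnj (\<eta> j) * cnj z)) * cnj (W j))))"

definition mu1 :: "real \<Rightarrow> complex" where
  "mu1 h = Complex (sqrt ((1 - 2*h) / (2*(1 - h)))) (1 / sqrt (2*(1 - h)))"

definition eta1 :: "real \<Rightarrow> complex" where
  "eta1 h = Complex (sqrt ((1 + 2*h) / (2*(1 + h)))) (1 / sqrt (2*(1 + h)))"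

definition psi5 :: "real \<Rightarrow> (nat \<Rightarrow> nat \<Rightarrow> real) \<Rightarrow> complex \<Rightarrow> nat \<Rightarrow> complex" where
  "psi5 h E = psi_form 1 2
      (\<lambda>k. 1)
      (\<lambda>j. if j = 1 then (1 - sqrt ((1 - 2*h) / (1 + 2*h))) / 2
           else (1 + sqrt ((1 - 2*h) / (1 + 2*h))) / 2)
      (\<lambda>k. mu1 h)
      (\<lambda>j. if j = 1 then eta1 h else cnj (eta1 h))
      (2 * (1 - h)) (2 * (1 + h)) E"

definition psi7 :: "real \<Rightarrow> real \<Rightarrow> (nat \<Rightarrow> nat \<Rightarrow> real) \<Rightarrow> complex \<Rightarrow> nat \<Rightarrow> complex" where
  "psi7 h \<omega> E = psi_form 2 2
      (\<lambda>k. if k = 1 then (1 + \<omega> / sqrt (1 - 2*h)) / 2 else (1 - \<omega> / sqrt (1 - 2*h)) / 2)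
      (\<lambda>j. if j = 1 then (1 - \<omega> / sqrt (1 + 2*h)) / 2 else (1 + \<omega> / sqrt (1 + 2*h)) / 2)
      (\<lambda>k. if k = 1 then mu1 h else cnj (mu1 h))
      (\<lambda>j. if j = 1 then eta1 h else cnj (eta1 h))
      (2 * (1 - h)) (2 * (1 + h)) E"

(* isometries of R^2 = C that descend to isometries of T^2 = R^2/\<Lambda> *)
definition torus_isometry :: "real \<Rightarrow> (complex \<Rightarrow> complex) \<Rightarrow> bool" where
  "torus_isometry \<theta> g \<longleftrightarrow>
     (\<exists>a c. cmod a = 1 \<and> (g = (\<lambda>z. a * z + c) \<or> g = (\<lambda>z. a * cnj z + c))) \<and>
     (\<forall>z w. w \<in> lattice \<theta> \<longrightarrow> g (z + w) - g z \<in> lattice \<theta>)"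

end

theory Submission
  imports Defs
begin

text \<open>
  For an isometric immersion of a flat surface, \<open>\<tau> = \<Delta>\<psi> + 2\<psi>\<close> and
  \<open>\<tau>\<^sub>2 = \<Delta>\<tau> + 2\<tau> - |\<tau>|\<^sup>2\<psi>\<close>, so a CMC biharmonic lift \<open>\<psi>\<close> satisfies
  \<open>(\<Delta> + 2(1 - h))(\<Delta> + 2(1 + h))\<psi> = 0\<close>. Being biperiodic, \<open>\<psi>\<close> is a finite sum of characters of
  frequencies \<open>(k, l/\<theta>)\<close> on the circles of squared radii \<open>2(1 \<mp> h) < 4\<close>, whence \<open>k\<^sup>2 \<le> 1\<close>; as
  \<open>|\<psi>| = |\<psi>\<^sub>x| = 1\<close>, in fact \<open>k = \<plusminus>1\<close> and \<open>(l/\<theta>)\<^sup>2 = 1 \<mp> 2h\<close>. Thus only four real frequencies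
  \<open>(1, \<plusminus>q\<^sub>1/\<theta>)\<close>, \<open>(1, \<plusminus>q\<^sub>2/\<theta>)\<close> survive. The two eigencomponents of \<open>\<psi>\<close> are
  \<open>(2h\<psi> \<plusminus> \<tau>)/4h\<close>; they have constant norm, are orthogonal, and remain so after differentiating one
  of them in \<open>x\<close>. This makes all coefficient vectors mutually orthogonal; fullness then counts the
  frequencies that occur, and \<open>\<langle>\<psi>\<^sub>x, \<psi>\<^sub>y\<rangle> = 0\<close> fixes the weights.
\<close>

section \<open>Fourier coefficients on the torus\<close>

text \<open>Rescaling the second coordinate by theta turns the lattice into the standard one. Since
  h < 1 keeps both eigenvalue circles inside radius 2, only finitely many frequencies occur and no
  convergence of Fourier series is at issue: it suffices that a continuous biperiodic function with
  vanishing Fourier coefficients is zero. The weights, i.e. the squared norms of the coefficient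
  vectors at the four frequencies, obey three linear conditions: a fixed total on each circle, and
  orthogonality of the x- and y-derivatives. One parameter remains, omega. As q1 < q2, the q2
  weights stay positive; a q1 weight may vanish, at an endpoint of the range of omega. Three
  frequencies give n = 5, four give n = 7. If of the two q1 frequencies only the negative one
  occurs, complex conjugation of the domain restores the normal form; this is why an isometry
  \<open>g\<close> appears. The case q1 = 0, i.e. h = 1/2, has to be split off repeatedly: there the
  two frequencies on the inner circle coincide.\<close>

definition torus_char :: "int \<Rightarrow> int \<Rightarrow> real \<times> real \<Rightarrow> complex" where
  "torus_char k l p = cis (of_int k * fst p + of_int l * snd p)"

definition torus_box :: "(real \<times> real) set" where
  "torus_box = cbox (-pi, -pi) (pi, pi)"

definition biperiodic :: "(real \<times> real \<Rightarrow> 'a) \<Rightarrow> bool" where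
  "biperiodic f \<longleftrightarrow> (\<forall>x y. f (x + 2 * pi, y) = f (x, y) \<and> f (x, y + 2 * pi) = f (x, y))"

text \<open>The integral is taken against the character itself and is not normalised: the amplitude
  of \<open>torus_char k l\<close> in \<open>f\<close> is \<open>fcoef f (- k) (- l)\<close> divided
  by 4 pi^2. Hence the negated indices and the minus signs in the derivative rules.\<close>

definition fcoef :: "(real \<times> real \<Rightarrow> complex) \<Rightarrow> int \<Rightarrow> int \<Rightarrow> complex" where
  "fcoef f k l = integral torus_box (\<lambda>p. f p * torus_char k l p)"

lemma cis_two_pi_int: "cis (a + of_int k * (b + 2 * pi)) = cis (a + of_int k * b)"
proof -
  have "cis (2 * pi * of_int k) = 1"
    by (rule cis_multiple_2pi) simp
  moreover have "a + of_int k * (b + 2 * pi) = (a + of_int k * b) + 2 * pi * of_int k"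
    by (simp add: algebra_simps)
  ultimately show ?thesis
    by (metis cis_mult mult.right_neutral)
qed

lemma biperiodic_torus_char: "biperiodic (torus_char k l)"
  unfolding biperiodic_def torus_char_def
  using cis_two_pi_int[of 0 k] cis_two_pi_int[of _ l] cis_two_pi_int[of "of_int l * _" k]
  by (simp add: add.commute)

lemma continuous_torus_char [continuous_intros]: "continuous_on S (torus_char k l)"
  unfolding torus_char_def cis_conv_exp by (intro continuous_intros)

lemma torus_char_mult: "torus_char k l p * torus_char k' l' p = torus_char (k + k') (l + l') p"
  by (simp add: torus_char_def cis_mult algebra_simps)

lemma torus_char_add: "torus_char k l (p + q) = torus_char k l p * torus_char k l q"
  by (simp add: torus_char_def cis_mult algebra_simps)

lemma torus_char_0 [simp]: "torus_char 0 0 p = 1"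
  by (simp add: torus_char_def)

lemma biperiodic_mult: "biperiodic f \<Longrightarrow> biperiodic g \<Longrightarrow> biperiodic (\<lambda>p. f p * g p)"
  by (simp add: biperiodic_def)

lemma integrable_torus_box:
  fixes f :: "real \<times> real \<Rightarrow> 'a::banach"
  assumes "continuous_on UNIV f"
  shows "f integrable_on torus_box"
  unfolding torus_box_def
  by (intro integrable_continuous continuous_on_subset[OF assms]) simp

lemma fcoef_add:
  assumes "continuous_on UNIV f" "continuous_on UNIV g"
  shows "fcoef (\<lambda>p. f p + g p) k l = fcoef f k l + fcoef g k l"
  unfolding fcoef_def distrib_right
  by (intro integral_add integrable_torus_box continuous_intros assms)

lemma fcoef_diff:
  assumes "continuous_on UNIV f" "continuous_on UNIV g"
  shows "fcoef (\<lambda>p. f p - g p) k l = fcoef f k l - fcoef g k l"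
  unfolding fcoef_def left_diff_distrib
  by (intro integral_diff integrable_torus_box continuous_intros assms)

lemma fcoef_cmult: "fcoef (\<lambda>p. c * f p) k l = c * fcoef f k l"
  unfolding fcoef_def mult.assoc by simp

lemma fcoef_sum:
  assumes "finite S" "\<And>s. s \<in> S \<Longrightarrow> continuous_on UNIV (f s)"
  shows "fcoef (\<lambda>p. \<Sum>s\<in>S. f s p) k l = (\<Sum>s\<in>S. fcoef (f s) k l)"
  unfolding fcoef_def sum_distrib_right
  by (intro integral_sum integrable_torus_box continuous_intros assms)

section \<open>Translation invariance of integrals over a period\<close>

text \<open>Both intervals contain the piece from \<open>c + a\<close> to \<open>c + T\<close>; what
  is left of each differs by a translation by \<open>T\<close>.\<close>

lemma integral_periodic_shift_small:
  fixes f :: "real \<Rightarrow> 'a::banach"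
  assumes f: "continuous_on UNIV f" and per: "\<And>x. f (x + T) = f x" and a: "0 \<le> a" "a \<le> T"
  shows "integral {c + a..c + a + T} f = integral {c..c + T} f"
proof -
  have int: "f integrable_on {u..v}" for u v
    by (intro integrable_continuous_real continuous_on_subset[OF f]) simp
  have "integral {c..c+a} f + integral {c+a..c+T} f = integral {c..c+T} f"
    using a by (intro Henstock_Kurzweil_Integration.integral_combine int) auto
  moreover have "integral {c+a..c+T} f + integral {c+T..c+a+T} f = integral {c+a..c+a+T} f"
    using a by (intro Henstock_Kurzweil_Integration.integral_combine int) auto
  moreover have "integral {c+T..c+a+T} f = integral {c..c+a} f"
    using integral_shift_real_ivl[of "c+T" T "c+a+T" f] per by simp
  ultimately show ?thesis by (metis add.commute)
qed

text \<open>Whole periods are absorbed by periodicity; the remainder of \<open>a\<close> modulo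
  \<open>T\<close> is a small shift.\<close>

lemma integral_periodic_shift:
  fixes f :: "real \<Rightarrow> 'a::banach"
  assumes f: "continuous_on UNIV f" and per: "\<And>x. f (x + T) = f x" and "T > 0"
  shows "integral {c + a..c + a + T} f = integral {c..c + T} f"
proof -
  have step: "integral {c + of_int m * T..c + of_int m * T + T} f = integral {c..c + T} f" for m :: int
  proof -
    have "f (x + of_int m * T) = f x" for x
    proof (induction m rule: int_induct[where k=0])
      case (step1 i)
      then show ?case using per[of "x + of_int i * T"] by (simp add: algebra_simps)
    next
      case (step2 i)
      then show ?case using per[of "x + of_int (i - 1) * T"] by (simp add: algebra_simps)
    qed simp
    then show ?thesis
      using integral_shift_real_ivl[of "c + of_int m * T" "of_int m * T" "c + of_int m * T + T" f]
      by (simp add: algebra_simps)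
  qed
  define m where "m = \<lfloor>a / T\<rfloor>"
  have m: "of_int m * T \<le> a" "a \<le> of_int m * T + T"
    using floor_divide_lower[OF \<open>T>0\<close>, of a] floor_divide_upper[OF \<open>T>0\<close>, of a]
    by (auto simp: m_def algebra_simps)
  have "integral {c + of_int m * T + (a - of_int m * T)..c + of_int m * T + (a - of_int m * T) + T} f
      = integral {c + of_int m * T..c + of_int m * T + T} f"
    by (rule integral_periodic_shift_small[OF f per]) (use m in auto)
  then show ?thesis by (simp add: step)
qed

lemma integral_torus_box:
  fixes f :: "real \<times> real \<Rightarrow> 'a::banach"
  assumes "continuous_on UNIV f"
  shows "integral torus_box f = integral {-pi..pi} (\<lambda>x. integral {-pi..pi} (\<lambda>y. f (x, y)))"
    and "integral torus_box f = integral {-pi..pi} (\<lambda>y. integral {-pi..pi} (\<lambda>x. f (x, y)))"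
proof -
  have c: "continuous_on (cbox (-pi, -pi) (pi, pi)) f"
    by (rule continuous_on_subset[OF assms]) simp
  show 1: "integral torus_box f = integral {-pi..pi} (\<lambda>x. integral {-pi..pi} (\<lambda>y. f (x, y)))"
    unfolding torus_box_def using integral_prod_continuous[OF c] by simp
  show "integral torus_box f = integral {-pi..pi} (\<lambda>y. integral {-pi..pi} (\<lambda>x. f (x, y)))"
    unfolding 1 using integral_swap_continuous[of "-pi" "-pi" pi pi "\<lambda>x y. f (x, y)"] c by simp
qed

lemma continuous_on_slices:
  assumes "continuous_on UNIV f"
  shows "continuous_on UNIV (\<lambda>x::real. f (x + a, b::real))" "continuous_on UNIV (\<lambda>y::real. f (a, y + b))"
  by (intro continuous_on_compose2[OF assms] continuous_intros; simp)+

text \<open>Each coordinate is shifted while it is the inner variable of an iterated integral, so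
  the order of integration is exchanged in between.\<close>

lemma integral_torus_box_shift:
  fixes f :: "real \<times> real \<Rightarrow> 'a::banach"
  assumes f: "continuous_on UNIV f" and per: "biperiodic f"
  shows "integral torus_box (\<lambda>p. f (p + q)) = integral torus_box f"
proof -
  obtain a b where q: "q = (a, b)" by force
  have cf: "continuous_on UNIV (\<lambda>p. f (p + r))" for r
    by (intro continuous_on_compose2[OF f] continuous_intros) auto
  have shift: "integral {-pi..pi} (\<lambda>x. g (x + a)) = integral {-pi..pi} g"
    if g: "continuous_on UNIV g" "\<And>x. g (x + 2 * pi) = g x" for g :: "real \<Rightarrow> 'a" and a
  proof -
    have "integral {-pi + a..-pi + a + 2 * pi} g = integral {-pi..-pi + 2 * pi} g"
      by (rule integral_periodic_shift[OF g]) auto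
    moreover have "integral {-pi..pi} (\<lambda>x. g (x + a)) = integral {-pi + a..pi + a} g"
      using integral_shift_real_ivl[of "-pi + a" a "pi + a" g] by simp
    ultimately show ?thesis by (simp add: algebra_simps)
  qed
  have "integral torus_box (\<lambda>p. f (p + q))
      = integral {-pi..pi} (\<lambda>x. integral {-pi..pi} (\<lambda>y. f (x + a, y + b)))"
    using integral_torus_box(1)[OF cf[of q]] by (simp add: q)
  also have "\<dots> = integral {-pi..pi} (\<lambda>x. integral {-pi..pi} (\<lambda>y. f (x + a, y)))"
    using per by (subst shift) (auto simp: biperiodic_def continuous_on_slices(2)[OF f, of _ 0, simplified])
  also have "\<dots> = integral torus_box (\<lambda>p. f (p + (a, 0)))"
    using integral_torus_box(1)[OF cf[of "(a, 0)"]] by simp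
  also have "\<dots> = integral {-pi..pi} (\<lambda>y. integral {-pi..pi} (\<lambda>x. f (x + a, y)))"
    using integral_torus_box(2)[OF cf[of "(a, 0)"]] by simp
  also have "\<dots> = integral {-pi..pi} (\<lambda>y. integral {-pi..pi} (\<lambda>x. f (x, y)))"
    using per by (subst shift) (auto simp: biperiodic_def continuous_on_slices(1)[OF f, of 0, simplified])
  also have "\<dots> = integral torus_box f"
    using integral_torus_box(2)[OF f] by simp
  finally show ?thesis .
qed

text \<open>Translation only multiplies a coefficient by a character, so the vanishing of all
  coefficients is translation invariant. This reduces pointwise uniqueness to the origin.\<close>

lemma fcoef_shift:
  assumes f: "continuous_on UNIV f" and per: "biperiodic f"
  shows "fcoef (\<lambda>p. f (p + q)) k l = torus_char k l (- q) * fcoef f k l"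
proof -
  have "fcoef (\<lambda>p. f (p + q)) k l
      = integral torus_box (\<lambda>p. torus_char k l (- q) * (f (p + q) * torus_char k l (p + q)))"
    unfolding fcoef_def torus_char_add
    by (intro integral_cong) (simp add: torus_char_def cis_mult)
  also have "\<dots> = torus_char k l (- q) * integral torus_box (\<lambda>p. f (p + q) * torus_char k l (p + q))"
    by simp
  also have "integral torus_box (\<lambda>p. f (p + q) * torus_char k l (p + q)) = fcoef f k l"
    unfolding fcoef_def
    by (rule integral_torus_box_shift)
       (intro continuous_intros biperiodic_mult biperiodic_torus_char f per)+
  finally show ?thesis .
qed

section \<open>Uniqueness of Fourier coefficients\<close>

text \<open>The factor is a combination of characters, and multiplying by a character only shifts
  the indices of the coefficients.\<close>

lemma fcoef_cos_mult:
  assumes f: "continuous_on UNIV f" and 0: "\<And>k l. fcoef f k l = 0"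
  shows "fcoef (\<lambda>p. of_real (cos (fst p) + cos (snd p) + a) * f p) k l = 0"
proof -
  have split: "complex_of_real (cos (fst p) + cos (snd p) + a) =
      (torus_char 1 0 p + torus_char (-1) 0 p) / 2 + (torus_char 0 1 p + torus_char 0 (-1) p) / 2 + a" for p
    by (auto simp: torus_char_def complex_eq_iff)
  have m: "continuous_on UNIV (\<lambda>p. torus_char i j p * f p) \<and>
           fcoef (\<lambda>p. torus_char i j p * f p) k l = 0" for i j
  proof -
    have "fcoef (\<lambda>p. torus_char i j p * f p) k l = fcoef f (i + k) (j + l)"
      unfolding fcoef_def torus_char_mult[symmetric] by (simp add: mult_ac)
    then show ?thesis using 0 by (auto intro!: continuous_intros f)
  qed
  have "fcoef (\<lambda>p. of_real (cos (fst p) + cos (snd p) + a) * f p) k l =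
     fcoef (\<lambda>p. (1/2) * (torus_char 1 0 p * f p) + (1/2) * (torus_char (-1) 0 p * f p)
       + (1/2) * (torus_char 0 1 p * f p) + (1/2) * (torus_char 0 (-1) p * f p) + a * f p) k l"
    unfolding split by (simp add: algebra_simps add_divide_distrib)
  also have "\<dots> = 0"
    by (simp only: fcoef_add fcoef_cmult m 0 continuous_on_add continuous_on_mult_left f) simp
  finally show ?thesis .
qed

lemma fcoef_cos_power_mult:
  assumes f: "continuous_on UNIV f" and 0: "\<And>k l. fcoef f k l = 0"
  shows "fcoef (\<lambda>p. of_real (((cos (fst p) + cos (snd p) + a) / b) ^ n) * f p) k l = 0"
proof -
  define G where "G n = (\<lambda>p. of_real (((cos (fst p) + cos (snd p) + a) / b) ^ n) * f p)" for n
  have "continuous_on UNIV (G n) \<and> (\<forall>k l. fcoef (G n) k l = 0)" for n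
  proof (induction n)
    case 0
    then show ?case using assms by (simp add: G_def)
  next
    case (Suc n)
    have "G (Suc n) = (\<lambda>p. of_real (1 / b) * (of_real (cos (fst p) + cos (snd p) + a) * G n p))"
      by (auto simp: G_def fun_eq_iff)
    then show ?case
      using Suc fcoef_cos_mult[of "G n" a]
          by (auto simp: fcoef_cmult intro!: continuous_intros simp del: of_real_add of_real_divide)
  qed
  then show ?thesis by (simp add: G_def)
qed

text \<open>The weight \<open>Q = (cos x + cos y + 2) / (4 - \<rho>)\<close> exceeds 1 near the origin and is at most 1
  elsewhere, so \<open>\<integral> f Q^n\<close> would tend to infinity if \<open>f\<close> did not vanish at the origin.\<close>

lemma fcoef_zero_imp_zero_origin:
  assumes f: "continuous_on UNIV f" and 0: "\<And>k l. fcoef f k l = 0"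
  shows "f (0, 0) = 0"
proof (rule ccontr)
  assume nz: "f (0, 0) \<noteq> 0"
  \<comment> \<open>A real function with value 1 at the origin; the weighted integrals of
    \<open>f\<close> vanish, hence so do those of \<open>g\<close>.\<close>
  define g where "g p = Re (f p / f (0, 0))" for p
  have g: "continuous_on UNIV g"
    unfolding g_def by (intro continuous_intros f) (use nz in auto)
  have g0: "g (0, 0) = 1" using nz by (simp add: g_def)
  obtain d where d: "d > 0" "\<And>p. dist p (0, 0) < d \<Longrightarrow> dist (g p) (g (0, 0)) < 1 / 2"
    using g[unfolded continuous_on_iff, rule_format, of "(0,0)" "1/2"] by auto
  \<comment> \<open>The third of \<open>d\<close> puts the square of half-side \<open>e\<close>
    inside the \<open>d\<close>-ball; the cap 1 keeps \<open>e\<close> below pi, where cosine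
    decreases.\<close>
  define e where "e = min (d / 3) 1"
  have e: "e > 0" "e \<le> 1" using d by (auto simp: e_def)
  have gpos: "g (x, y) \<ge> 1 / 2" if "\<bar>x\<bar> \<le> e" "\<bar>y\<bar> \<le> e" for x y
  proof -
    have "dist (x, y) (0, 0) \<le> dist x 0 + dist y 0"
      unfolding dist_prod_def using sqrt_sum_squares_le_sum[of "dist x 0" "dist y 0"] by simp
    also have "dist x 0 + dist y 0 < d"
      using that d by (auto simp: e_def dist_real_def)
    finally have "dist (x, y) (0, 0) < d" .
    from d(2)[OF this] show ?thesis unfolding g0 dist_real_def by linarith
  qed
  define \<rho> where "\<rho> = 1 - cos e"
  have e_pi: "e < pi" using e pi_gt3 by simp
  have \<rho>: "\<rho> > 0" "\<rho> < 2"
    using cos_monotone_0_pi[of 0 e] cos_monotone_0_pi[of e pi] e e_pi by (auto simp: \<rho>_def)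
  \<comment> \<open>Outside the square of half-side \<open>e\<close>, one cosine is at most
    \<open>cos e\<close>, which is 1 - rho, and the other at most 1, so the numerator is at most the
    denominator.\<close>
  define Q where "Q p = (cos (fst p) + cos (snd p) + 2) / (4 - \<rho>)" for p :: "real \<times> real"
  have Q0: "Q p \<ge> 0" for p
    unfolding Q_def using \<rho> cos_ge_minus_one[of "fst p"] cos_ge_minus_one[of "snd p"]
    by (intro divide_nonneg_nonneg) linarith+
  have cosle: "cos x \<le> 1 - \<rho>" if "e < \<bar>x\<bar>" "\<bar>x\<bar> \<le> pi" for x
    using cos_monotone_0_pi[of e "\<bar>x\<bar>"] that e by (simp add: \<rho>_def)
  have Q1: "Q (x, y) \<le> 1" if "(x, y) \<in> torus_box" "e < \<bar>x\<bar> \<or> e < \<bar>y\<bar>" for x y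
  proof -
    have "\<bar>x\<bar> \<le> pi" "\<bar>y\<bar> \<le> pi" using that by (auto simp: torus_box_def)
    then have "cos x + cos y \<le> 2 - \<rho>"
      using that(2) cosle[of x] cosle[of y] cos_le_one[of x] cos_le_one[of y] by linarith
    then show ?thesis using \<rho> by (simp add: Q_def)
  qed
  define e' where "e' = e / 2"
  define q where "q = (2 * cos e' + 2) / (4 - \<rho>)"
  have e': "0 < e'" "e' < e" using e by (auto simp: e'_def)
  \<comment> \<open>By the double angle formula, cos e = 2 cos^2 e' - 1 < 2 cos e' - 1, because cos
    e' lies strictly between 0 and 1. This makes \<open>q\<close> exceed 1 on the half-size square
    \<open>V\<close>.\<close>
  have ce': "2 * cos e' > 2 - \<rho>"
  proof -
    have "cos e = 2 * (cos e')\<^sup>2 - 1" using cos_double_cos[of e'] by (simp add: e'_def)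
    moreover have "0 < cos e'" using e by (intro cos_gt_zero) (use pi_gt3 in \<open>auto simp: e'_def\<close>)
    moreover have "cos e' < 1" using cos_monotone_0_pi[of 0 e'] e' e_pi by simp
    ultimately have "cos e < 2 * cos e' - 1"
      using mult_strict_left_mono[of "cos e'" 1 "cos e'"] by (simp add: power2_eq_square)
    then show ?thesis by (simp add: \<rho>_def)
  qed
  have q: "q > 1" using ce' \<rho> by (simp add: q_def field_simps)
  define V where "V = cbox (-e', -e') (e', e')"
  have Vsub: "V \<subseteq> torus_box" using e' e_pi by (auto simp: V_def torus_box_def)
  have QV: "Q p \<ge> q" if "p \<in> V" for p
  proof -
    obtain x y where p: "p = (x, y)" by force
    have "\<bar>x\<bar> \<le> e'" "\<bar>y\<bar> \<le> e'" using that by (auto simp: V_def p)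
    then have "cos x \<ge> cos e'" "cos y \<ge> cos e'"
      using cos_monotone_0_pi_le[of "\<bar>x\<bar>" e'] cos_monotone_0_pi_le[of "\<bar>y\<bar>" e'] e' e_pi by auto
    then show ?thesis using \<rho> by (simp add: Q_def q_def p divide_right_mono)
  qed
  have "compact torus_box" by (simp add: torus_box_def)
  then have "bounded (g ` torus_box)"
    using compact_continuous_image[of torus_box g] g continuous_on_subset compact_imp_bounded by blast
  then obtain M where M: "M > 0" "\<And>p. p \<in> torus_box \<Longrightarrow> \<bar>g p\<bar> \<le> M"
    by (auto simp: bounded_pos)
  have Qc: "continuous_on UNIV Q" unfolding Q_def by (intro continuous_intros) (use \<rho> in auto)
  have zero: "integral torus_box (\<lambda>p. g p * Q p ^ n) = 0" for n
  proof -
    have "integral torus_box (\<lambda>p. of_real (Q p ^ n) * f p) = 0"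
      using fcoef_cos_power_mult[OF f 0, of 2 "4 - \<rho>" n 0 0] by (simp add: fcoef_def Q_def)
    then have "((\<lambda>p. of_real (Q p ^ n) * f p) has_integral 0) torus_box"
      unfolding has_integral_iff by (intro conjI integrable_torus_box continuous_intros Qc f)
    then have "((\<lambda>p. 1 / f (0,0) * (of_real (Q p ^ n) * f p)) has_integral 1 / f (0,0) * 0) torus_box"
      by (rule has_integral_mult_right)
    from has_integral_linear[OF this bounded_linear_Re]
    have "((\<lambda>p. Re (1 / f (0,0) * (of_real (Q p ^ n) * f p))) has_integral 0) torus_box"
      by (simp add: o_def)
    moreover have "Re (1 / f (0,0) * (of_real (Q p ^ n) * f p)) = g p * Q p ^ n" for p
    proof -
      have "1 / f (0,0) * (of_real (Q p ^ n) * f p) = of_real (Q p ^ n) * (f p / f (0,0))" by simp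
      then show ?thesis by (simp only: Re_complex_of_real times_complex.simps g_def Im_complex_of_real) simp
    qed
    ultimately show ?thesis by (simp add: integral_unique)
  qed
  \<comment> \<open>Adding \<open>M\<close> makes the integrand non-negative on the whole box, so
    its integral dominates the one over \<open>V\<close>, which grows like
    \<open>q ^ n\<close>.\<close>
  have lower: "g p * Q p ^ n + M \<ge> 0" if "p \<in> torus_box" for p n
  proof -
    obtain x y where p: "p = (x, y)" by force
    show ?thesis
    proof (cases "e < \<bar>x\<bar> \<or> e < \<bar>y\<bar>")
      case True
      then have "Q p ^ n \<le> 1" using Q1 Q0 that p power_le_one by blast
      then have "\<bar>g p * Q p ^ n\<bar> \<le> M * 1"
        unfolding abs_mult using M that Q0 by (intro mult_mono) auto
      then show ?thesis by linarith
    next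
      case False
      then have "g p \<ge> 1/2" using gpos p by auto
      then show ?thesis using Q0 M by simp
    qed
  qed
  define A where "A = measure lborel V"
  have A: "A > 0" using e' by (simp add: A_def V_def content_Pair)
  have bound: "(1/2 * q ^ n) * A \<le> measure lborel torus_box * M" for n
  proof -
    have c: "continuous_on UNIV (\<lambda>p. g p * Q p ^ n + M)"
      by (intro continuous_intros g Qc)
    have iV: "(\<lambda>p. g p * Q p ^ n + M) integrable_on V"
      unfolding V_def by (intro integrable_continuous continuous_on_subset[OF c]) simp
    have "(1/2 * q ^ n) * A = integral V (\<lambda>p. 1/2 * q ^ n)"
      by (simp add: V_def A_def)
    also have "\<dots> \<le> integral V (\<lambda>p. g p * Q p ^ n + M)"
    proof (rule integral_le)
      show "(\<lambda>p. 1/2 * q ^ n) integrable_on V" by (simp add: V_def integrable_on_const)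
      fix p assume p: "p \<in> V"
      then have "g p \<ge> 1/2" using gpos[of "fst p" "snd p"] e' by (cases p) (auto simp: V_def)
      moreover have "Q p ^ n \<ge> q ^ n" using QV[OF p] q by (intro power_mono) auto
      ultimately have "1/2 * q ^ n \<le> g p * Q p ^ n" using q by (intro mult_mono) auto
      then show "1/2 * q ^ n \<le> g p * Q p ^ n + M" using M by linarith
    qed (rule iV)
    also have "\<dots> \<le> integral torus_box (\<lambda>p. g p * Q p ^ n + M)"
      by (intro integral_subset_le Vsub iV integrable_torus_box c) (use lower in auto)
    also have "\<dots> = integral torus_box (\<lambda>p. g p * Q p ^ n) + integral torus_box (\<lambda>p. M)"
      by (intro integral_add integrable_torus_box continuous_intros g Qc)
    also have "\<dots> = measure lborel torus_box * M" by (simp add: zero) (simp add: torus_box_def)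
    finally show ?thesis .
  qed
  obtain n where "2 * (measure lborel torus_box * M) / A < q ^ n"
    using real_arch_pow[OF q] by blast
  then show False using bound[of n] A by (simp add: field_simps)
qed

lemma fcoef_zero_imp_zero:
  assumes f: "continuous_on UNIV f" and per: "biperiodic f" and 0: "\<And>k l. fcoef f k l = 0"
  shows "f p = 0"
proof -
  have "(\<lambda>q. f (q + p)) (0, 0) = 0"
    by (rule fcoef_zero_imp_zero_origin)
       (auto simp: fcoef_shift[OF f per] 0 intro!: continuous_intros continuous_on_compose2[OF f])
  then show ?thesis by (cases p) simp
qed

section \<open>Coefficients of derivatives and trigonometric polynomials\<close>

text \<open>Integration by parts in the first variable; periodicity cancels the boundary
  terms.\<close>

lemma fcoef_deriv_fst:
  assumes f: "continuous_on UNIV f" and f': "continuous_on UNIV f'" and per: "biperiodic f"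
    and d: "\<And>x y. ((\<lambda>x. f (x, y)) has_vector_derivative f' (x, y)) (at x)"
  shows "fcoef f' k l = - \<i> * of_int k * fcoef f k l"
proof -
  have c: "continuous_on UNIV (\<lambda>p. f' p * torus_char k l p + f p * (\<i> * of_int k * torus_char k l p))"
    by (intro continuous_intros f f')
  have "((\<lambda>x. torus_char k l (x, y)) has_vector_derivative \<i> * of_int k * torus_char k l (x, y)) (at x
      within S)"
    for x y S
  proof -
    have "((\<lambda>w. exp (\<i> * (of_int k * w + of_int l * of_real y))) has_field_derivative
        \<i> * of_int k * exp (\<i> * (of_int k * of_real x + of_int l * of_real y))) (at (of_real x))"
      by (auto intro!: derivative_eq_intros)
    from has_vector_derivative_real_field[OF this]
    show ?thesis by (simp add: torus_char_def cis_conv_exp)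
  qed
  then have "((\<lambda>x. f (x, y) * torus_char k l (x, y)) has_vector_derivative
      f (x, y) * (\<i> * of_int k * torus_char k l (x, y))
          + f' (x, y) * torus_char k l (x, y)) (at x within S)" for x y S
    by (intro has_vector_derivative_mult has_vector_derivative_at_within[OF d])
  then have "((\<lambda>x. f (x, y) * (\<i> * of_int k * torus_char k l (x, y)) + f' (x, y) * torus_char k l (x, y))
     has_integral f (pi, y) * torus_char k l (pi, y) - f (-pi, y) * torus_char k l (-pi, y)) {-pi..pi}" for y
    by (intro fundamental_theorem_of_calculus) auto
  moreover have "f (pi, y) * torus_char k l (pi, y) = f (-pi, y) * torus_char k l (-pi, y)" for y
    using biperiodic_mult[OF per biperiodic_torus_char[of k l]]
    unfolding biperiodic_def by (auto dest: spec[of _ "-pi"])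
  ultimately have "integral {-pi..pi} (\<lambda>x. f' (x, y) * torus_char k l (x, y)
      + f (x, y) * (\<i> * of_int k * torus_char k l (x, y))) = 0" for y
    by (simp add: integral_unique add.commute)
  then have "integral torus_box (\<lambda>p. f' p * torus_char k l p + f p * (\<i> * of_int k * torus_char k l p)) = 0"
    using integral_torus_box(2)[OF c] by simp
  moreover have "integral torus_box (\<lambda>p. f' p * torus_char k l p + f p * (\<i> * of_int k * torus_char k l p))
     = fcoef f' k l + integral torus_box (\<lambda>p. (\<i> * of_int k) * (f p * torus_char k l p))"
    unfolding fcoef_def
    by (subst integral_add) (auto intro!: integrable_torus_box continuous_intros f f' simp: mult_ac)
  ultimately show ?thesis by (simp add: fcoef_def add_eq_0_iff)
qed

lemma fcoef_swap:
  assumes f: "continuous_on UNIV f"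
  shows "fcoef (f \<circ> prod.swap) k l = fcoef f l k"
proof -
  have sw: "f (y, x) = (f \<circ> prod.swap) (x, y)" "torus_char l k (y, x) = torus_char k l (x, y)" for x y
    by (auto simp: torus_char_def add.commute)
  have fs: "continuous_on UNIV (f \<circ> prod.swap)"
    by (intro continuous_on_compose continuous_on_subset[OF f] continuous_on_swap) auto
  have "fcoef (f \<circ> prod.swap) k l =
      integral {-pi..pi} (\<lambda>x. integral {-pi..pi} (\<lambda>y. (f \<circ> prod.swap) (x, y) * torus_char k l (x, y)))"
    unfolding fcoef_def by (rule integral_torus_box(1)) (intro continuous_intros fs)
  also have "\<dots> = integral {-pi..pi} (\<lambda>x. integral {-pi..pi} (\<lambda>y. f (y, x) * torus_char l k (y, x)))"
    by (simp only: sw)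
  also have "\<dots> = fcoef f l k"
    unfolding fcoef_def by (rule integral_torus_box(2)[symmetric]) (intro continuous_intros f)
  finally show ?thesis .
qed

lemma fcoef_deriv_snd:
  assumes f: "continuous_on UNIV f" and f': "continuous_on UNIV f'" and per: "biperiodic f"
    and d: "\<And>x y. ((\<lambda>y. f (x, y)) has_vector_derivative f' (x, y)) (at y)"
  shows "fcoef f' k l = - \<i> * of_int l * fcoef f k l"
proof -
  have sc: "continuous_on UNIV (h \<circ> prod.swap)" if "continuous_on UNIV h"
    for h :: "real \<times> real \<Rightarrow> complex"
    by (intro continuous_on_compose continuous_on_subset[OF that] continuous_on_swap) auto
  have "fcoef (f' \<circ> prod.swap) l k = - \<i> * of_int l * fcoef (f \<circ> prod.swap) l k"
    by (rule fcoef_deriv_fst[OF sc[OF f] sc[OF f']]) (use per d in \<open>auto simp: biperiodic_def\<close>)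
  then show ?thesis by (simp add: fcoef_swap f f')
qed

text \<open>A product of characters is a character, so only coefficients of the constant 1 are
  needed. Its derivatives are zero, and the derivative rules then annihilate every coefficient with
  a non-zero index.\<close>

lemma fcoef_torus_char: "fcoef (torus_char k l) i j = (if k + i = 0
    \<and> l + j = 0 then of_real (4 * pi\<^sup>2) else 0)"
proof -
  have *: "fcoef (torus_char k l) i j = fcoef (\<lambda>p. 1) (k + i) (l + j)"
    unfolding fcoef_def torus_char_mult by simp
  have d: "fcoef (\<lambda>p. 0) m n = 0" for m n by (simp add: fcoef_def)
  have "fcoef (\<lambda>p. 0) m n = - \<i> * of_int m * fcoef (\<lambda>p. 1) m n"
       "fcoef (\<lambda>p. 0) m n = - \<i> * of_int n * fcoef (\<lambda>p. 1) m n" for m n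
    by (intro fcoef_deriv_fst fcoef_deriv_snd continuous_intros;
        simp add: biperiodic_def)+
  then have "fcoef (\<lambda>p. 1) m n = 0" if "m \<noteq> 0 \<or> n \<noteq> 0" for m n
    using that d by (metis complex_i_not_zero mult_eq_0_iff neg_equal_0_iff_equal of_int_eq_0_iff)
  moreover have "fcoef (\<lambda>p. 1) 0 0 = of_real (4 * pi\<^sup>2)"
    by (simp add: fcoef_def torus_box_def content_Pair scaleR_conv_of_real power2_eq_square)
  ultimately show ?thesis unfolding * by (cases "k + i = 0 \<and> l + j = 0") auto
qed

text \<open>The difference of the two sides has no Fourier coefficients, so uniqueness makes it
  vanish at every point.\<close>

lemma trig_poly_representation:
  assumes f: "continuous_on UNIV f" and per: "biperiodic f" and S: "finite S"
    and supp: "\<And>k l. (k, l) \<notin> S \<Longrightarrow> fcoef f (- k) (- l) = 0"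
  shows "f p = (\<Sum>(k, l)\<in>S. fcoef f (- k) (- l) / of_real (4 * pi\<^sup>2) * torus_char k l p)"
proof -
  define t where "t s p = (case s of (k, l) \<Rightarrow> fcoef f (- k) (- l) / of_real (4 * pi\<^sup>2) * torus_char k l
      p)" for s p
  have tc: "continuous_on UNIV (t s)" for s
    by (cases s) (auto simp: t_def intro!: continuous_intros)
  have tp: "biperiodic (t s)" for s
    using biperiodic_torus_char by (cases s) (auto simp: t_def biperiodic_def)
  define g where "g p = f p - (\<Sum>s\<in>S. t s p)" for p
  have "g p = 0"
  proof (rule fcoef_zero_imp_zero)
    show "continuous_on UNIV g" unfolding g_def by (intro continuous_intros f tc)
    show "biperiodic g" using per tp by (simp add: g_def biperiodic_def)
    fix k l
    have ft: "fcoef (t s) k l = (if s = (-k, -l) then fcoef f k l else 0)" for s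
    proof -
      obtain i j where s: "s = (i, j)" by force
      have "fcoef (t s) k l = fcoef f (- i) (- j) / of_real (4 * pi\<^sup>2) * fcoef (torus_char i j) k l"
        unfolding s t_def prod.case by (rule fcoef_cmult)
      then show ?thesis unfolding s fcoef_torus_char by (auto simp: add_eq_0_iff2)
    qed
    have "fcoef g k l = fcoef f k l - (\<Sum>s\<in>S. fcoef (t s) k l)"
      unfolding g_def by (simp add: fcoef_diff fcoef_sum f S tc continuous_on_sum)
    also have "(\<Sum>s\<in>S. fcoef (t s) k l) = (if (-k, -l) \<in> S then fcoef f k l else 0)"
      unfolding ft by (simp add: S)
    also have "\<dots> = fcoef f k l" using supp[of "-k" "-l"] by auto
    finally show "fcoef g k l = 0" by simp
  qed
  then show ?thesis by (simp add: g_def t_def split_def)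
qed

section \<open>Flat isometric immersions into spheres\<close>

lemma vinner_commute: "vinner N u v = vinner N v u"
  by (simp add: vinner_def mult.commute)

lemma vinner_cong:
  "(\<And>i. i < N \<Longrightarrow> u i = u' i) \<Longrightarrow> (\<And>i. i < N \<Longrightarrow> v i = v' i) \<Longrightarrow> vinner N u v = vinner N u' v'"
  by (simp add: vinner_def)

lemma vinner_add_left: "vinner N (\<lambda>i. u i + v i) w = vinner N u w + vinner N v w"
  by (simp add: vinner_def algebra_simps sum.distrib)

lemma vinner_add_right: "vinner N w (\<lambda>i. u i + v i) = vinner N w u + vinner N w v"
  by (simp add: vinner_def algebra_simps sum.distrib)

lemma vinner_diff_left: "vinner N (\<lambda>i. u i - v i) w = vinner N u w - vinner N v w"
  by (simp add: vinner_def algebra_simps sum_subtractf)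

lemma vinner_diff_right: "vinner N w (\<lambda>i. u i - v i) = vinner N w u - vinner N w v"
  by (simp add: vinner_def algebra_simps sum_subtractf)

lemma vinner_scale_left: "vinner N (\<lambda>i. c * u i) w = c * vinner N u w"
  by (simp add: vinner_def sum_distrib_left mult.assoc)

lemma vinner_scale_right: "vinner N w (\<lambda>i. c * u i) = c * vinner N w u"
  by (simp add: vinner_def sum_distrib_left mult_ac)

lemmas vinner_linear = vinner_add_left vinner_add_right vinner_diff_left vinner_diff_right
  vinner_scale_left vinner_scale_right

lemma vinner_self_eq_0: "vinner N u u = 0 \<longleftrightarrow> vzero N u"
  by (auto simp: vinner_def vzero_def sum_nonneg_eq_0_iff)

lemma vinner_self_nonneg: "vinner N u u \<ge> 0"
  by (auto simp: vinner_def intro!: sum_nonneg)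

text \<open>\<open>pdir\<close> rests on \<open>deriv\<close>, which has a value even where no
  derivative exists. This relation carries differentiability along, and constrains only the
  meaningful components.\<close>

definition has_pdir :: "nat \<Rightarrow> complex \<Rightarrow> (complex \<Rightarrow> nat \<Rightarrow> real) \<Rightarrow> (complex \<Rightarrow> nat \<Rightarrow> real) \<Rightarrow> bool" where
  "has_pdir N d F F' \<longleftrightarrow>
     (\<forall>z. \<forall>i<N. ((\<lambda>t::real. F (z + of_real t * d) i) has_real_derivative F' z i) (at 0))"

lemma has_pdir_imp_pdir: "has_pdir N d F F' \<Longrightarrow> i < N \<Longrightarrow> pdir d F z i = F' z i"
  unfolding has_pdir_def pdir_def by (blast intro: DERIV_imp_deriv)

lemma has_pdir_add:
  "has_pdir N d F F' \<Longrightarrow> has_pdir N d G G' \<Longrightarrow> has_pdir N d (\<lambda>z i. F z i + G z i) (\<lambda>z i. F' z i + G' z i)"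
  unfolding has_pdir_def by (auto intro: DERIV_add)

lemma has_pdir_cmult: "has_pdir N d F F' \<Longrightarrow> has_pdir N d (\<lambda>z i. c * F z i) (\<lambda>z i. c * F' z i)"
  unfolding has_pdir_def by (auto intro: DERIV_cmult)

lemma has_pdir_cong:
  assumes "has_pdir N d F F'" "\<And>z i. i < N \<Longrightarrow> F z i = G z i" "\<And>z i. i < N \<Longrightarrow> F' z i = G' z i"
  shows "has_pdir N d G G'"
  using assms unfolding has_pdir_def by simp

lemma has_pdir_vinner_const:
  assumes F: "has_pdir N d F F'" and G: "has_pdir N d G G'" and c: "\<And>z. vinner N (F z) (G z) = c"
  shows "vinner N (F' z) (G z) + vinner N (F z) (G' z) = 0"
proof -
  have "((\<lambda>t::real. \<Sum>i<N. F (z + of_real t * d) i * G (z + of_real t * d) i) has_real_derivative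
      (\<Sum>i<N. F' z i * G (z + of_real 0 * d) i + G' z i * F (z + of_real 0 * d) i)) (at 0)"
    using F G unfolding has_pdir_def by (intro DERIV_sum DERIV_mult) auto
  then have "((\<lambda>t::real. c) has_real_derivative (\<Sum>i<N. F' z i * G z i + G' z i * F z i)) (at 0)"
    using c by (simp add: vinner_def)
  then have "(\<Sum>i<N. F' z i * G z i + G' z i * F z i) = 0"
    using DERIV_unique DERIV_const by blast
  then show ?thesis by (simp add: vinner_def sum.distrib mult.commute)
qed

lemma pds_Nil [simp]: "pds [] F = F"
  by (simp add: pds_def)

lemma pds_Cons: "pds (d # ds) F = pdir d (pds ds F)"
  by (simp add: pds_def)

lemma smooth_map_has_pdir:
  assumes "smooth_map N F" "set ds \<subseteq> {1, \<i>}" "d \<in> {1, \<i>}"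
  shows "has_pdir N d (pds ds F) (pds (d # ds) F)"
  unfolding has_pdir_def
proof (intro allI impI)
  fix z i assume "i < N"
  then have "(\<lambda>t::real. pds ds F (z + of_real t * d) i) differentiable (at 0)"
    using assms unfolding smooth_map_def by blast
  then obtain D where "((\<lambda>t::real. pds ds F (z + of_real t * d) i) has_real_derivative D) (at 0)"
    using real_differentiable_def by blast
  then show "((\<lambda>t::real. pds ds F (z + of_real t * d) i) has_real_derivative pds (d # ds) F z i) (at 0)"
    unfolding pds_Cons pdir_def using DERIV_imp_deriv by metis
qed

lemma lattice_generators:
  "Complex (2 * pi) 0 \<in> lattice \<theta>" "Complex 0 (2 * pi * \<theta>) \<in> lattice \<theta>"
proof -
  have "\<exists>k l. Complex (2 * pi) 0 = Complex (2 * pi * of_int k) (2 * pi * of_int l * \<theta>)"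
    by (rule exI[of _ 1], rule exI[of _ 0]) simp
  then show "Complex (2 * pi) 0 \<in> lattice \<theta>" by (simp add: lattice_def)
  have "\<exists>k l. Complex 0 (2 * pi * \<theta>) = Complex (2 * pi * of_int k) (2 * pi * of_int l * \<theta>)"
    by (rule exI[of _ 0], rule exI[of _ 1]) simp
  then show "Complex 0 (2 * pi * \<theta>) \<in> lattice \<theta>" by (simp add: lattice_def)
qed

text \<open>The ambient dimension \<open>N\<close> is a parameter of its own so that it can be
  instantiated both by \<open>n + 1\<close> and by an even number \<open>2 * M\<close>.\<close>

locale flat_torus_immersion =
  fixes \<theta> :: real and n N :: nat and psi :: "complex \<Rightarrow> nat \<Rightarrow> real"
  assumes theta_pos: "\<theta> > 0" and N_eq: "n + 1 = N" and imm: "torus_immersion \<theta> n psi"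
begin

abbreviation ip :: "(nat \<Rightarrow> real) \<Rightarrow> (nat \<Rightarrow> real) \<Rightarrow> real" where "ip \<equiv> vinner N"

abbreviation P :: "complex list \<Rightarrow> complex \<Rightarrow> nat \<Rightarrow> real" where "P ds \<equiv> pds ds psi"

lemma smooth: "smooth_map N psi"
  using imm by (simp only: torus_immersion_def N_eq)

lemma P_has_pdir: "set ds \<subseteq> {1, \<i>} \<Longrightarrow> d \<in> {1, \<i>} \<Longrightarrow> has_pdir N d (P ds) (P (d # ds))"
  using smooth_map_has_pdir[OF smooth] .

lemma P_continuous: "set ds \<subseteq> {1, \<i>} \<Longrightarrow> i < N \<Longrightarrow> continuous_on UNIV (\<lambda>z. P ds z i)"
  using smooth unfolding smooth_map_def by blast

lemma P_periodic:
  assumes "w \<in> lattice \<theta>" "i < N"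
  shows "P ds (z + w) i = P ds z i"
proof (induction ds arbitrary: z)
  case Nil
  then show ?case using imm assms unfolding torus_immersion_def N_eq by simp
next
  case (Cons d ds)
  have "(\<lambda>t::real. P ds (z + w + of_real t * d) i) = (\<lambda>t. P ds (z + of_real t * d) i)"
    using Cons[of "z + of_real _ * d"] by (simp add: add_ac)
  then show ?case by (simp add: pds_Cons pdir_def)
qed

text \<open>The factor theta turns the lattice into the period lattice of \<open>biperiodic\<close>;
  the index \<open>l\<close> on the standard torus is the y-frequency \<open>l / \<theta>\<close>
  upstairs.\<close>

definition lift :: "complex list \<Rightarrow> nat \<Rightarrow> real \<times> real \<Rightarrow> complex" where
  "lift ds i p = of_real (P ds (Complex (fst p) (\<theta> * snd p)) i)"

lemma lift_continuous:
  assumes "set ds \<subseteq> {1, \<i>}" "i < N"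
  shows "continuous_on UNIV (lift ds i)"
  unfolding lift_def
  by (intro continuous_intros continuous_on_compose2[OF P_continuous[OF assms]]) auto

lemma lift_biperiodic: "i < N \<Longrightarrow> biperiodic (lift ds i)"
proof -
  assume i: "i < N"
  have *: "Complex (x + 2 * pi) (\<theta> * y) = Complex x (\<theta> * y) + Complex (2 * pi) 0"
    "Complex x (\<theta> * (y + 2 * pi)) = Complex x (\<theta> * y) + Complex 0 (2 * pi * \<theta>)" for x y
    by (auto simp: complex_eq_iff algebra_simps)
  show ?thesis unfolding biperiodic_def lift_def
    by (simp add: * P_periodic lattice_generators i)
qed

lemma lift_deriv_fst:
  assumes ds: "set ds \<subseteq> {1, \<i>}" and i: "i < N"
  shows "((\<lambda>x. lift ds i (x, y)) has_vector_derivative lift (1 # ds) i (x, y)) (at x)"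
proof -
  define z where "z = Complex x (\<theta> * y)"
  have "((\<lambda>t::real. P ds (z + of_real t * 1) i) has_real_derivative P (1 # ds) z i) (at 0)"
    using P_has_pdir[OF ds, of 1] i unfolding has_pdir_def by simp
  then have "((\<lambda>s::real. P ds (z + of_real (s - x)) i) has_real_derivative P (1 # ds) z i) (at (0 + x))"
    by (subst DERIV_shift) simp
  moreover have "z + of_real (s - x) = Complex s (\<theta> * y)" for s
    by (simp add: z_def complex_eq_iff)
  ultimately have "((\<lambda>s. P ds (Complex s (\<theta> * y)) i) has_real_derivative P (1 # ds) z i) (at x)"
    by simp
  then show ?thesis
    unfolding lift_def z_def by (simp add: has_vector_derivative_of_real
        has_real_derivative_iff_has_vector_derivative)
qed

lemma lift_deriv_snd:
  assumes ds: "set ds \<subseteq> {1, \<i>}" and i: "i < N"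
  shows "((\<lambda>y. lift ds i (x, y)) has_vector_derivative of_real \<theta> * lift (\<i> # ds) i (x, y)) (at y)"
proof -
  define z where "z = Complex x (\<theta> * y)"
  \<comment> \<open>The point 0 is written as \<open>\<theta> * (y - y)\<close> so that the chain
    rule can compose with the affine map \<open>\<theta> * (s - y)\<close>.\<close>
  have "((\<lambda>t::real. P ds (z + of_real t * \<i>) i) has_real_derivative P (\<i> # ds) z i) (at (\<theta> * (y - y)))"
    using P_has_pdir[OF ds, of \<i>] i unfolding has_pdir_def by simp
  moreover have "((\<lambda>s. \<theta> * (s - y)) has_real_derivative \<theta>) (at y)"
    by (auto intro!: derivative_eq_intros)
  ultimately have "((\<lambda>s. P ds (z + of_real (\<theta> * (s - y)) * \<i>) i) has_real_derivative P (\<i> # ds) z i * \<theta>)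
      (at y)"
    by (rule DERIV_chain2)
  moreover have "z + of_real (\<theta> * (s - y)) * \<i> = Complex x (\<theta> * s)" for s
    by (simp add: z_def complex_eq_iff algebra_simps)
  ultimately have "((\<lambda>s. P ds (Complex x (\<theta> * s)) i) has_real_derivative \<theta> * P (\<i> # ds) z i) (at y)"
    by (simp add: mult.commute)
  then have "((\<lambda>s. complex_of_real (P ds (Complex x (\<theta> * s)) i)) has_vector_derivative of_real (\<theta> * P (\<i> #
      ds) z i)) (at y)"
    by (intro has_vector_derivative_of_real) (simp add: has_real_derivative_iff_has_vector_derivative)
  then show ?thesis
    unfolding lift_def z_def by simp
qed

lemma fcoef_lift_Cons:
  assumes ds: "set ds \<subseteq> {1, \<i>}" and i: "i < N"
  shows "fcoef (lift (1 # ds) i) k l = - \<i> * of_int k * fcoef (lift ds i) k l"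
    and "fcoef (lift (\<i> # ds) i) k l = - \<i> * of_real (of_int l / \<theta>) * fcoef (lift ds i) k l"
proof -
  show "fcoef (lift (1 # ds) i) k l = - \<i> * of_int k * fcoef (lift ds i) k l"
    by (rule fcoef_deriv_fst) (use ds i in \<open>auto intro!: lift_continuous lift_biperiodic lift_deriv_fst\<close>)
  have "fcoef (\<lambda>p. of_real \<theta> * lift (\<i> # ds) i p) k l = - \<i> * of_int l * fcoef (lift ds i) k l"
    by (rule fcoef_deriv_snd)
       (use ds i in \<open>auto intro!: lift_continuous lift_biperiodic lift_deriv_snd continuous_intros\<close>)
  then have "of_real \<theta> * fcoef (lift (\<i> # ds) i) k l = - \<i> * of_int l * fcoef (lift ds i) k l"
    by (simp add: fcoef_cmult)
  then show "fcoef (lift (\<i> # ds) i) k l = - \<i> * of_real (of_int l / \<theta>) * fcoef (lift ds i) k l"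
    using theta_pos by (simp add: field_simps)
qed

text \<open>\<open>smooth_map\<close> does not assert symmetry of mixed partials. Both orders
  multiply the Fourier coefficients by the same factor, so uniqueness gives equality.\<close>

lemma mixed_partials_commute:
  assumes i: "i < N"
  shows "P [1, \<i>] z i = P [\<i>, 1] z i"
proof -
  have c: "continuous_on UNIV (lift [1, \<i>] i)" "continuous_on UNIV (lift [\<i>, 1] i)"
    using i by (auto intro!: lift_continuous)
  have "(\<lambda>p. lift [1, \<i>] i p - lift [\<i>, 1] i p) (Re z, Im z / \<theta>) = 0"
  proof (rule fcoef_zero_imp_zero)
    show "continuous_on UNIV (\<lambda>p. lift [1, \<i>] i p - lift [\<i>, 1] i p)"
      by (intro continuous_intros c)
    show "biperiodic (\<lambda>p. lift [1, \<i>] i p - lift [\<i>, 1] i p)"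
      using lift_biperiodic[OF i] by (simp add: biperiodic_def)
    show "fcoef (\<lambda>p. lift [1, \<i>] i p - lift [\<i>, 1] i p) k l = 0" for k l
      using i by (simp add: fcoef_diff c fcoef_lift_Cons)
  qed
  then show ?thesis using theta_pos by (simp add: lift_def)
qed

lemma ip_relations:
  "ip (psi z) (psi z) = 1" "ip (P [1] z) (P [1] z) = 1" "ip (P [\<i>] z) (P [\<i>] z) = 1"
  "ip (P [1] z) (P [\<i>] z) = 0"
  using imm unfolding torus_immersion_def N_eq by (auto simp: pds_Cons)

lemma ip_const:
  assumes "\<And>z. ip (P ds z) (P es z) = c" "set ds \<subseteq> {1, \<i>}" "set es \<subseteq> {1, \<i>}" "d \<in> {1, \<i>}"
  shows "ip (P (d # ds) z) (P es z) + ip (P (d # es) z) (P ds z) = 0"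
  using has_pdir_vinner_const[OF P_has_pdir P_has_pdir, of ds d es c z] assms
  by (simp add: vinner_commute[of N "P ds z" "P (d # es) z"])

lemma ip_first: "ip (P [1] z) (psi z) = 0" "ip (P [\<i>] z) (psi z) = 0"
  using ip_const[of "[]" "[]" 1 1 z] ip_const[of "[]" "[]" 1 \<i> z] ip_relations(1) by simp_all

lemma ip_second: "ip (P [1, 1] z) (psi z) = - 1" "ip (P [\<i>, \<i>] z) (psi z) = - 1"
  using ip_const[of "[1]" "[]" 0 1 z] ip_const[of "[\<i>]" "[]" 0 \<i> z] ip_first ip_relations(2,3)
  by simp_all

text \<open>This is the vanishing of the Christoffel symbols of the flat metric. For instance
  <psi_yy, psi_x> = - <psi_y, psi_xy>, which is minus half the x-derivative of the constant
  |psi_y|^2.\<close>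

lemma ip_second_first:
  "ip (P [1, 1] z) (P [1] z) = 0" "ip (P [\<i>, \<i>] z) (P [1] z) = 0"
  "ip (P [1, 1] z) (P [\<i>] z) = 0" "ip (P [\<i>, \<i>] z) (P [\<i>] z) = 0"
proof -
  have mixed: "ip (P [1, \<i>] z) u = ip (P [\<i>, 1] z) u" for u
    by (rule vinner_cong) (auto simp: mixed_partials_commute)
  show "ip (P [1, 1] z) (P [1] z) = 0" "ip (P [\<i>, \<i>] z) (P [\<i>] z) = 0"
    using ip_const[of "[1]" "[1]" 1 1 z] ip_const[of "[\<i>]" "[\<i>]" 1 \<i> z] ip_relations(2,3) by simp_all
  show "ip (P [\<i>, \<i>] z) (P [1] z) = 0"
    using ip_const[of "[\<i>]" "[\<i>]" 1 1 z] ip_const[of "[1]" "[\<i>]" 0 \<i> z] ip_relations(3,4) mixed[of "P [\<i>] z"]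
    by simp
  show "ip (P [1, 1] z) (P [\<i>] z) = 0"
    using ip_const[of "[1]" "[1]" 1 \<i> z] ip_const[of "[1]" "[\<i>]" 0 1 z] ip_relations(2,4) mixed[of "P [1] z"]
    by simp
qed

definition T :: "complex \<Rightarrow> nat \<Rightarrow> real" where
  "T z i = P [1, 1] z i + P [\<i>, \<i>] z i + 2 * psi z i"

text \<open>The iterated derivative of \<open>T\<close> along \<open>ds\<close>, spelled out in
  partials of \<open>psi\<close>.\<close>

definition dT :: "complex list \<Rightarrow> complex \<Rightarrow> nat \<Rightarrow> real" where
  "dT ds z i = P (ds @ [1, 1]) z i + P (ds @ [\<i>, \<i>]) z i + 2 * P ds z i"

lemma dT_Nil: "dT [] = T"
  by (simp add: dT_def T_def fun_eq_iff)

lemma dT_has_pdir: "set ds \<subseteq> {1, \<i>} \<Longrightarrow> d \<in> {1, \<i>} \<Longrightarrow> has_pdir N d (dT ds) (dT (d # ds))"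
proof -
  assume "set ds \<subseteq> {1, \<i>}" "d \<in> {1, \<i>}"
  then show ?thesis
    unfolding dT_def using P_has_pdir[of "ds @ [1,1]" d] P_has_pdir[of "ds @ [\<i>,\<i>]" d] P_has_pdir[of ds d]
    by (intro has_pdir_add has_pdir_cmult) auto
qed

text \<open>Each projection subtracts <psi_dd, psi> psi = - psi; the two directions together produce
  the term 2 psi.\<close>

lemma tension_eq: "tension N psi z i = T z i"
  using ip_second[of z] by (simp add: tension_def nabla_def tproj_def T_def pds_Cons)

lemma ip_T_left: "ip (T z) u = ip (P [1, 1] z) u + ip (P [\<i>, \<i>] z) u + 2 * ip (psi z) u"
proof -
  have "ip (T z) u = ip (\<lambda>i. P [1, 1] z i + P [\<i>, \<i>] z i + 2 * psi z i) u"
    by (rule vinner_cong) (auto simp: T_def)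
  then show ?thesis by (simp add: vinner_linear)
qed

lemma ip_T: "ip (T z) (psi z) = 0" "ip (T z) (P [1] z) = 0" "ip (T z) (P [\<i>] z) = 0"
  using ip_second[of z] ip_second_first[of z] ip_first[of z] ip_relations[of z]
    vinner_commute[of N "psi z" "P [1] z"] vinner_commute[of N "psi z" "P [\<i>] z"]
  unfolding ip_T_left by linarith+

text \<open>Differentiating <T, psi> = 0 and <T, psi_d> = 0 gives <T_d, psi> = 0 and <T_dd, psi> = -
  <T_d, psi_d> = <T, psi_dd>.\<close>

lemma ip_dT:
  assumes d: "d \<in> {1, \<i>}"
  shows "ip (dT [d] z) (psi z) = 0" "ip (dT [d, d] z) (psi z) = ip (T z) (P [d, d] z)"
proof -
  have 0: "ip (T z) (P [d] z) = 0" for z using d ip_T by auto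
  have T: "has_pdir N d T (dT [d])" "has_pdir N d (dT [d]) (dT [d, d])"
    using dT_has_pdir[of "[]" d] dT_has_pdir[of "[d]" d] d by (auto simp: dT_Nil)
  have psi: "has_pdir N d psi (P [d])" "has_pdir N d (P [d]) (P [d, d])"
    using P_has_pdir[of "[]" d] P_has_pdir[of "[d]" d] d by auto
  show 1: "ip (dT [d] z) (psi z) = 0" for z
    using has_pdir_vinner_const[OF T(1) psi(1) ip_T(1)] 0 by simp
  show "ip (dT [d, d] z) (psi z) = ip (T z) (P [d, d] z)"
    using has_pdir_vinner_const[OF T(2) psi(1) 1, of z] has_pdir_vinner_const[OF T(1) psi(2) 0, of z]
    by simp
qed

text \<open>T_d is already tangent to the sphere, so only the second covariant derivative has a
  normal part to remove.\<close>

lemma nabla_nabla_tension: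
  assumes d: "d \<in> {1, \<i>}" and i: "i < N"
  shows "nabla N psi d (nabla N psi d (tension N psi)) z i
       = dT [d, d] z i - ip (T z) (P [d, d] z) * psi z i"
proof -
  have T: "has_pdir N d (tension N psi) (dT [d])"
    by (rule has_pdir_cong[OF dT_has_pdir[of "[]" d]]) (use d in \<open>auto simp: dT_Nil tension_eq\<close>)
  have 1: "nabla N psi d (tension N psi) z i = dT [d] z i" if "i < N" for z i
  proof -
    have "ip (pdir d (tension N psi) z) (psi z) = ip (dT [d] z) (psi z)"
      by (rule vinner_cong) (auto simp: has_pdir_imp_pdir[OF T])
    then show ?thesis
      using that by (simp add: nabla_def tproj_def has_pdir_imp_pdir[OF T] ip_dT[OF d])
  qed
  have 2: "has_pdir N d (nabla N psi d (tension N psi)) (dT [d, d])"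
    by (rule has_pdir_cong[OF dT_has_pdir[of "[d]" d]]) (use d 1 in auto)
  have "ip (pdir d (nabla N psi d (tension N psi)) z) (psi z) = ip (dT [d, d] z) (psi z)"
    by (rule vinner_cong) (auto simp: has_pdir_imp_pdir[OF 2])
  then show ?thesis
    using i by (simp add: nabla_def[of N psi d "nabla N psi d _"] tproj_def has_pdir_imp_pdir[OF 2]
        ip_dT[OF d])
qed

text \<open>The two normal parts add up to <T, psi_xx + psi_yy> = |T|^2 because T is orthogonal to
  psi. As T is also normal to the surface, each curvature term equals - T, and the two together
  contribute 2 T.\<close>

lemma bitension_eq:
  assumes i: "i < N"
  shows "bitension N psi z i = dT [1, 1] z i + dT [\<i>, \<i>] z i + 2 * T z i - ip (T z) (T z) * psi z i"
proof -
  have "ip (T z) (T z) = ip (T z) (P [1, 1] z) + ip (T z) (P [\<i>, \<i>] z)"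
    using ip_T(1)[of z] ip_T_left[of z "T z"]
      vinner_commute[of N "T z" "P [1,1] z"] vinner_commute[of N "T z" "P [\<i>,\<i>] z"]
      vinner_commute[of N "T z" "psi z"] by simp
  moreover have "tension N psi = T" by (simp add: tension_eq fun_eq_iff)
  moreover have "pdir 1 psi = P [1]" "pdir \<i> psi = P [\<i>]" by (simp_all add: pds_Cons)
  ultimately show ?thesis
    using nabla_nabla_tension[of 1 i z] nabla_nabla_tension[of \<i> i z] i ip_T[of z] ip_relations[of z]
    by (simp add: bitension_def sphere_curv_def algebra_simps)
qed

end

section \<open>The spectrum of a CMC biharmonic torus\<close>

text \<open>Parseval's identity for a trigonometric polynomial \<open>g\<close>: expand
  \<open>g\<close> and integrate term by term against \<open>f\<close>.\<close>

lemma integral_mult_fcoef: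
  assumes f: "continuous_on UNIV f" and g: "continuous_on UNIV g" and per: "biperiodic g"
    and S: "finite S" and supp: "\<And>k l. (k, l) \<notin> S \<Longrightarrow> fcoef g (- k) (- l) = 0"
  shows "integral torus_box (\<lambda>p. g p * f p)
       = (\<Sum>(k, l)\<in>S. fcoef g (- k) (- l) * fcoef f k l / of_real (4 * pi\<^sup>2))"
proof -
  define t where "t s p = (case s of (k, l) \<Rightarrow> fcoef g (- k) (- l) / of_real (4 * pi\<^sup>2) * (f p * torus_char
      k l p))" for s p
  have tc: "continuous_on UNIV (t s)" for s
    by (cases s) (auto simp: t_def intro!: continuous_intros f)
  have ti: "integral torus_box (t s) = (case s of (k, l) \<Rightarrow> fcoef g (- k) (- l) * fcoef f k l / of_real (4
      * pi\<^sup>2))" for s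
  proof -
    obtain k l where s: "s = (k, l)" by force
    have "integral torus_box (t s) = fcoef g (- k) (- l) / of_real (4 * pi\<^sup>2) * fcoef f k l"
      unfolding s t_def prod.case fcoef_def[of f] by (rule integral_mult_right)
    then show ?thesis by (simp add: s)
  qed
  have "g p * f p = (\<Sum>s\<in>S. t s p)" for p
  proof -
    have "g p = (\<Sum>(k, l)\<in>S. fcoef g (- k) (- l) / of_real (4 * pi\<^sup>2) * torus_char k l p)"
      by (rule trig_poly_representation[OF g per S]) (rule supp)
    then have "g p * f p = (\<Sum>s\<in>S. (case s of (k, l) \<Rightarrow>
        fcoef g (- k) (- l) / of_real (4 * pi\<^sup>2) * torus_char k l p) * f p)"
      by (simp only: sum_distrib_right)
    also have "\<dots> = (\<Sum>s\<in>S. t s p)"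
      by (rule sum.cong) (auto simp: t_def)
    finally show ?thesis .
  qed
  then have "integral torus_box (\<lambda>p. g p * f p) = (\<Sum>s\<in>S. integral torus_box (t s))"
    by (simp add: integral_sum S integrable_torus_box tc)
  then show ?thesis by (simp add: ti)
qed

lemma fcoef_cnj:
  assumes f: "continuous_on UNIV f" and real: "\<And>p. cnj (f p) = f p"
  shows "fcoef f (- k) (- l) = cnj (fcoef f k l)"
proof -
  have "cnj (fcoef f k l) = integral torus_box (cnj \<circ> (\<lambda>p. f p * torus_char k l p))"
    unfolding fcoef_def
    by (intro integral_linear[symmetric] integrable_torus_box bounded_linear_cnj continuous_intros f)
  also have "cnj \<circ> (\<lambda>p. f p * torus_char k l p) = (\<lambda>p. f p * torus_char (- k) (- l) p)"
    by (auto simp: fun_eq_iff real torus_char_def cis_cnj)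
  finally show ?thesis by (simp add: fcoef_def)
qed

text \<open>A real plane wave with frequency vector (1, c). The x-frequency is built in because the
  spectrum allows only 1 and -1, and conjugation folds the latter into the former.\<close>

definition wave :: "real \<Rightarrow> real \<Rightarrow> real \<Rightarrow> complex \<Rightarrow> real" where
  "wave c A B z = A * cos (Re z + c * Im z) + B * sin (Re z + c * Im z)"

lemma wave_deriv:
  "((\<lambda>t. wave c A B (z + of_real t * 1)) has_real_derivative wave c B (- A) z) (at 0)"
  "((\<lambda>t. wave c A B (z + of_real t * \<i>)) has_real_derivative wave c (c * B) (- (c * A)) z) (at 0)"
  unfolding wave_def by (auto intro!: derivative_eq_intros)

lemma has_pdir_sum_wave:
  "has_pdir N 1 (\<lambda>z i. \<Sum>l\<in>L. wave (c l) (A l i) (B l i) z) (\<lambda>z i. \<Sum>l\<in>L. wave (c l) (B l i) (- A l i) z)"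
  "has_pdir N \<i> (\<lambda>z i. \<Sum>l\<in>L. wave (c l) (A l i) (B l i) z)
     (\<lambda>z i. \<Sum>l\<in>L. wave (c l) (c l * B l i) (- (c l * A l i)) z)"
  unfolding has_pdir_def by (intro allI impI DERIV_sum wave_deriv)+

lemma wave_scale: "wave c (r * A) (r * B) z = r * wave c A B z"
  by (simp add: wave_def algebra_simps)

locale cmc_biharmonic_torus = flat_torus_immersion +
  fixes h :: real
  assumes h: "0 < h" "h < 1"
    and T_norm: "\<And>z. ip (T z) (T z) = 4 * h\<^sup>2"
    and biharm: "\<And>z i. i < N \<Longrightarrow> dT [1, 1] z i + dT [\<i>, \<i>] z i + 2 * T z i - 4 * h\<^sup>2 * psi z i = 0"
begin

text \<open>The eigenvalue of minus the Laplacian on the character with frequency (k, l /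
  theta).\<close>

definition freq :: "int \<Rightarrow> int \<Rightarrow> real" where
  "freq k l = (of_int k)\<^sup>2 + (of_int l / \<theta>)\<^sup>2"

text \<open>With lambda = \<open>freq k l\<close>, the equation \<open>biharm\<close> reads ((lambda
  - 2)^2 - 4 h^2) c = 0 on coefficients.\<close>

lemma fcoef_support:
  assumes i: "i < N" and nz: "fcoef (lift [] i) k l \<noteq> 0"
  shows "freq k l = 2 * (1 - h) \<or> freq k l = 2 * (1 + h)"
proof -
  define C where "C = fcoef (lift [] i) k l"
  have 1: "(- \<i> * of_int k) * (- \<i> * of_int k) = - of_real ((of_int k)\<^sup>2)"
    "(- \<i> * of_real (of_int l / \<theta>)) * (- \<i> * of_real (of_int l / \<theta>)) = - of_real ((of_int l / \<theta>)\<^sup>2)"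
    by (simp_all add: power2_eq_square complex_eq_iff)
  have second: "fcoef (lift (1 # 1 # ds) i) k l = - of_real ((of_int k)\<^sup>2) * fcoef (lift ds i) k l"
    "fcoef (lift (\<i> # \<i> # ds) i) k l = - of_real ((of_int l / \<theta>)\<^sup>2) * fcoef (lift ds i) k l"
    if "set ds \<subseteq> {1, \<i>}" for ds
    unfolding 1[symmetric] using that i by (simp_all add: fcoef_lift_Cons del: of_real_divide)
  define G where "G p = lift [1,1,1,1] i p + (lift [1,1,\<i>,\<i>] i p + (lift [\<i>,\<i>,1,1] i p + (lift [\<i>,\<i>,\<i>,\<i>] i p
     + (4 * lift [1,1] i p + (4 * lift [\<i>,\<i>] i p + of_real (4 - 4 * h\<^sup>2) * lift [] i p)))))" for p
  have "G p = 0" for p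
  proof -
    define z where "z = Complex (fst p) (\<theta> * snd p)"
    have "G p = of_real (dT [1, 1] z i + dT [\<i>, \<i>] z i + 2 * T z i - 4 * h\<^sup>2 * psi z i)"
      by (simp add: G_def lift_def dT_def T_def z_def algebra_simps)
    then show ?thesis using biharm[OF i] by simp
  qed
  then have "G = (\<lambda>p. 0)" by auto
  then have "0 = fcoef G k l" by (simp add: fcoef_def)
  also have "\<dots> = fcoef (lift [1,1,1,1] i) k l + (fcoef (lift [1,1,\<i>,\<i>] i) k l + (fcoef (lift [\<i>,\<i>,1,1] i) k l
      + (fcoef (lift [\<i>,\<i>,\<i>,\<i>] i) k l + (4 * fcoef (lift [1,1] i) k l + (4 * fcoef (lift [\<i>,\<i>] i) k l
      + of_real (4 - 4 * h\<^sup>2) * fcoef (lift [] i) k l)))))"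
    unfolding G_def using i
    by (simp only: fcoef_add fcoef_cmult lift_continuous continuous_on_add continuous_on_mult_left
        list.set empty_subsetI insert_subset insertI1 insert_iff simp_thms)
  also have "\<dots> = of_real ((freq k l - 2 * (1 - h)) * (freq k l - 2 * (1 + h))) * C"
    unfolding C_def freq_def by (simp add: second del: of_real_divide of_real_power)
      (simp add: algebra_simps power2_eq_square add_divide_distrib)
  finally have "(freq k l - 2 * (1 - h)) * (freq k l - 2 * (1 + h)) = 0"
    using nz by (metis C_def mult_eq_0_iff of_real_eq_0_iff)
  then show ?thesis by simp
qed

definition S :: "(int \<times> int) set" where
  "S = {(k, l). freq k l = 2 * (1 - h) \<or> freq k l = 2 * (1 + h)}"

lemma S_bound: "(k, l) \<in> S \<Longrightarrow> freq k l < 4"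
  using h by (auto simp: S_def)

lemma S_k: 
  assumes "(k, l) \<in> S" shows "k \<in> {-1, 0, 1}"
proof -
  have "(of_int k)\<^sup>2 < (4::real)" using S_bound[OF assms] by (simp add: freq_def add_strict_increasing2)
    (smt (verit) zero_le_power2)
  then have "k\<^sup>2 < 2\<^sup>2" by (simp flip: of_int_power)
  then have "\<bar>k\<bar> < 2" by (metis abs_of_nonneg power2_abs power_less_imp_less_base zero_le_numeral)
  then show ?thesis by auto
qed

lemma finite_S: "finite S"
proof (rule finite_subset)
  define M where "M = \<lceil>2 * \<theta>\<rceil>"
  show "S \<subseteq> {-1, 0, 1} \<times> {-M..M}"
  proof clarify
    fix k l assume kl: "(k, l) \<in> S"
    have "(of_int l / \<theta>)\<^sup>2 < 2\<^sup>2"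
      using S_bound[OF kl] by (simp add: freq_def) (smt (verit) zero_le_power2)
    then have "\<bar>of_int l / \<theta>\<bar> < 2" by (metis abs_numeral power2_abs power_less_imp_less_base zero_le_numeral)
    then have "\<bar>of_int l\<bar> < 2 * \<theta>" using theta_pos by (simp add: field_simps)
    then have "l \<in> {-M..M}" unfolding M_def by auto linarith+
    then show "k \<in> {-1, 0, 1} \<and> l \<in> {-M..M}" using S_k[OF kl] by simp
  qed
qed simp

lemma fcoef_S: "i < N \<Longrightarrow> (k, l) \<notin> S \<Longrightarrow> fcoef (lift [] i) (- k) (- l) = 0"
  using fcoef_support[of i "-k" "-l"] by (auto simp: S_def freq_def)

text \<open>Since \<open>k\<^sup>2 \<le> 1\<close> on the spectrum, integrating \<open>\<langle>\<psi>\<^sub>x\<^sub>x + \<psi>, \<psi>\<rangle> = 0\<close> leaves a sum of non-negative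
  terms \<open>(1 - k\<^sup>2)|c|\<^sup>2\<close>.\<close>

lemma fcoef_k_one:
  assumes i: "i < N" and nz: "fcoef (lift [] i) k l \<noteq> 0"
  shows "k = 1 \<or> k = -1"
proof -
  define c where "c j s = fcoef (lift [] j) (fst s) (snd s)" for j s
  define g where "g j p = lift [1, 1] j p + lift [] j p" for j p
  have lc: "continuous_on UNIV (lift [1, 1] j)" "continuous_on UNIV (lift [] j)" "continuous_on UNIV (g j)"
    if "j < N" for j
    unfolding g_def using that by (auto intro!: lift_continuous continuous_intros)
  have g: "fcoef (g j) k l = of_real (1 - (of_int k)\<^sup>2) * fcoef (lift [] j) k l" if "j < N" for j k l
    unfolding g_def using that by (simp add: fcoef_add lc fcoef_lift_Cons algebra_simps power2_eq_square)
  have "integral torus_box (\<lambda>p. g j p * lift [] j p)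
      = (\<Sum>(k, l)\<in>S. fcoef (g j) (- k) (- l) * fcoef (lift [] j) k l / of_real (4 * pi\<^sup>2))" if "j < N" for j
    by (rule integral_mult_fcoef[OF lc(2,3) _ finite_S])
       (use that lift_biperiodic fcoef_S in \<open>auto simp: g\<close>, auto simp: g_def biperiodic_def)
  also have "(\<Sum>(k, l)\<in>S. fcoef (g j) (- k) (- l) * fcoef (lift [] j) k l / of_real (4 * pi\<^sup>2))
      = of_real (\<Sum>s\<in>S. (1 - (of_int (fst s))\<^sup>2) * (cmod (c j s))\<^sup>2 / (4 * pi\<^sup>2))" if "j < N" for j
  proof -
    have "fcoef (g j) (- k) (- l) * fcoef (lift [] j) k l
        = of_real ((1 - (of_int k)\<^sup>2) * (cmod (c j (k, l)))\<^sup>2)" for k l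
    proof -
      have "fcoef (g j) (- k) (- l) * fcoef (lift [] j) k l
          = of_real (1 - (of_int k)\<^sup>2) * (fcoef (lift [] j) k l * cnj (fcoef (lift [] j) k l))"
        using fcoef_cnj[OF lc(2)[OF that], of k l] that by (simp add: g lift_def mult_ac)
      then show ?thesis unfolding complex_norm_square[symmetric] by (simp add: c_def)
    qed
    then show ?thesis by (auto intro!: sum.cong)
  qed
  finally have int: "integral torus_box (\<lambda>p. g j p * lift [] j p)
      = of_real (\<Sum>s\<in>S. (1 - (of_int (fst s))\<^sup>2) * (cmod (c j s))\<^sup>2 / (4 * pi\<^sup>2))" if "j < N" for j
    using that by blast
  have "(\<Sum>j<N. g j p * lift [] j p) = 0" for p
  proof -
    define z where "z = Complex (fst p) (\<theta> * snd p)"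
    have "(\<Sum>j<N. g j p * lift [] j p) = of_real (ip (P [1, 1] z) (psi z) + ip (psi z) (psi z))"
      by (simp add: g_def lift_def z_def vinner_def sum.distrib algebra_simps)
    then show ?thesis by (simp add: ip_second ip_relations)
  qed
  then have "0 = integral torus_box (\<lambda>p. \<Sum>j<N. g j p * lift [] j p)" by simp
  also have "\<dots> = (\<Sum>j<N. integral torus_box (\<lambda>p. g j p * lift [] j p))"
    by (intro integral_sum) (auto intro!: integrable_torus_box continuous_intros lc)
  also have "\<dots> = of_real (\<Sum>j<N. \<Sum>s\<in>S. (1 - (of_int (fst s))\<^sup>2) * (cmod (c j s))\<^sup>2 / (4 * pi\<^sup>2))"
    by (simp add: int)
  finally have zero: "(\<Sum>j<N. \<Sum>s\<in>S. (1 - (of_int (fst s))\<^sup>2) * (cmod (c j s))\<^sup>2 / (4 * pi\<^sup>2)) = 0"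
    unfolding of_real_eq_0_iff[where 'a = complex, symmetric] by (rule sym)
  have nonneg: "(1 - (of_int (fst s))\<^sup>2) * (cmod (c j s))\<^sup>2 / (4 * pi\<^sup>2) \<ge> 0" if "s \<in> S" for s j
    using S_k[of "fst s" "snd s"] that by auto
  have "\<forall>j<N. \<forall>s\<in>S. (1 - (of_int (fst s))\<^sup>2) * (cmod (c j s))\<^sup>2 / (4 * pi\<^sup>2) = 0"
    using zero nonneg by (simp add: sum_nonneg_eq_0_iff sum_nonneg finite_S)
  moreover have "(k, l) \<in> S" using fcoef_support[OF i nz] by (simp add: S_def)
  ultimately have "(1 - (of_int k)\<^sup>2) * (cmod (c i (k, l)))\<^sup>2 / (4 * pi\<^sup>2) = 0" using i by fastforce
  then have "(of_int k :: real)\<^sup>2 = 1" using nz by (simp add: c_def)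
  then have "k\<^sup>2 = 1" by (metis of_int_eq_1_iff of_int_power)
  then show ?thesis by (simp add: power2_eq_1_iff)
qed

definition L1 :: "int set" where "L1 = {l. (of_int l / \<theta>)\<^sup>2 = 1 - 2 * h}"
definition L2 :: "int set" where "L2 = {l. (of_int l / \<theta>)\<^sup>2 = 1 + 2 * h}"

lemma finite_L: "finite (L1 \<union> L2)"
proof (rule finite_subset)
  show "L1 \<union> L2 \<subseteq> snd ` S"
  proof
    fix l assume "l \<in> L1 \<union> L2"
    then have "(1, l) \<in> S" by (auto simp: L1_def L2_def S_def freq_def)
    then show "l \<in> snd ` S" by force
  qed
qed (simp add: finite_S)

text \<open>Since \<open>psi\<close> is real, the terms at (1, l) and (-1, -l) are conjugate, and c
  e^(it) plus its conjugate is 2 Re c cos t - 2 Im c sin t.\<close>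

lemma psi_wave_sum:
  obtains A B where "\<And>z i. i < N \<Longrightarrow> psi z i = (\<Sum>l\<in>L1 \<union> L2. wave (of_int l / \<theta>) (A l i) (B l i) z)"
proof -
  define a where "a i k l = fcoef (lift [] i) (- k) (- l) / of_real (4 * pi\<^sup>2)" for i k l
  have "psi z i = (\<Sum>l\<in>L1 \<union> L2. wave (of_int l / \<theta>) (2 * Re (a i 1 l)) (- 2 * Im (a i 1 l)) z)"
    if i: "i < N" for z i
  proof -
    define p where "p = (Re z, Im z / \<theta>)"
    have lc: "continuous_on UNIV (lift [] i)" using i by (auto intro!: lift_continuous)
    have "lift [] i p = (\<Sum>(k, l)\<in>{1, -1} \<times> (L1 \<union> L2). a i k l * torus_char k l p)"
      unfolding a_def
    proof (rule trig_poly_representation[where f = "lift [] i"])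
      fix k l :: int assume "(k, l) \<notin> {1, -1} \<times> (L1 \<union> L2)"
      then show "fcoef (lift [] i) (- k) (- l) = 0"
        using fcoef_k_one[OF i, of "-k" "-l"] fcoef_support[OF i, of "-k" "-l"]
        by (cases "fcoef (lift [] i) (- k) (- l) = 0") (auto simp: L1_def L2_def freq_def)
    qed (use i in \<open>auto simp: finite_L lc intro: lift_biperiodic finite_subset[OF _ finite_L]\<close>)
    also have "\<dots> = (\<Sum>k\<in>{1, -1}. \<Sum>l\<in>L1 \<union> L2. a i k l * torus_char k l p)"
      by (simp add: sum.cartesian_product)
    also have "\<dots> = (\<Sum>l\<in>L1 \<union> L2. a i 1 l * torus_char 1 l p) + (\<Sum>l\<in>L1 \<union> L2. a i (-1) l * torus_char (-1) l p)"
      by simp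
    \<comment> \<open>\<open>L1\<close> and \<open>L2\<close> are symmetric under negation; the
      reindexing aligns each term with its conjugate partner.\<close>
    also have "(\<Sum>l\<in>L1 \<union> L2. a i (-1) l * torus_char (-1) l p)
        = (\<Sum>l\<in>L1 \<union> L2. a i (-1) (- l) * torus_char (-1) (- l) p)"
      by (rule sum.reindex_bij_witness[of _ uminus uminus]) (auto simp: L1_def L2_def)
    also have "\<dots> = (\<Sum>l\<in>L1 \<union> L2. cnj (a i 1 l * torus_char 1 l p))"
    proof (rule sum.cong)
      fix l
      have "a i (-1) (- l) = cnj (a i 1 l)"
        using fcoef_cnj[OF lc, of "-1" "-l"] by (simp add: a_def lift_def)
      then show "a i (-1) (- l) * torus_char (-1) (- l) p = cnj (a i 1 l * torus_char 1 l p)"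
        by (simp add: torus_char_def cis_cnj)
    qed simp
    finally have "lift [] i p = (\<Sum>l\<in>L1 \<union> L2. a i 1 l * torus_char 1 l p + cnj (a i 1 l * torus_char 1 l p))"
      by (simp only: sum.distrib)
    also have "\<dots> = of_real (\<Sum>l\<in>L1 \<union> L2. wave (of_int l / \<theta>) (2 * Re (a i 1 l)) (- 2 * Im (a i 1 l)) z)"
      unfolding of_real_sum
    proof (rule sum.cong)
      fix l
      show "a i 1 l * torus_char 1 l p + cnj (a i 1 l * torus_char 1 l p)
         = of_real (wave (of_int l / \<theta>) (2 * Re (a i 1 l)) (- 2 * Im (a i 1 l)) z)"
        by (simp add: complex_eq_iff wave_def torus_char_def p_def algebra_simps)
    qed simp
    finally show ?thesis using theta_pos
        by (simp only: lift_def pds_Nil p_def fst_conv snd_conv of_real_eq_iff) simp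
  qed
  then show thesis
    by (rule that[of "\<lambda>l i. 2 * Re (a i 1 l)" "\<lambda>l i. - 2 * Im (a i 1 l)"])
qed

end

section \<open>Orthogonality of the coefficient vectors\<close>

lemma quadratic_trig_const:
  fixes A B C K :: real
  assumes "\<And>t. A * (cos t)\<^sup>2 + B * (cos t * sin t) + C * (sin t)\<^sup>2 = K"
  shows "A = K" "C = K" "B = 0"
proof -
  show A: "A = K" using assms[of 0] by simp
  show C: "C = K" using assms[of "pi / 2"] by simp
  have "A * (1/2) + B * (1/2) + C * (1/2) = K"
    using assms[of "pi / 4"] by (simp add: cos_45 sin_45 power_divide)
  then show "B = 0" using A C by simp
qed

text \<open>After rescaling to frequencies r < 1 and 1, the even and odd parts in y vanish
  separately. At pi/2 and pi one term of each part drops out, while the other keeps a non-zero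
  factor because r < 1. For alpha = 0 the functions multiplied by \<open>Z\<close> and
  \<open>W\<close> are identically zero, hence the extra condition there.\<close>

lemma product_trig_zero:
  fixes X Y Z W \<alpha> \<beta> :: real
  assumes 0: "\<And>y. X * (cos (\<alpha> * y) * cos (\<beta> * y)) + Y * (cos (\<alpha> * y) * sin (\<beta> * y))
      + Z * (sin (\<alpha> * y) * cos (\<beta> * y)) + W * (sin (\<alpha> * y) * sin (\<beta> * y)) = 0"
    and "0 \<le> \<alpha>" "\<alpha> < \<beta>"
  shows "X = 0" "Y = 0" "\<alpha> > 0 \<Longrightarrow> Z = 0" "\<alpha> > 0 \<Longrightarrow> W = 0"
proof -
  have b: "\<beta> > 0" using assms by linarith
  define r where "r = \<alpha> / \<beta>"
  have r: "0 \<le> r" "r < 1" using assms b by (auto simp: r_def)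
  show X: "X = 0" using 0[of 0] by simp
  have at: "X * cos (r * t) * cos t + W * sin (r * t) * sin t = 0"
    "Y * cos (r * t) * sin t + Z * sin (r * t) * cos t = 0" for t
  proof -
    have "\<alpha> * (t / \<beta>) = r * t" "\<beta> * (t / \<beta>) = t" "\<alpha> * (- t / \<beta>) = - (r * t)" "\<beta> * (- t / \<beta>) = - t"
      using b by (auto simp: r_def)
    then have "X * (cos (r * t) * cos t) + Y * (cos (r * t) * sin t)
      + Z * (sin (r * t) * cos t) + W * (sin (r * t) * sin t) = 0"
      "X * (cos (r * t) * cos t) - Y * (cos (r * t) * sin t)
      - Z * (sin (r * t) * cos t) + W * (sin (r * t) * sin t) = 0"
      using 0[of "t / \<beta>"] 0[of "- t / \<beta>"] by simp_all
    then show "X * cos (r * t) * cos t + W * sin (r * t) * sin t = 0"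
      "Y * cos (r * t) * sin t + Z * sin (r * t) * cos t = 0"
      by (simp_all add: mult.assoc)
  qed
  have "cos (r * (pi / 2)) > 0" using r
      by (intro cos_gt_zero_pi) (auto simp: field_simps intro: less_le_trans[of _ 0])
  then show Y: "Y = 0" using at(2)[of "pi / 2"] by simp
  assume "\<alpha> > 0"
  then have r0: "r > 0" using b by (simp add: r_def)
  have "sin (r * pi) > 0" using r r0 by (intro sin_gt_zero) auto
  then show "Z = 0" using at(2)[of pi] Y by simp
  have "sin (r * (pi / 2)) > 0"
    using r r0 by (intro sin_gt_zero) (auto simp: field_simps intro: less_le_trans[of _ pi])
  then show "W = 0" using at(1)[of "pi / 2"] X by simp
qed

text \<open>The vectors are the values on the line x = 0 of two waves of opposite y-frequency and of
  their x-derivative, as functions of the phase t. Comparing coefficients gives nine linear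
  equations for ten inner products; only the split between |a|^2 and |a'|^2 stays free.\<close>

lemma wave_pair_orthogonal:
  fixes a b a' b' :: "nat \<Rightarrow> real"
  assumes PP: "\<And>t. vinner N (\<lambda>i. cos t * (a i + a' i) + sin t * (b i - b' i)) (\<lambda>i. cos t * (a i + a' i)
      + sin t * (b i - b' i)) = K"
    and QQ: "\<And>t. vinner N (\<lambda>i. cos t * (b i + b' i) + sin t * (a' i - a i)) (\<lambda>i. cos t * (b i + b' i)
        + sin t * (a' i - a i)) = K"
    and PQ: "\<And>t. vinner N (\<lambda>i. cos t * (a i + a' i) + sin t * (b i - b' i)) (\<lambda>i. cos t * (b i + b' i)
        + sin t * (a' i - a i)) = 0"
  shows "vinner N a a = vinner N b b" "vinner N a' a' = vinner N b' b'" "vinner N a a + vinner N a' a' = K"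
    "vinner N a b = 0" "vinner N a a' = 0" "vinner N a b' = 0" "vinner N b a' = 0" "vinner N b b' = 0"
        "vinner N a' b' = 0"
proof -
  let ?v = "vinner N"
  define p where "p = (\<lambda>i. a i + a' i)"
  define p' where "p' = (\<lambda>i. b i - b' i)"
  define q where "q = (\<lambda>i. b i + b' i)"
  define q' where "q' = (\<lambda>i. a' i - a i)"
  have *: "?v (\<lambda>i. cos t * u i + sin t * v i) (\<lambda>i. cos t * x i + sin t * y i)
     = ?v u x * (cos t)\<^sup>2 + (?v u y + ?v v x) * (cos t * sin t) + ?v v y * (sin t)\<^sup>2" for u v x y t
    by (simp add: vinner_linear algebra_simps power2_eq_square)
  have c: "?v b a = ?v a b" "?v a' a = ?v a a'" "?v b' a = ?v a b'" "?v a' b = ?v b a'"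
      "?v b' b = ?v b b'" "?v b' a' = ?v a' b'"
    by (rule vinner_commute)+
  have PP': "?v p p * (cos t)\<^sup>2 + (?v p p' + ?v p' p) * (cos t * sin t) + ?v p' p' * (sin t)\<^sup>2 = K"
    and QQ': "?v q q * (cos t)\<^sup>2 + (?v q q' + ?v q' q) * (cos t * sin t) + ?v q' q' * (sin t)\<^sup>2 = K"
    and PQ': "?v p q * (cos t)\<^sup>2 + (?v p q' + ?v p' q) * (cos t * sin t) + ?v p' q' * (sin t)\<^sup>2 = 0" for t
    using PP[of t] QQ[of t] PQ[of t] by (simp_all only: *[symmetric] p_def p'_def q_def q'_def)
  note e = quadratic_trig_const[OF PP'] quadratic_trig_const[OF QQ'] quadratic_trig_const[OF PQ']
  note e = e[unfolded p_def p'_def q_def q'_def vinner_linear c]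
  show "?v a a = ?v b b" "?v a' a' = ?v b' b'" "?v a a + ?v a' a' = K"
    "?v a b = 0" "?v a a' = 0" "?v a b' = 0" "?v b a' = 0" "?v b b' = 0" "?v a' b' = 0"
    using e by linarith+
qed

lemma vinner_product_trig_zero:
  fixes p p' q q' :: "nat \<Rightarrow> real"
  assumes 0: "\<And>y. vinner N (\<lambda>i. cos (\<alpha> * y) * p i + sin (\<alpha> * y) * p' i) (\<lambda>i. cos (\<beta> * y) * q i
      + sin (\<beta> * y) * q' i) = 0"
    and ab: "0 \<le> \<alpha>" "\<alpha> < \<beta>"
  shows "vinner N p q = 0" "vinner N p q' = 0" "\<alpha> > 0 \<Longrightarrow> vinner N p' q = 0" "\<alpha> > 0 \<Longrightarrow> vinner N p' q' = 0"
proof -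
  have "vinner N p q * (cos (\<alpha> * y) * cos (\<beta> * y)) + vinner N p q' * (cos (\<alpha> * y) * sin (\<beta> * y))
      + vinner N p' q * (sin (\<alpha> * y) * cos (\<beta> * y)) + vinner N p' q' * (sin (\<alpha> * y) * sin (\<beta> * y)) = 0" for y
    using 0[of y] unfolding vinner_linear by (simp add: algebra_simps)
  from product_trig_zero[OF this ab]
  show "vinner N p q = 0" "vinner N p q' = 0" "\<alpha> > 0 \<Longrightarrow> vinner N p' q = 0" "\<alpha> > 0 \<Longrightarrow> vinner N p' q' = 0"
    by blast+
qed

context cmc_biharmonic_torus
begin

text \<open>\<open>T\<close> acts diagonally: the Laplacian multiplies a wave by - (1 + c^2), to
  which 2 is added.\<close>

lemma wave_sum_derivs:
  fixes A B :: "'l \<Rightarrow> nat \<Rightarrow> real"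
  assumes psi: "\<And>z i. i < N \<Longrightarrow> psi z i = (\<Sum>l\<in>L. wave (c l) (A l i) (B l i) z)" and i: "i < N"
  shows "P [1] z i = (\<Sum>l\<in>L. wave (c l) (B l i) (- A l i) z)"
    and "P [\<i>] z i = (\<Sum>l\<in>L. wave (c l) (c l * B l i) (- (c l * A l i)) z)"
    and "T z i = (\<Sum>l\<in>L. (1 - (c l)\<^sup>2) * wave (c l) (A l i) (B l i) z)"
proof -
  have P1: "P [1] z i = (\<Sum>l\<in>L. wave (c l) (B l i) (- A l i) z)" if "i < N" for z i
    unfolding pds_Cons pds_Nil
    by (rule has_pdir_imp_pdir[OF has_pdir_cong[OF has_pdir_sum_wave(1)[of N c A B L]] that]) (simp_all
        add: psi)
  have Pi: "P [\<i>] z i = (\<Sum>l\<in>L. wave (c l) (c l * B l i) (- (c l * A l i)) z)" if "i < N" for z i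
    unfolding pds_Cons pds_Nil
    by (rule has_pdir_imp_pdir[OF has_pdir_cong[OF has_pdir_sum_wave(2)[of N c A B L]] that]) (simp_all
        add: psi)
  have P11: "P [1, 1] z i = (\<Sum>l\<in>L. wave (c l) (- A l i) (- B l i) z)"
    unfolding pds_Cons[of _ "[1]"]
    by (rule has_pdir_imp_pdir[OF has_pdir_cong[OF has_pdir_sum_wave(1)[of N c B "\<lambda>l i. - A l i" L]] i])
        (simp_all add: P1)
  have Pii: "P [\<i>, \<i>] z i = (\<Sum>l\<in>L. wave (c l) (c l * (- (c l * A l i))) (- (c l * (c l * B l i))) z)"
    unfolding pds_Cons[of _ "[\<i>]"]
    by (rule has_pdir_imp_pdir[OF has_pdir_cong[OF has_pdir_sum_wave(2)[of N c "\<lambda>l i. c l * B l i"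
        "\<lambda>l i. - (c l * A l i)" L]] i])
       (simp_all add: Pi)
  show "P [1] z i = (\<Sum>l\<in>L. wave (c l) (B l i) (- A l i) z)"
    "P [\<i>] z i = (\<Sum>l\<in>L. wave (c l) (c l * B l i) (- (c l * A l i)) z)"
    using P1 Pi i by auto
  show "T z i = (\<Sum>l\<in>L. (1 - (c l)\<^sup>2) * wave (c l) (A l i) (B l i) z)"
    unfolding T_def P11 Pii psi[OF i]
    by (simp add: sum_distrib_left wave_def algebra_simps power2_eq_square flip: sum.distrib)
qed

text \<open>Both circles must occur: with only one of them, T would be a non-zero multiple of psi,
  contradicting <T, psi> = 0. On each circle the square of the integer \<open>l\<close> is fixed, so
  \<open>l\<close> is determined up to sign.\<close>

lemma frequencies:
  obtains q1 q2 :: nat where "(real q1 / \<theta>)\<^sup>2 = 1 - 2 * h" "(real q2 / \<theta>)\<^sup>2 = 1 + 2 * h"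
    "L1 = {int q1, - int q1}" "L2 = {int q2, - int q2}" "q1 < q2"
proof -
  obtain A B where psi: "\<And>z i. i < N \<Longrightarrow> psi z i = (\<Sum>l\<in>L1 \<union> L2. wave (of_int l / \<theta>) (A l i) (B l i) z)"
    using psi_wave_sum by blast
  have T: "T z i = (\<Sum>l\<in>L1 \<union> L2. (1 - (of_int l / \<theta>)\<^sup>2) * wave (of_int l / \<theta>) (A l i) (B l i) z)"
    if "i < N" for z i by (rule wave_sum_derivs(3)[OF _ that]) (rule psi)
  have ne: "L1 \<noteq> {}" "L2 \<noteq> {}"
  proof -
    have no: False if c: "\<And>l. l \<in> L1 \<union> L2 \<Longrightarrow> 1 - (of_int l / \<theta>)\<^sup>2 = c" and "c \<noteq> 0" for c
    proof -
      have "T z i = c * psi z i" if "i < N" for z i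
        unfolding T[OF that] psi[OF that] sum_distrib_left using c by (intro sum.cong) auto
      then have "ip (T 0) (psi 0) = ip (\<lambda>i. c * psi 0 i) (psi 0)" by (intro vinner_cong) auto
      then show False using ip_T(1)[of 0] ip_relations(1)[of 0] \<open>c \<noteq> 0\<close> by (simp add: vinner_linear)
    qed
    show "L1 \<noteq> {}" using no[of "- 2 * h"] h by (auto simp: L2_def)
    show "L2 \<noteq> {}" using no[of "2 * h"] h by (auto simp: L1_def)
  qed
  have pm: "{l. (of_int l / \<theta>)\<^sup>2 = c} = {int (nat \<bar>m\<bar>), - int (nat \<bar>m\<bar>)}" if "(of_int m / \<theta>)\<^sup>2 = c" for m c
  proof -
    have "(of_int l / \<theta>)\<^sup>2 = (of_int m / \<theta>)\<^sup>2 \<longleftrightarrow> l = \<bar>m\<bar> \<or> l = - \<bar>m\<bar>" for l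
    proof -
      have "(of_int l / \<theta>)\<^sup>2 = (of_int m / \<theta>)\<^sup>2 \<longleftrightarrow> (of_int l)\<^sup>2 = (of_int m :: real)\<^sup>2"
        using theta_pos by (simp add: power_divide)
      also have "\<dots> \<longleftrightarrow> l\<^sup>2 = m\<^sup>2" by (metis of_int_eq_iff of_int_power)
      also have "\<dots> \<longleftrightarrow> l = \<bar>m\<bar> \<or> l = - \<bar>m\<bar>" by (auto simp: power2_eq_iff abs_if)
      finally show ?thesis .
    qed
    then show ?thesis using that by auto
  qed
  obtain m1 where m1: "(of_int m1 / \<theta>)\<^sup>2 = 1 - 2 * h" using ne by (auto simp: L1_def)
  obtain m2 where m2: "(of_int m2 / \<theta>)\<^sup>2 = 1 + 2 * h" using ne by (auto simp: L2_def)
  have sq: "(real (nat \<bar>m\<bar>) / \<theta>)\<^sup>2 = (of_int m / \<theta>)\<^sup>2" for m :: int by (simp add: power_divide)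
  have "(real (nat \<bar>m1\<bar>) / \<theta>)\<^sup>2 < (real (nat \<bar>m2\<bar>) / \<theta>)\<^sup>2" unfolding sq m1 m2 using h by simp
  then have "real (nat \<bar>m1\<bar>) / \<theta> < real (nat \<bar>m2\<bar>) / \<theta>"
    by (rule power_less_imp_less_base) (use theta_pos in auto)
  then have "nat \<bar>m1\<bar> < nat \<bar>m2\<bar>"
    using theta_pos by (simp only: divide_less_cancel of_nat_less_iff)
  then show thesis
    using that[of "nat \<bar>m1\<bar>" "nat \<bar>m2\<bar>"] pm[OF m1] pm[OF m2] m1 m2 sq
    by (simp add: L1_def L2_def)
qed

text \<open>Slots 1 and 2 belong to the y-frequencies +-q1/theta, slots 3 and 4 to +-q2/theta.
  Restriction to the lines x = 0 and x = pi/2 turns the relations between the two eigencomponents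
  into identities in y alone.\<close>

lemma wave_data:
  obtains q1 q2 :: nat and a b :: "nat \<Rightarrow> nat \<Rightarrow> real"
  where "(real q1 / \<theta>)\<^sup>2 = 1 - 2 * h" "(real q2 / \<theta>)\<^sup>2 = 1 + 2 * h" "q1 < q2"
    and "\<And>z i. i < N \<Longrightarrow> psi z i = wave (q1 / \<theta>) (a 1 i) (b 1 i) z + wave (- (q1 / \<theta>)) (a 2 i) (b 2 i) z
           + wave (q2 / \<theta>) (a 3 i) (b 3 i) z + wave (- (q2 / \<theta>)) (a 4 i) (b 4 i) z"
    and "\<And>j k. j \<in> {1, 2, 3, 4} \<Longrightarrow> k \<in> {1, 2, 3, 4} \<Longrightarrow> ip (a j) (b k) = 0"
    and "\<And>j k. j \<in> {1, 2, 3, 4} \<Longrightarrow> k \<in> {1, 2, 3, 4} \<Longrightarrow> j \<noteq> k \<Longrightarrow> ip (a j) (a k) = 0"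
    and "\<And>j k. j \<in> {1, 2, 3, 4} \<Longrightarrow> k \<in> {1, 2, 3, 4} \<Longrightarrow> j \<noteq> k \<Longrightarrow> ip (b j) (b k) = 0"
    and "\<And>j. j \<in> {1, 2, 3, 4} \<Longrightarrow> ip (a j) (a j) = ip (b j) (b j)"
    and "ip (b 1) (b 1) + ip (b 2) (b 2) = 1 / 2" "ip (b 3) (b 3) + ip (b 4) (b 4) = 1 / 2"
    and "q1 * (ip (b 1) (b 1) - ip (b 2) (b 2)) + q2 * (ip (b 3) (b 3) - ip (b 4) (b 4)) = 0"
    and "q1 = 0 \<Longrightarrow> ip (b 2) (b 2) = 0"
proof -
  obtain A B where psi0: "\<And>z i. i < N \<Longrightarrow> psi z i = (\<Sum>l\<in>L1 \<union> L2. wave (of_int l / \<theta>) (A l i) (B l i) z)"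
    using psi_wave_sum by blast
  obtain q1 q2 :: nat where q: "(real q1 / \<theta>)\<^sup>2 = 1 - 2 * h" "(real q2 / \<theta>)\<^sup>2 = 1 + 2 * h"
    "L1 = {int q1, - int q1}" "L2 = {int q2, - int q2}" "q1 < q2"
    using frequencies by blast
  define \<alpha> \<beta> where "\<alpha> = q1 / \<theta>" and "\<beta> = q2 / \<theta>"
  have ab: "0 \<le> \<alpha>" "\<alpha> < \<beta>" using q theta_pos by (auto simp: \<alpha>_def \<beta>_def divide_strict_right_mono)
  have h_ab: "\<alpha>\<^sup>2 = 1 - 2 * h" "\<beta>\<^sup>2 = 1 + 2 * h" using q by (auto simp: \<alpha>_def \<beta>_def)
  \<comment> \<open>For q1 = 0 the first two frequencies coincide; slot 2 is emptied so that this
    wave is not counted twice.\<close>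
  define a1 a2 a3 a4 where "a1 = A (int q1)" and "a2 = (if q1 = 0 then (\<lambda>i. 0) else A (- int q1))"
    and "a3 = A (int q2)" and "a4 = A (- int q2)"
  define b1 b2 b3 b4 where "b1 = B (int q1)" and "b2 = (if q1 = 0 then (\<lambda>i. 0) else B (- int q1))"
    and "b3 = B (int q2)" and "b4 = B (- int q2)"
  define c where "c = (\<lambda>j::nat. if j = 1 then \<alpha> else if j = 2 then - \<alpha> else if j = 3 then \<beta> else - \<beta>)"
  define a where "a = (\<lambda>j::nat. if j = 1 then a1 else if j = 2 then a2 else if j = 3 then a3 else a4)"
  define b where "b = (\<lambda>j::nat. if j = 1 then b1 else if j = 2 then b2 else if j = 3 then b3 else b4)"
  define J where "J = {1, 2, 3, 4::nat}"
  define W1 W2 W1x W2x where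
    "W1 = (\<lambda>z i. wave \<alpha> (a1 i) (b1 i) z + wave (- \<alpha>) (a2 i) (b2 i) z)" and
    "W2 = (\<lambda>z i. wave \<beta> (a3 i) (b3 i) z + wave (- \<beta>) (a4 i) (b4 i) z)" and
    "W1x = (\<lambda>z i. wave \<alpha> (b1 i) (- a1 i) z + wave (- \<alpha>) (b2 i) (- a2 i) z)" and
    "W2x = (\<lambda>z i. wave \<beta> (b3 i) (- a3 i) z + wave (- \<beta>) (b4 i) (- a4 i) z)"
  have psi: "psi z i = (\<Sum>j\<in>J. wave (c j) (a j i) (b j i) z)" if "i < N" for z i
  proof (cases "q1 = 0")
    case True
    then have "L1 \<union> L2 = {0, int q2, - int q2}" "q2 \<noteq> 0" using q by auto
    then show ?thesis unfolding psi0[OF that] using True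
      by (simp add: J_def c_def a_def b_def a1_def a2_def a3_def a4_def b1_def b2_def b3_def b4_def \<alpha>_def
          \<beta>_def wave_def)
  next
    case False
    then have "L1 \<union> L2 = {int q1, - int q1, int q2, - int q2}" "q2 \<noteq> 0" "q1 \<noteq> q2" "int q1 \<noteq> - int q2"
        "- int q1 \<noteq> int q2"
      "int q1 \<noteq> - int q1" "int q2 \<noteq> - int q2"
      using q by auto
    then show ?thesis unfolding psi0[OF that] using False
      by (simp add: J_def c_def a_def b_def a1_def a2_def a3_def a4_def b1_def b2_def b3_def b4_def \<alpha>_def
          \<beta>_def)
  qed
  have psiW: "psi z i = W1 z i + W2 z i" if "i < N" for z i
    unfolding psi[OF that] by (simp add: J_def c_def a_def b_def W1_def W2_def)
  have P1W: "P [1] z i = W1x z i + W2x z i" if "i < N" for z i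
  proof -
    have "P [1] z i = (\<Sum>j\<in>J. wave (c j) (b j i) (- a j i) z)"
      by (rule wave_sum_derivs(1)[OF _ that]) (rule psi)
    then show ?thesis by (simp add: J_def c_def a_def b_def W1x_def W2x_def)
  qed
  have PiW: "P [\<i>] z i = (\<Sum>j\<in>J. wave (c j) (c j * b j i) (- (c j * a j i)) z)" if "i < N" for z i
    by (rule wave_sum_derivs(2)[OF _ that]) (rule psi)
  have TW: "T z i = 2 * h * (W1 z i - W2 z i)" if "i < N" for z i
  proof -
    have "T z i = (\<Sum>j\<in>J. (1 - (c j)\<^sup>2) * wave (c j) (a j i) (b j i) z)"
      by (rule wave_sum_derivs(3)[OF _ that]) (rule psi)
    then show ?thesis using h_ab by (simp add: J_def c_def a_def b_def W1_def W2_def algebra_simps)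
  qed
  have ipW: "ip (psi z) u = ip (W1 z) u + ip (W2 z) u" "ip (T z) u = 2 * h * (ip (W1 z) u - ip (W2 z) u)"
     "ip u (psi z) = ip u (W1 z) + ip u (W2 z)" "ip u (T z) = 2 * h * (ip u (W1 z) - ip u (W2 z))"
     "ip u (P [1] z) = ip u (W1x z) + ip u (W2x z)" for z u
  proof -
    have "ip (psi z) u = ip (\<lambda>i. W1 z i + W2 z i) u" "ip (T z) u = ip (\<lambda>i. 2 * h * (W1 z i - W2 z i)) u"
      "ip u (psi z) = ip u (\<lambda>i. W1 z i + W2 z i)" "ip u (T z) = ip u (\<lambda>i. 2 * h * (W1 z i - W2 z i))"
      "ip u (P [1] z) = ip u (\<lambda>i. W1x z i + W2x z i)"
      by (intro vinner_cong; simp add: psiW TW P1W)+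
    then show "ip (psi z) u = ip (W1 z) u + ip (W2 z) u" "ip (T z) u = 2 * h * (ip (W1 z) u - ip (W2 z) u)"
     "ip u (psi z) = ip u (W1 z) + ip u (W2 z)" "ip u (T z) = 2 * h * (ip u (W1 z) - ip u (W2 z))"
     "ip u (P [1] z) = ip u (W1x z) + ip u (W2x z)"
      by (simp_all add: vinner_linear)
  qed
  \<comment> \<open>With T = 2h (W1 - W2), the relations |psi| = 1, |T| = 2h and <T, psi> = 0 form a
    linear system for the three inner products.\<close>
  have WW: "ip (W1 z) (W1 z) = 1 / 2" "ip (W2 z) (W2 z) = 1 / 2" "ip (W1 z) (W2 z) = 0" for z
  proof -
    have c: "ip (W2 z) (W1 z) = ip (W1 z) (W2 z)" by (rule vinner_commute)
    have 1: "ip (W1 z) (W1 z) + 2 * ip (W1 z) (W2 z) + ip (W2 z) (W2 z) = 1"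
      using ip_relations(1)[of z] unfolding ipW c by simp
    have "4 * h\<^sup>2 * (ip (W1 z) (W1 z) - 2 * ip (W1 z) (W2 z) + ip (W2 z) (W2 z)) = 4 * h\<^sup>2"
      using T_norm[of z] unfolding ipW c by (simp add: algebra_simps power2_eq_square)
    then have 2: "ip (W1 z) (W1 z) - 2 * ip (W1 z) (W2 z) + ip (W2 z) (W2 z) = 1" using h by simp
    have "2 * h * (ip (W1 z) (W1 z) - ip (W2 z) (W2 z)) = 0"
      using ip_T(1)[of z] unfolding ipW c by (simp add: algebra_simps)
    then have 3: "ip (W1 z) (W1 z) = ip (W2 z) (W2 z)" using h by simp
    show "ip (W1 z) (W1 z) = 1 / 2" "ip (W2 z) (W2 z) = 1 / 2" "ip (W1 z) (W2 z) = 0"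
      using 1 2 3 by linarith+
  qed
  have dW: "has_pdir N 1 W1 W1x" "has_pdir N 1 W2 W2x"
    unfolding W1_def W2_def W1x_def W2x_def has_pdir_def by (intro allI impI DERIV_add wave_deriv)+
  \<comment> \<open>For the two cross terms, differentiating <W1, W2> = 0 in x gives their sum and
    <T, psi_x> = 0 their difference.\<close>
  have WWx: "ip (W1 z) (W1x z) = 0" "ip (W2 z) (W2x z) = 0" "ip (W1 z) (W2x z) = 0"
      "ip (W1x z) (W2 z) = 0" for z
  proof -
    show 1: "ip (W1 z) (W1x z) = 0" "ip (W2 z) (W2x z) = 0"
      using has_pdir_vinner_const[OF dW(1) dW(1) WW(1), of z] has_pdir_vinner_const[OF dW(2) dW(2) WW(2),
          of z]
      by (simp_all add: vinner_commute[of N "W1x z" "W1 z"] vinner_commute[of N "W2x z" "W2 z"])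
    have 2: "ip (W1x z) (W2 z) + ip (W1 z) (W2x z) = 0"
      using has_pdir_vinner_const[OF dW(1) dW(2) WW(3)] .
    have "ip (W1 z) (W2x z) - ip (W2 z) (W1x z) = 0"
    proof -
      have "2 * h * (ip (W1 z) (W2x z) - ip (W2 z) (W1x z)) = 0"
        using ip_T(2)[of z] unfolding ipW by (simp add: 1 algebra_simps)
      then show ?thesis using h by simp
    qed
    then show "ip (W1 z) (W2x z) = 0" "ip (W1x z) (W2 z) = 0"
      using 2 vinner_commute[of N "W2 z" "W1x z"] by linarith+
  qed
  \<comment> \<open>A quarter period in x acts like the x-derivative, so \<open>W1\<close> at x =
    pi/2 agrees with \<open>W1x\<close> at x = 0, and likewise for \<open>W2\<close>.\<close>
  have W0: "W1 (Complex 0 y) = (\<lambda>i. cos (\<alpha> * y) * (a1 i + a2 i) + sin (\<alpha> * y) * (b1 i - b2 i))"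
    "W2 (Complex 0 y) = (\<lambda>i. cos (\<beta> * y) * (a3 i + a4 i) + sin (\<beta> * y) * (b3 i - b4 i))"
    "W1x (Complex 0 y) = (\<lambda>i. cos (\<alpha> * y) * (b1 i + b2 i) + sin (\<alpha> * y) * (a2 i - a1 i))"
    "W2x (Complex 0 y) = (\<lambda>i. cos (\<beta> * y) * (b3 i + b4 i) + sin (\<beta> * y) * (a4 i - a3 i))"
    "W1 (Complex (pi / 2) y) = (\<lambda>i. cos (\<alpha> * y) * (b1 i + b2 i) + sin (\<alpha> * y) * (a2 i - a1 i))"
    "W2 (Complex (pi / 2) y) = (\<lambda>i. cos (\<beta> * y) * (b3 i + b4 i) + sin (\<beta> * y) * (a4 i - a3 i))" for y
    by (auto simp: W1_def W2_def W1x_def W2x_def wave_def fun_eq_iff algebra_simps cos_add sin_add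
        cos_diff sin_diff)
  have pair: "ip a1 a1 = ip b1 b1 \<and> ip a2 a2 = ip b2 b2 \<and> ip a1 a1 + ip a2 a2 = 1 / 2 \<and>
    ip a1 b1 = 0 \<and> ip a1 a2 = 0 \<and> ip a1 b2 = 0 \<and> ip b1 a2 = 0 \<and> ip b1 b2 = 0 \<and> ip a2 b2 = 0"
  proof (cases "q1 = 0")
    case True
    then have "a2 = (\<lambda>i. 0)" "b2 = (\<lambda>i. 0)" by (auto simp: a2_def b2_def)
    moreover have "ip u (\<lambda>i. 0) = 0" for u by (simp add: vinner_def)
    moreover have "ip (\<lambda>i. 0) u = 0" for u by (simp add: vinner_def)
    ultimately show ?thesis
      using WW(1)[of "Complex 0 0"] WW(1)[of "Complex (pi/2) 0"] WWx(1)[of "Complex 0 0"]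
      unfolding W0 by simp
  next
    case False
    then have "\<alpha> > 0" using theta_pos by (simp add: \<alpha>_def)
    then have y: "\<alpha> * (t / \<alpha>) = t" for t by simp
    note wave_pair_orthogonal[OF WW(1)[of "Complex 0 (_ / \<alpha>)", unfolded W0 y]
        WW(1)[of "Complex (pi/2) (_ / \<alpha>)", unfolded W0 y] WWx(1)[of "Complex 0 (_ / \<alpha>)", unfolded W0 y]]
    then show ?thesis by blast
  qed
  have "\<beta> > 0" using ab by linarith
  then have y: "\<beta> * (t / \<beta>) = t" for t by simp
  note pair2 = wave_pair_orthogonal[OF WW(2)[of "Complex 0 (_ / \<beta>)", unfolded W0 y]
        WW(2)[of "Complex (pi/2) (_ / \<beta>)", unfolded W0 y] WWx(2)[of "Complex 0 (_ / \<beta>)", unfolded W0 y]]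
  note m1 = vinner_product_trig_zero[OF WW(3)[of "Complex 0 _", unfolded W0] ab]
  note m2 = vinner_product_trig_zero[OF WW(3)[of "Complex (pi/2) _", unfolded W0] ab]
  note m3 = vinner_product_trig_zero[OF WWx(3)[of "Complex 0 _", unfolded W0] ab]
  note m4 = vinner_product_trig_zero[OF WWx(4)[of "Complex 0 _", unfolded W0] ab]
  \<comment> \<open>For q1 > 0, each of \<open>m1\<close> to \<open>m4\<close> yields four
    equations: sixteen linear equations for the sixteen inner products between the circles.\<close>
  have mixed: "ip a1 a3 = 0 \<and> ip a1 b3 = 0 \<and> ip a1 a4 = 0 \<and> ip a1 b4 = 0 \<and>
     ip b1 a3 = 0 \<and> ip b1 b3 = 0 \<and> ip b1 a4 = 0 \<and> ip b1 b4 = 0 \<and>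
     ip a2 a3 = 0 \<and> ip a2 b3 = 0 \<and> ip a2 a4 = 0 \<and> ip a2 b4 = 0 \<and>
     ip b2 a3 = 0 \<and> ip b2 b3 = 0 \<and> ip b2 a4 = 0 \<and> ip b2 b4 = 0"
  proof (cases "q1 = 0")
    case True
    then have "a2 = (\<lambda>i. 0)" "b2 = (\<lambda>i. 0)" by (auto simp: a2_def b2_def)
    moreover have z: "ip (\<lambda>i. 0) u = 0" for u by (simp add: vinner_def)
    ultimately show ?thesis
      using m1(1,2) m2(1,2) m3(1,2) m4(1,2) unfolding vinner_linear by simp
  next
    case False
    then have "\<alpha> > 0" using theta_pos by (simp add: \<alpha>_def)
    note m1(1,2) m1(3,4)[OF this] m2(1,2) m2(3,4)[OF this] m3(1,2) m3(3,4)[OF this] m4(1,2) m4(3,4)[OF this]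
    note this[unfolded vinner_linear]
    then show ?thesis by (intro conjI; linarith)
  qed
  have sym: "ip a2 a1 = ip a1 a2" "ip b2 b1 = ip b1 b2" "ip a2 b1 = ip b1 a2" "ip a4 a3 = ip a3 a4"
      "ip b4 b3 = ip b3 b4"
    "ip a4 b3 = ip b3 a4" "ip a3 a1 = ip a1 a3" "ip a4 a1 = ip a1 a4" "ip a3 a2 = ip a2 a3"
        "ip a4 a2 = ip a2 a4"
    "ip b3 b1 = ip b1 b3" "ip b4 b1 = ip b1 b4" "ip b3 b2 = ip b2 b3" "ip b4 b2 = ip b2 b4"
    "ip a3 b1 = ip b1 a3" "ip a3 b2 = ip b2 a3" "ip a4 b1 = ip b1 a4" "ip a4 b2 = ip b2 a4"
    by (rule vinner_commute)+
  \<comment> \<open>At the origin psi_x is the sum of the \<open>b\<close> vectors and psi_y their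
    sum weighted by the frequencies, so orthogonality leaves only squared norms.\<close>
  have bal: "\<alpha> * (ip b1 b1 - ip b2 b2) + \<beta> * (ip b3 b3 - ip b4 b4) = 0"
  proof -
    have "0 = ip (P [1] 0) (P [\<i>] 0)" using ip_relations(4)[of 0] by simp
    also have "\<dots> = ip (\<lambda>i. b1 i + b2 i + (b3 i + b4 i)) (\<lambda>i. \<alpha> * (b1 i - b2 i) + \<beta> * (b3 i - b4 i))"
      by (rule vinner_cong) (auto simp: P1W PiW W1x_def W2x_def wave_def J_def c_def a_def b_def
          algebra_simps)
    also have "\<dots> = \<alpha> * (ip b1 b1 - ip b2 b2) + \<beta> * (ip b3 b3 - ip b4 b4)"
      using pair pair2 mixed by (simp add: vinner_linear sym algebra_simps)
    finally show ?thesis by simp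
  qed
  have "\<theta> * (\<alpha> * (ip b1 b1 - ip b2 b2) + \<beta> * (ip b3 b3 - ip b4 b4))
      = q1 * (ip b1 b1 - ip b2 b2) + q2 * (ip b3 b3 - ip b4 b4)"
    using theta_pos by (simp add: \<alpha>_def \<beta>_def field_simps)
  then have bal': "q1 * (ip b1 b1 - ip b2 b2) + q2 * (ip b3 b3 - ip b4 b4) = 0" using bal by simp
  show thesis
  proof (rule that[of q1 q2 a b])
    show "psi z i = wave (q1 / \<theta>) (a 1 i) (b 1 i) z + wave (- (q1 / \<theta>)) (a 2 i) (b 2 i) z
           + wave (q2 / \<theta>) (a 3 i) (b 3 i) z + wave (- (q2 / \<theta>)) (a 4 i) (b 4 i) z" if "i < N" for z i
      unfolding psi[OF that] by (simp add: J_def c_def \<alpha>_def \<beta>_def)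
    show "ip (a j) (b k) = 0" if "j \<in> {1,2,3,4}" "k \<in> {1,2,3,4}" for j k
      using that pair pair2 mixed by (auto simp: a_def b_def sym)
    show "ip (a j) (a k) = 0" "ip (b j) (b k) = 0" if "j \<in> {1,2,3,4}" "k \<in> {1,2,3,4}" "j \<noteq> k" for j k
      using that pair pair2 mixed by (auto simp: a_def b_def sym)
    show "ip (a j) (a j) = ip (b j) (b j)" if "j \<in> {1,2,3,4}" for j
      using that pair pair2 by (auto simp: a_def b_def)
    show "ip (b 2) (b 2) = 0" if "q1 = 0" using that by (simp add: b_def b2_def vinner_def)
  qed (use q pair pair2 bal' in \<open>auto simp: b_def\<close>)
qed

end

section \<open>Normal forms\<close>

lemma vinner_sum_right: "vinner N u (\<lambda>i. \<Sum>j\<in>J. f j i) = (\<Sum>j\<in>J. vinner N u (f j))"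
  unfolding vinner_def sum_distrib_left by (rule sum.swap)

text \<open>The projector onto the span of the family is the identity, and its trace is the number of
  vectors.\<close>

lemma complete_orthonormal_card:
  assumes orth: "\<And>j k. j \<in> {1..K} \<Longrightarrow> k \<in> {1..K} \<Longrightarrow> vinner N (E j) (E k) = (if j = k then 1 else 0)"
    and full: "\<And>v. (\<And>j. j \<in> {1..K} \<Longrightarrow> vinner N v (E j) = 0) \<Longrightarrow> vzero N v"
  shows "K = N"
proof -
  have 1: "(\<Sum>j\<in>{1..K}. (E j m)\<^sup>2) = 1" if m: "m < N" for m
  proof -
    define v where "v = (\<lambda>i. (if i = m then 1 else 0) - (\<Sum>j\<in>{1..K}. E j m * E j i))"
    have "vinner N v (E k) = 0" if k: "k \<in> {1..K}" for k
    proof -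
      have "vinner N (E k) (\<lambda>i. if i = m then 1 else 0) = E k m"
        using m by (simp add: vinner_def sum.delta' if_distrib cong: if_cong)
      moreover have "vinner N (E k) (\<lambda>i. \<Sum>j\<in>{1..K}. E j m * E j i) = (\<Sum>j\<in>{1..K}. E j m * (if k
          = j then 1 else 0))"
        unfolding vinner_sum_right vinner_scale_right using orth k by (intro sum.cong) auto
      moreover have "\<dots> = E k m" using k by (simp add: if_distrib cong: if_cong)
      ultimately show ?thesis
        unfolding v_def vinner_commute[of N _ "E k"] vinner_diff_right by simp
    qed
    then have "vzero N v" by (rule full)
    then have "v m = 0" using m by (simp add: vzero_def)
    then show ?thesis by (simp add: v_def power2_eq_square)
  qed
  have "real N = (\<Sum>m<N. \<Sum>j\<in>{1..K}. (E j m)\<^sup>2)" using 1 by simp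
  also have "\<dots> = (\<Sum>j\<in>{1..K}. \<Sum>m<N. (E j m)\<^sup>2)" by (rule sum.swap)
  also have "\<dots> = (\<Sum>j\<in>{1..K}. 1)"
    using orth by (intro sum.cong) (auto simp: vinner_def power2_eq_square)
  finally show ?thesis by simp
qed

text \<open>Interleaving the normalised cosine and sine vectors matches Z_k = (E_(2k-1) - i E_(2k))
  / 2. The sign \<open>s p\<close> absorbs the reversal of the sine vector in the terms with
  conjugated mu or eta.\<close>

lemma orthonormal_basis_of_pairs:
  fixes a b :: "nat \<Rightarrow> nat \<Rightarrow> real" and s \<rho> :: "nat \<Rightarrow> real"
  assumes ab: "\<And>p q. p \<in> {1..m} \<Longrightarrow> q \<in> {1..m} \<Longrightarrow> vinner N (a p) (b q) = 0"
    and aa: "\<And>p q. p \<in> {1..m} \<Longrightarrow> q \<in> {1..m} \<Longrightarrow> p \<noteq> q \<Longrightarrow> vinner N (a p) (a q) = 0"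
    and bb: "\<And>p q. p \<in> {1..m} \<Longrightarrow> q \<in> {1..m} \<Longrightarrow> p \<noteq> q \<Longrightarrow> vinner N (b p) (b q) = 0"
    and norm: "\<And>p. p \<in> {1..m} \<Longrightarrow> vinner N (a p) (a p) = \<rho> p \<and> vinner N (b p) (b p) = \<rho> p \<and> \<rho> p > 0"
    and s: "\<And>p. s p * s p = 1"
    and full: "\<And>v. (\<And>p. p \<in> {1..m} \<Longrightarrow> vinner N v (a p) = 0 \<and> vinner N v (b p) = 0) \<Longrightarrow> vzero N v"
  obtains E where "N = 2 * m" "orthonormal_basis N E"
    "\<And>p i. p \<in> {1..m} \<Longrightarrow> a p i = sqrt (\<rho> p) * E (2 * p - 1) i"
    "\<And>p i. p \<in> {1..m} \<Longrightarrow> b p i = sqrt (\<rho> p) * (s p * E (2 * p) i)"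
proof -
  define E where "E k = (if odd k then (\<lambda>i. 1 / sqrt (\<rho> ((k + 1) div 2)) * a ((k + 1) div 2) i)
      else (\<lambda>i. s (k div 2) / sqrt (\<rho> (k div 2)) * b (k div 2) i))" for k :: nat
  have odd_E: "E (2 * p - 1) = (\<lambda>i. 1 / sqrt (\<rho> p) * a p i)" if "p \<in> {1..m}" for p
    using that by (simp add: E_def)
  have even_E: "E (2 * p) = (\<lambda>i. s p / sqrt (\<rho> p) * b p i)" for p
    by (simp add: E_def)
  have sq: "1 / sqrt (\<rho> p) * (1 / sqrt (\<rho> p) * \<rho> p) = 1" "s p / sqrt (\<rho> p) * (s p / sqrt (\<rho> p) * \<rho> p) = 1"
    if "p \<in> {1..m}" for p
  proof -
    have r: "\<rho> p > 0" using norm that by blast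
    then have q: "sqrt (\<rho> p) * sqrt (\<rho> p) = \<rho> p" by simp
    then show "1 / sqrt (\<rho> p) * (1 / sqrt (\<rho> p) * \<rho> p) = 1" using r by (simp add: field_simps)
    have "s p / sqrt (\<rho> p) * (s p / sqrt (\<rho> p) * \<rho> p) = (s p * s p) * \<rho> p / (sqrt (\<rho> p) * sqrt (\<rho> p))" by simp
    then show "s p / sqrt (\<rho> p) * (s p / sqrt (\<rho> p) * \<rho> p) = 1" using r unfolding q s by simp
  qed
  have cases: "\<exists>p\<in>{1..m}. k = 2 * p - 1 \<or> k = 2 * p" if "k \<in> {1..2 * m}" for k
  proof (cases "odd k")
    case True
    then obtain p where "k = 2 * p + 1" by (rule oddE)
    then show ?thesis using that by (intro bexI[of _ "p + 1"]) auto
  next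
    case False
    then obtain p where "k = 2 * p" by auto
    then show ?thesis using that by (intro bexI[of _ p]) auto
  qed
  have orth: "vinner N (E j) (E k) = (if j = k then 1 else 0)" if j: "j \<in> {1..2 * m}"
      and k: "k \<in> {1..2 * m}" for j k
  proof -
    obtain p where p: "p \<in> {1..m}" "j = 2 * p - 1 \<or> j = 2 * p" using cases[OF j] by blast
    obtain q where q: "q \<in> {1..m}" "k = 2 * q - 1 \<or> k = 2 * q" using cases[OF k] by blast
    have ba: "vinner N (b p) (a q) = 0" using ab[OF q(1) p(1)] by (simp add: vinner_commute)
    have ne: "2 * p - 1 \<noteq> 2 * q" "2 * q - 1 \<noteq> 2 * p" "2 * p - 1 = 2 * q - 1 \<longleftrightarrow> p = q"
      using p(1) q(1) by (auto; presburger)+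
    consider "j = 2 * p - 1" "k = 2 * q - 1" | "j = 2 * p - 1" "k = 2 * q" | "j = 2 * p"
        "k = 2 * q - 1" | "j = 2 * p" "k = 2 * q"
      using p q by blast
    then show ?thesis
    proof cases
      case 1
      then show ?thesis using odd_E[OF p(1)] odd_E[OF q(1)] aa[OF p(1) q(1)] norm[OF p(1)] sq(1)[OF p(1)] ne
        by (cases "p = q") (simp_all only: vinner_scale_left vinner_scale_right, simp_all)
    next
      case 2
      then show ?thesis using odd_E[OF p(1)] even_E[of q] ab[OF p(1) q(1)] ne
        by (simp only: vinner_scale_left vinner_scale_right) auto
    next
      case 3
      then show ?thesis using odd_E[OF q(1)] even_E[of p] ba ne
        by (simp only: vinner_scale_left vinner_scale_right) auto
    next
      case 4
      then show ?thesis using even_E[of p] even_E[of q] bb[OF p(1) q(1)] norm[OF p(1)] sq(2)[OF p(1)]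
        by (cases "p = q") (simp_all only: vinner_scale_left vinner_scale_right, simp_all)
    qed
  qed
  have "2 * m = N"
  proof (rule complete_orthonormal_card[of "2 * m" N E])
    fix v assume v: "\<And>j. j \<in> {1..2 * m} \<Longrightarrow> vinner N v (E j) = 0"
    show "vzero N v"
    proof (rule full)
      fix p assume p: "p \<in> {1..m}"
      then have "vinner N v (E (2 * p - 1)) = 0" "vinner N v (E (2 * p)) = 0" by (auto intro!: v)
      moreover have "s p \<noteq> 0" "\<rho> p > 0" using s[of p] norm[OF p] by auto
      ultimately show "vinner N v (a p) = 0 \<and> vinner N v (b p) = 0"
        unfolding odd_E[OF p] even_E vinner_scale_right by auto
    qed
  qed (use orth in auto)
  show thesis
  proof (rule that[of E])
    show "N = 2 * m" using \<open>2 * m = N\<close> by simp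
    show "orthonormal_basis N E" unfolding orthonormal_basis_def using orth \<open>2 * m = N\<close> by auto
    fix p i assume p: "p \<in> {1..m}"
    then have r: "\<rho> p > 0" using norm by blast
    show "a p i = sqrt (\<rho> p) * E (2 * p - 1) i" unfolding odd_E[OF p] using r by simp
    have "sqrt (\<rho> p) * (s p * E (2 * p) i) = (s p * s p) * b p i" unfolding even_E using r by simp
    then show "b p i = sqrt (\<rho> p) * (s p * E (2 * p) i)" by (simp add: s)
  qed
qed

section \<open>From the complex exponential form to real waves\<close>

lemma exp_pair_eq:
  "exp (of_real (r / 2) * (\<mu> * z - cnj \<mu> * cnj z)) * ((of_real e - \<i> * of_real e') / 2)
   + exp (of_real (r / 2) * (- \<mu> * z + cnj \<mu> * cnj z)) * cnj ((of_real e - \<i> * of_real e') / 2)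
   = complex_of_real (e * cos (r * Im (\<mu> * z)) + e' * sin (r * Im (\<mu> * z)))"
proof -
  define x where "x = Im (\<mu> * z)"
  have "\<mu> * z - cnj \<mu> * cnj z = of_real (2 * x) * \<i>" "- \<mu> * z + cnj \<mu> * cnj z = of_real (- (2 * x)) * \<i>"
    by (simp_all add: complex_eq_iff x_def)
  then have "of_real (r / 2) * (\<mu> * z - cnj \<mu> * cnj z) = \<i> * of_real (r * x)"
    "of_real (r / 2) * (- \<mu> * z + cnj \<mu> * cnj z) = \<i> * of_real (- (r * x))"
    by (simp_all only:) simp_all
  then show ?thesis unfolding x_def[symmetric] by (simp only: cis_conv_exp[symmetric])
      (simp add: complex_eq_iff algebra_simps diff_divide_distrib)
qed

text \<open>The square root of lambda_1 is the common denominator in \<open>mu1\<close>, so it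
  cancels and leaves x-frequency 1; conjugating \<open>mu1\<close> reverses the sign of x
  only.\<close>

lemma mu1_phase:
  assumes "h \<le> 1 / 2"
  shows "sqrt (2 * (1 - h)) * Im (mu1 h * z) = Re z + sqrt (1 - 2 * h) * Im z"
    "sqrt (2 * (1 - h)) * Im (cnj (mu1 h) * z) = - Re z + sqrt (1 - 2 * h) * Im z"
proof -
  define d where "d = sqrt (2 * (1 - h))"
  have d: "d > 0" using assms by (simp add: d_def)
  have m: "mu1 h = Complex (sqrt (1 - 2 * h) / d) (1 / d)" by (simp add: mu1_def d_def real_sqrt_divide)
  show "sqrt (2 * (1 - h)) * Im (mu1 h * z) = Re z + sqrt (1 - 2 * h) * Im z"
    "sqrt (2 * (1 - h)) * Im (cnj (mu1 h) * z) = - Re z + sqrt (1 - 2 * h) * Im z"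
    unfolding d_def[symmetric] m using d by (simp_all add: field_simps)
qed

lemma eta1_phase:
  assumes "h > 0"
  shows "sqrt (2 * (1 + h)) * Im (eta1 h * z) = Re z + sqrt (1 + 2 * h) * Im z"
    "sqrt (2 * (1 + h)) * Im (cnj (eta1 h) * z) = - Re z + sqrt (1 + 2 * h) * Im z"
proof -
  define d where "d = sqrt (2 * (1 + h))"
  have d: "d > 0" using assms by (simp add: d_def)
  have m: "eta1 h = Complex (sqrt (1 + 2 * h) / d) (1 / d)" by (simp add: eta1_def d_def real_sqrt_divide)
  show "sqrt (2 * (1 + h)) * Im (eta1 h * z) = Re z + sqrt (1 + 2 * h) * Im z"
    "sqrt (2 * (1 + h)) * Im (cnj (eta1 h) * z) = - Re z + sqrt (1 + 2 * h) * Im z"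
    unfolding d_def[symmetric] m using d by (simp_all add: field_simps)
qed

text \<open>Evenness of cosine and oddness of sine: this is where the minus signs before
  \<open>E 4\<close>, \<open>E 6\<close> and \<open>E 8\<close> come from.\<close>

lemma wave_cnj_phase: "e * cos (- Re z + c * Im z) + e' * sin (- Re z + c * Im z) = wave (- c) e (- e') z"
proof -
  have "- Re z + c * Im z = - (Re z + - c * Im z)" by simp
  then show ?thesis unfolding wave_def by (simp only: cos_minus sin_minus)
qed

lemma psi_form_eq:
  "psi_form m m' R R' \<mu> \<eta> lam1 lam2 E z i = of_real (
      (\<Sum>k=1..m. 1 / sqrt 2 * sqrt (R k) * (E (2 * k - 1) i * cos (sqrt lam1 * Im (\<mu> k * z))
         + E (2 * k) i * sin (sqrt lam1 * Im (\<mu> k * z))))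
    + (\<Sum>j=1..m'. 1 / sqrt 2 * sqrt (R' j) * (E (2 * (m + j) - 1) i * cos (sqrt lam2 * Im (\<eta> j * z))
         + E (2 * (m + j)) i * sin (sqrt lam2 * Im (\<eta> j * z)))))"
  unfolding psi_form_def Let_def exp_pair_eq
  by (simp add: sum_distrib_left mult.assoc)

lemma half_sqrt: "1 / sqrt 2 * sqrt (x / 2) = sqrt (x / 4)"
proof -
  have "sqrt (x / 4) = sqrt (1 / 2 * (x / 2))" by simp
  then show ?thesis by (simp only: real_sqrt_mult real_sqrt_divide real_sqrt_one)
qed

lemma psi5_eq_wave:
  assumes h: "0 < h" "h \<le> 1 / 2"
  shows "psi5 h E z i = of_real (
      sqrt (1 / 2) * wave (sqrt (1 - 2 * h)) (E 1 i) (E 2 i) z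
    + sqrt ((1 - sqrt (1 - 2 * h) / sqrt (1 + 2 * h)) / 4) * wave (sqrt (1 + 2 * h)) (E 3 i) (E 4 i) z
    + sqrt ((1 + sqrt (1 - 2 * h) / sqrt (1 + 2 * h)) / 4) * wave (- sqrt (1 + 2 * h)) (E 5 i) (- E 6 i) z)"
proof -
  have i12: "{1..2} = {1, 2::nat}" "{1..1} = {1::nat}" by auto
  have half1: "1 / sqrt 2 * sqrt 1 = sqrt (1 / 2)" by (simp add: real_sqrt_divide)
  have "psi5 h E z i = of_real (1 / sqrt 2 * sqrt 1 * (E 1 i * cos (sqrt (2 * (1 - h)) * Im (mu1 h * z))
      + E 2 i * sin (sqrt (2 * (1 - h)) * Im (mu1 h * z)))
    + (1 / sqrt 2 * sqrt ((1 - sqrt ((1 - 2 * h) / (1 + 2 * h))) / 2) * (E 3 i * cos (sqrt (2 * (1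
        + h)) * Im (eta1 h * z)) + E 4 i * sin (sqrt (2 * (1 + h)) * Im (eta1 h * z)))
     + 1 / sqrt 2 * sqrt ((1 + sqrt ((1 - 2 * h) / (1 + 2 * h))) / 2) * (E 5 i * cos (sqrt (2 * (1
         + h)) * Im (cnj (eta1 h) * z)) + E 6 i * sin (sqrt (2 * (1 + h)) * Im (cnj (eta1 h) * z)))))"
    unfolding psi5_def psi_form_eq i12 by simp
  then show ?thesis
    unfolding mu1_phase[OF h(2)] eta1_phase[OF h(1)] half_sqrt half1 wave_cnj_phase real_sqrt_divide[of "1
        - 2 * h"]
    unfolding wave_def by (simp only: add.assoc)
qed

lemma psi7_eq_wave:
  assumes h: "0 < h" "h \<le> 1 / 2"
  shows "psi7 h \<omega> E z i = of_real (
      sqrt ((1 + \<omega> / sqrt (1 - 2 * h)) / 4) * wave (sqrt (1 - 2 * h)) (E 1 i) (E 2 i) z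
    + sqrt ((1 - \<omega> / sqrt (1 - 2 * h)) / 4) * wave (- sqrt (1 - 2 * h)) (E 3 i) (- E 4 i) z
    + sqrt ((1 - \<omega> / sqrt (1 + 2 * h)) / 4) * wave (sqrt (1 + 2 * h)) (E 5 i) (E 6 i) z
    + sqrt ((1 + \<omega> / sqrt (1 + 2 * h)) / 4) * wave (- sqrt (1 + 2 * h)) (E 7 i) (- E 8 i) z)"
proof -
  have i12: "{1..2} = {1, 2::nat}" by auto
  have "psi7 h \<omega> E z i = of_real (
      (1 / sqrt 2 * sqrt ((1 + \<omega> / sqrt (1 - 2 * h)) / 2) * (E 1 i * cos (sqrt (2 * (1 - h)) * Im (mu1 h *
          z)) + E 2 i * sin (sqrt (2 * (1 - h)) * Im (mu1 h * z)))
     + 1 / sqrt 2 * sqrt ((1 - \<omega> / sqrt (1 - 2 * h)) / 2) * (E 3 i * cos (sqrt (2 * (1 - h)) * Im (cnj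
         (mu1 h) * z)) + E 4 i * sin (sqrt (2 * (1 - h)) * Im (cnj (mu1 h) * z))))
    + (1 / sqrt 2 * sqrt ((1 - \<omega> / sqrt (1 + 2 * h)) / 2) * (E 5 i * cos (sqrt (2 * (1
        + h)) * Im (eta1 h * z)) + E 6 i * sin (sqrt (2 * (1 + h)) * Im (eta1 h * z)))
     + 1 / sqrt 2 * sqrt ((1 + \<omega> / sqrt (1 + 2 * h)) / 2) * (E 7 i * cos (sqrt (2 * (1
         + h)) * Im (cnj (eta1 h) * z)) + E 8 i * sin (sqrt (2 * (1 + h)) * Im (cnj (eta1 h) * z)))))"
    unfolding psi7_def psi_form_eq i12 by simp
  then show ?thesis
    unfolding mu1_phase[OF h(2)] eta1_phase[OF h(1)] half_sqrt wave_cnj_phase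
    unfolding wave_def by (simp only: add.assoc)
qed

lemma vinner_wave: "vinner N v (\<lambda>i. wave c (a i) (b i) z) = wave c (vinner N v a) (vinner N v b) z"
proof -
  have "vinner N v (\<lambda>i. wave c (a i) (b i) z)
      = vinner N v (\<lambda>i. cos (Re z + c * Im z) * a i + sin (Re z + c * Im z) * b i)"
    by (simp add: wave_def mult.commute)
  then show ?thesis by (simp only: vinner_linear) (simp add: wave_def mult.commute)
qed

lemma wave_zero: "wave c 0 0 z = 0"
  by (simp add: wave_def)

lemma wave_cnj: "wave c A B (cnj z) = wave (- c) A B z"
  by (simp add: wave_def)

section \<open>Recognising the two normal forms\<close>

lemma psi5_normal_form:
  fixes a b :: "nat \<Rightarrow> nat \<Rightarrow> real"
  assumes h: "0 < h" "h \<le> 1 / 2"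
    and F: "\<And>z i. i < N \<Longrightarrow> F z i = wave (sqrt (1 - 2 * h)) (a 1 i) (b 1 i) z
       + wave (sqrt (1 + 2 * h)) (a 2 i) (b 2 i) z + wave (- sqrt (1 + 2 * h)) (a 3 i) (b 3 i) z"
    and ab: "\<And>p q. p \<in> {1..3} \<Longrightarrow> q \<in> {1..3} \<Longrightarrow> vinner N (a p) (b q) = 0"
    and aa: "\<And>p q. p \<in> {1..3} \<Longrightarrow> q \<in> {1..3} \<Longrightarrow> p \<noteq> q \<Longrightarrow> vinner N (a p) (a q) = 0"
    and bb: "\<And>p q. p \<in> {1..3} \<Longrightarrow> q \<in> {1..3} \<Longrightarrow> p \<noteq> q \<Longrightarrow> vinner N (b p) (b q) = 0"
    and norm: "\<And>p. p \<in> {1..3} \<Longrightarrow> vinner N (a p) (a p) = \<rho> p \<and> vinner N (b p) (b p) = \<rho> p \<and> \<rho> p > 0"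
    and \<rho>: "\<rho> 1 = 1 / 2" "\<rho> 2 = (1 - sqrt (1 - 2 * h) / sqrt (1 + 2 * h)) / 4"
      "\<rho> 3 = (1 + sqrt (1 - 2 * h) / sqrt (1 + 2 * h)) / 4"
    and full: "\<And>v. (\<And>z. vinner N v (F z) = 0) \<Longrightarrow> vzero N v"
  obtains E where "N = 6" "orthonormal_basis N E" "\<And>z i. i < N \<Longrightarrow> complex_of_real (F z i) = psi5 h E z i"
proof -
  \<comment> \<open>Pair 3 belongs to the conjugated \<open>eta1\<close>, the only conjugate phase
    of \<open>psi5\<close>.\<close>
  define s where "s p = (if p = 3 then - 1 else 1 :: real)" for p :: nat
  obtain E where E: "N = 2 * 3" "orthonormal_basis N E"
    "\<And>p i. p \<in> {1..3} \<Longrightarrow> a p i = sqrt (\<rho> p) * E (2 * p - 1) i"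
    "\<And>p i. p \<in> {1..3} \<Longrightarrow> b p i = sqrt (\<rho> p) * (s p * E (2 * p) i)"
  proof (rule orthonormal_basis_of_pairs[where s = s, OF ab aa bb norm])
    fix v assume v: "\<And>p. p \<in> {1..3} \<Longrightarrow> vinner N v (a p) = 0 \<and> vinner N v (b p) = 0"
    show "vzero N v"
    proof (rule full)
      fix z
      have "vinner N v (F z) = vinner N v (\<lambda>i. wave (sqrt (1 - 2 * h)) (a 1 i) (b 1 i) z
       + wave (sqrt (1 + 2 * h)) (a 2 i) (b 2 i) z + wave (- sqrt (1 + 2 * h)) (a 3 i) (b 3 i) z)"
        by (rule vinner_cong) (auto simp: F)
      then show "vinner N v (F z) = 0" by (simp add: vinner_add_right vinner_wave v wave_zero)
    qed
  qed (auto simp: s_def)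
  have a: "a 1 i = sqrt (\<rho> 1) * E 1 i" "b 1 i = sqrt (\<rho> 1) * E 2 i" "a 2 i = sqrt (\<rho> 2) * E 3 i"
    "b 2 i = sqrt (\<rho> 2) * E 4 i" "a 3 i = sqrt (\<rho> 3) * E 5 i" "b 3 i = sqrt (\<rho> 3) * (- E 6 i)" for i
    using E(3)[of 1] E(3)[of 2] E(3)[of 3] E(4)[of 1] E(4)[of 2] E(4)[of 3] by (simp_all add: s_def)
  have "complex_of_real (F z i) = psi5 h E z i" if "i < N" for z i
    unfolding F[OF that] psi5_eq_wave[OF h] a wave_scale \<rho> ..
  then show thesis using that E by simp
qed

lemma psi7_normal_form:
  fixes a b :: "nat \<Rightarrow> nat \<Rightarrow> real"
  assumes h: "0 < h" "h \<le> 1 / 2"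
    and F: "\<And>z i. i < N \<Longrightarrow> F z i = wave (sqrt (1 - 2 * h)) (a 1 i) (b 1 i) z
        + wave (- sqrt (1 - 2 * h)) (a 2 i) (b 2 i) z
       + wave (sqrt (1 + 2 * h)) (a 3 i) (b 3 i) z + wave (- sqrt (1 + 2 * h)) (a 4 i) (b 4 i) z"
    and ab: "\<And>p q. p \<in> {1..4} \<Longrightarrow> q \<in> {1..4} \<Longrightarrow> vinner N (a p) (b q) = 0"
    and aa: "\<And>p q. p \<in> {1..4} \<Longrightarrow> q \<in> {1..4} \<Longrightarrow> p \<noteq> q \<Longrightarrow> vinner N (a p) (a q) = 0"
    and bb: "\<And>p q. p \<in> {1..4} \<Longrightarrow> q \<in> {1..4} \<Longrightarrow> p \<noteq> q \<Longrightarrow> vinner N (b p) (b q) = 0"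
    and norm: "\<And>p. p \<in> {1..4} \<Longrightarrow> vinner N (a p) (a p) = \<rho> p \<and> vinner N (b p) (b p) = \<rho> p \<and> \<rho> p > 0"
    and \<rho>: "\<rho> 1 = (1 + \<omega> / sqrt (1 - 2 * h)) / 4" "\<rho> 2 = (1 - \<omega> / sqrt (1 - 2 * h)) / 4"
      "\<rho> 3 = (1 - \<omega> / sqrt (1 + 2 * h)) / 4" "\<rho> 4 = (1 + \<omega> / sqrt (1 + 2 * h)) / 4"
    and full: "\<And>v. (\<And>z. vinner N v (F z) = 0) \<Longrightarrow> vzero N v"
  obtains E where "N = 8" "orthonormal_basis N E" "\<And>z i. i < N \<Longrightarrow> complex_of_real (F z i) = psi7 h \<omega> E z i"
proof -
  \<comment> \<open>Pairs 2 and 4 belong to the conjugated \<open>mu1\<close> and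
    \<open>eta1\<close>.\<close>
  define s where "s p = (if p = 2 \<or> p = 4 then - 1 else 1 :: real)" for p :: nat
  obtain E where E: "N = 2 * 4" "orthonormal_basis N E"
    "\<And>p i. p \<in> {1..4} \<Longrightarrow> a p i = sqrt (\<rho> p) * E (2 * p - 1) i"
    "\<And>p i. p \<in> {1..4} \<Longrightarrow> b p i = sqrt (\<rho> p) * (s p * E (2 * p) i)"
  proof (rule orthonormal_basis_of_pairs[where s = s, OF ab aa bb norm])
    fix v assume v: "\<And>p. p \<in> {1..4} \<Longrightarrow> vinner N v (a p) = 0 \<and> vinner N v (b p) = 0"
    show "vzero N v"
    proof (rule full)
      fix z
      have "vinner N v (F z) = vinner N v (\<lambda>i. wave (sqrt (1 - 2 * h)) (a 1 i) (b 1 i) z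
          + wave (- sqrt (1 - 2 * h)) (a 2 i) (b 2 i) z
       + wave (sqrt (1 + 2 * h)) (a 3 i) (b 3 i) z + wave (- sqrt (1 + 2 * h)) (a 4 i) (b 4 i) z)"
        by (rule vinner_cong) (auto simp: F)
      then show "vinner N v (F z) = 0" by (simp add: vinner_add_right vinner_wave v wave_zero)
    qed
  qed (auto simp: s_def)
  have a: "a 1 i = sqrt (\<rho> 1) * E 1 i" "b 1 i = sqrt (\<rho> 1) * E 2 i" "a 2 i = sqrt (\<rho> 2) * E 3 i"
    "b 2 i = sqrt (\<rho> 2) * (- E 4 i)" "a 3 i = sqrt (\<rho> 3) * E 5 i" "b 3 i = sqrt (\<rho> 3) * E 6 i"
    "a 4 i = sqrt (\<rho> 4) * E 7 i" "b 4 i = sqrt (\<rho> 4) * (- E 8 i)" for i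
    using E(3)[of 1] E(3)[of 2] E(3)[of 3] E(3)[of 4] E(4)[of 1] E(4)[of 2] E(4)[of 3] E(4)[of 4]
        by (simp_all add: s_def)
  have "complex_of_real (F z i) = psi7 h \<omega> E z i" if "i < N" for z i
    unfolding F[OF that] psi7_eq_wave[OF h] a wave_scale \<rho> ..
  then show thesis using that E by simp
qed

lemma torus_isometry_id: "torus_isometry \<theta> (\<lambda>z. z)"
  unfolding torus_isometry_def by (intro conjI exI[of _ 1] exI[of _ 0]) auto

text \<open>The lattice is rectangular, so reflection in the x-axis preserves it. On waves this
  reflection negates the y-frequency.\<close>

lemma torus_isometry_cnj: "torus_isometry \<theta> cnj"
  unfolding torus_isometry_def
proof (intro conjI allI impI)
  show "\<exists>a c. cmod a = 1 \<and> (cnj = (\<lambda>z. a * z + c) \<or> cnj = (\<lambda>z. a * cnj z + c))"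
    by (intro exI[of _ 1] exI[of _ 0]) (auto simp: fun_eq_iff)
  fix z w assume "w \<in> lattice \<theta>"
  then obtain k l where w: "w = Complex (2 * pi * of_int k) (2 * pi * of_int l * \<theta>)"
    by (auto simp: lattice_def)
  have "cnj (z + w) - cnj z = Complex (2 * pi * of_int k) (2 * pi * of_int (- l) * \<theta>)"
    by (simp add: w complex_eq_iff)
  then show "cnj (z + w) - cnj z \<in> lattice \<theta>" unfolding lattice_def by blast
qed

context cmc_biharmonic_torus
begin

text \<open>The case split is on which q1 weight vanishes: if one does, three pairs of vectors span
  and N = 6; if none does, four pairs and N = 8.\<close>

lemma classification:
  obtains q1 q2 :: nat and g E
  where "q1 < q2" "\<theta>\<^sup>2 = (real q1 ^ 2 + real q2 ^ 2) / 2"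
    "h = (real q2 ^ 2 - real q1 ^ 2) / (2 * (real q1 ^ 2 + real q2 ^ 2))"
    "torus_isometry \<theta> g" "orthonormal_basis N E"
    "(n = 5 \<and> h \<le> 1 / 2 \<and> (\<forall>z. \<forall>i<N. complex_of_real (psi (g z) i) = psi5 h E z i)) \<or>
     (n = 7 \<and> q1 > 0 \<and> h < 1 / 2 \<and> (\<exists>\<omega>. - sqrt (1 - 2 * h) < \<omega> \<and> \<omega> < sqrt (1 - 2 * h) \<and>
        (\<forall>z. \<forall>i<N. complex_of_real (psi (g z) i) = psi7 h \<omega> E z i)))"
proof -
  note concl = that
  obtain q1 q2 :: nat and a b :: "nat \<Rightarrow> nat \<Rightarrow> real"
    where q: "(real q1 / \<theta>)\<^sup>2 = 1 - 2 * h" "(real q2 / \<theta>)\<^sup>2 = 1 + 2 * h" "q1 < q2"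
    and psi: "\<And>z i. i < N \<Longrightarrow> psi z i = wave (q1 / \<theta>) (a 1 i) (b 1 i) z + wave (- (q1 / \<theta>)) (a 2 i) (b 2 i) z
           + wave (q2 / \<theta>) (a 3 i) (b 3 i) z + wave (- (q2 / \<theta>)) (a 4 i) (b 4 i) z"
    and ab: "\<And>j k. j \<in> {1, 2, 3, 4} \<Longrightarrow> k \<in> {1, 2, 3, 4} \<Longrightarrow> ip (a j) (b k) = 0"
    and aa: "\<And>j k. j \<in> {1, 2, 3, 4} \<Longrightarrow> k \<in> {1, 2, 3, 4} \<Longrightarrow> j \<noteq> k \<Longrightarrow> ip (a j) (a k) = 0"
    and bb: "\<And>j k. j \<in> {1, 2, 3, 4} \<Longrightarrow> k \<in> {1, 2, 3, 4} \<Longrightarrow> j \<noteq> k \<Longrightarrow> ip (b j) (b k) = 0"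
    and eq: "\<And>j. j \<in> {1, 2, 3, 4} \<Longrightarrow> ip (a j) (a j) = ip (b j) (b j)"
    and sums: "ip (b 1) (b 1) + ip (b 2) (b 2) = 1 / 2" "ip (b 3) (b 3) + ip (b 4) (b 4) = 1 / 2"
    and bal: "q1 * (ip (b 1) (b 1) - ip (b 2) (b 2)) + q2 * (ip (b 3) (b 3) - ip (b 4) (b 4)) = 0"
    and q0: "q1 = 0 \<Longrightarrow> ip (b 2) (b 2) = 0"
  proof (rule wave_data, goal_cases)
    case (1 q1 q2 a b)
    show ?case by (rule 1(1)) (fact 1)+
  qed
  define \<rho> where "\<rho> j = ip (b j) (b j)" for j
  note sums = sums[folded \<rho>_def] note bal = bal[folded \<rho>_def] note q0 = q0[folded \<rho>_def]
  have \<rho>0: "\<rho> j \<ge> 0" for j by (simp add: \<rho>_def vinner_self_nonneg)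
  have q2: "real q2 > 0" "real q1 < real q2" using q(3) by auto
  have \<alpha>: "q1 / \<theta> = sqrt (1 - 2 * h)" and \<beta>: "q2 / \<theta> = sqrt (1 + 2 * h)"
    using q theta_pos real_sqrt_unique[of "q1 / \<theta>" "1 - 2 * h"] real_sqrt_unique[of "q2 / \<theta>"
        "1 + 2 * h"] by simp_all
  note psi = psi[unfolded \<alpha> \<beta>]
  define \<kappa> where "\<kappa> = real q1 / real q2"
  have ratio: "sqrt (1 - 2 * h) / sqrt (1 + 2 * h) = \<kappa>"
    unfolding \<kappa>_def \<alpha>[symmetric] \<beta>[symmetric] using theta_pos by simp
  have h2: "h \<le> 1 / 2" using q(1) zero_le_power2[of "real q1 / \<theta>"] by linarith
  have qq: "real q1 ^ 2 = \<theta>\<^sup>2 * (1 - 2 * h)" "real q2 ^ 2 = \<theta>\<^sup>2 * (1 + 2 * h)"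
    unfolding q(1)[symmetric] q(2)[symmetric] using theta_pos by (simp_all add: power_divide)
  have th: "\<theta>\<^sup>2 = (real q1 ^ 2 + real q2 ^ 2) / 2" unfolding qq by (simp add: algebra_simps)
  have hh: "h = (real q2 ^ 2 - real q1 ^ 2) / (2 * (real q1 ^ 2 + real q2 ^ 2))"
  proof -
    have "real q2 ^ 2 - real q1 ^ 2 = \<theta>\<^sup>2 * 4 * h" "2 * (real q1 ^ 2 + real q2 ^ 2) = \<theta>\<^sup>2 * 4"
      unfolding qq by (simp_all add: algebra_simps)
    then show ?thesis using theta_pos by simp
  qed
  have full: "vzero N v" if "\<And>z. ip v (psi z) = 0" for v
    using imm that unfolding torus_immersion_def N_eq by blast
  \<comment> \<open>The balance equation and q1 < q2 give |rho_3 - rho_4| < 1/2, whereas the two add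
    up to 1/2.\<close>
  have \<rho>34: "\<rho> 3 > 0" "\<rho> 4 > 0"
  proof -
    have "\<bar>\<rho> 1 - \<rho> 2\<bar> \<le> 1 / 2" using sums \<rho>0[of 1] \<rho>0[of 2] by linarith
    then have "\<bar>q1 * (\<rho> 1 - \<rho> 2)\<bar> \<le> q1 * (1 / 2)"
      unfolding abs_mult by (intro mult_mono) auto
    then have "\<bar>q2 * (\<rho> 3 - \<rho> 4)\<bar> < q2 * (1 / 2)" using bal q2 by linarith
    then have "\<bar>\<rho> 3 - \<rho> 4\<bar> < 1 / 2" unfolding abs_mult using q2 by simp
    then show "\<rho> 3 > 0" "\<rho> 4 > 0" using sums by linarith+
  qed
  \<comment> \<open>Stated for arbitrary slots and a domain map \<open>g\<close>, so that it serves
    both the identity and the conjugation, which permutes the slots.\<close>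
  have n5: thesis if j: "j1 \<in> {1,2,3,4}" "j3 \<in> {1,2,3,4}" "j4 \<in> {1,2,3,4}" "j1 \<noteq> j3" "j1 \<noteq> j4" "j3 \<noteq> j4"
    and g: "torus_isometry \<theta> g" "\<And>z. \<exists>w. g w = z"
    and F: "\<And>z i. i < N \<Longrightarrow> psi (g z) i = wave (sqrt (1 - 2 * h)) (a j1 i) (b j1 i) z
       + wave (sqrt (1 + 2 * h)) (a j3 i) (b j3 i) z + wave (- sqrt (1 + 2 * h)) (a j4 i) (b j4 i) z"
    and r: "\<rho> j1 = 1 / 2" "\<rho> j3 + \<rho> j4 = 1 / 2" "q1 / 2 + q2 * (\<rho> j3 - \<rho> j4) = 0" "\<rho> j3 > 0" "\<rho> j4 > 0"
    for g j1 j3 j4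
  proof -
    define \<sigma> where "\<sigma> p = (if p = 1 then j1 else if p = 2 then j3 else j4)" for p :: nat
    have \<sigma>: "\<sigma> p \<in> {1,2,3,4}" for p unfolding \<sigma>_def using j by auto
    have \<sigma>ne: "\<sigma> p \<noteq> \<sigma> p'" if "p \<in> {1..3}" "p' \<in> {1..3}" "p \<noteq> p'" for p p'
      using that j unfolding \<sigma>_def by auto
    have "\<rho> j3 - \<rho> j4 = - \<kappa> / 2" using r(3) q2 by (simp add: \<kappa>_def field_simps)
    then have r34: "\<rho> j3 = (1 - \<kappa>) / 4" "\<rho> j4 = (1 + \<kappa>) / 4"
      using r(2) by (auto simp: field_simps)
    have fullg: "vzero N v" if "\<And>z. ip v (psi (g z)) = 0" for v
      by (rule full) (use that g(2) in metis)
    obtain E where E: "N = 6" "orthonormal_basis N E"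
      "\<And>z i. i < N \<Longrightarrow> complex_of_real (psi (g z) i) = psi5 h E z i"
    proof (rule psi5_normal_form[OF h(1) h2, of N "\<lambda>z. psi (g z)" "\<lambda>p. a (\<sigma> p)" "\<lambda>p. b (\<sigma> p)" "\<lambda>p. \<rho> (\<sigma> p)"])
      show "psi (g z) i = wave (sqrt (1 - 2 * h)) (a (\<sigma> 1) i) (b (\<sigma> 1) i) z
       + wave (sqrt (1 + 2 * h)) (a (\<sigma> 2) i) (b (\<sigma> 2) i) z + wave (- sqrt (1
           + 2 * h)) (a (\<sigma> 3) i) (b (\<sigma> 3) i) z"
        if "i < N" for z i using F[OF that] by (simp add: \<sigma>_def)
      show "ip (a (\<sigma> p)) (a (\<sigma> p)) = \<rho> (\<sigma> p) \<and> ip (b (\<sigma> p)) (b (\<sigma> p)) = \<rho> (\<sigma> p) \<and> 0 < \<rho> (\<sigma> p)"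
        if "p \<in> {1..3}" for p
        using eq[OF \<sigma>[of p]] r by (auto simp: \<rho>_def[symmetric] \<sigma>_def)
    qed (use ab aa bb \<sigma> \<sigma>ne fullg r r34 ratio in \<open>auto simp: \<sigma>_def\<close>)
    have "n = 5" using E(1) N_eq by simp
    then show thesis using concl[OF q(3) th hh g(1) E(2)] E(3) h2 by blast
  qed
  have vz: "a j i = 0 \<and> b j i = 0" if "\<rho> j = 0" "j \<in> {1,2,3,4}" "i < N" for j i
    using that vinner_self_eq_0[of N "b j"] vinner_self_eq_0[of N "a j"] eq[of j]
        by (auto simp: \<rho>_def vzero_def)
  consider "\<rho> 2 = 0" | "\<rho> 1 = 0" "q1 \<noteq> 0" "\<rho> 2 \<noteq> 0" | "\<rho> 1 > 0" "\<rho> 2 > 0" "q1 \<noteq> 0"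
    using \<rho>0[of 1] \<rho>0[of 2] q0 by (cases "q1 = 0") (auto simp: le_less)
  then show thesis
  proof cases
    case 1
    show thesis
    proof (rule n5[of 1 3 4 "\<lambda>z. z"])
      show r: "\<rho> 1 = 1 / 2" using sums 1 by simp
      show "q1 / 2 + q2 * (\<rho> 3 - \<rho> 4) = 0" using bal unfolding r 1 by simp
      show "psi z i = wave (sqrt (1 - 2 * h)) (a 1 i) (b 1 i) z
       + wave (sqrt (1 + 2 * h)) (a 3 i) (b 3 i) z + wave (- sqrt (1
           + 2 * h)) (a 4 i) (b 4 i) z" if "i < N" for z i
        using psi[OF that] vz[OF 1 _ that] by (simp add: wave_zero)
    qed (use sums \<rho>34 torus_isometry_id in auto)
  next
    case 2
    show thesis
    proof (rule n5[of 2 4 3 cnj])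
      show r: "\<rho> 2 = 1 / 2" using sums 2 by simp
      show "q1 / 2 + q2 * (\<rho> 4 - \<rho> 3) = 0" using bal unfolding r 2(1) by (simp add: algebra_simps)
      show "psi (cnj z) i = wave (sqrt (1 - 2 * h)) (a 2 i) (b 2 i) z
       + wave (sqrt (1 + 2 * h)) (a 4 i) (b 4 i) z + wave (- sqrt (1
           + 2 * h)) (a 3 i) (b 3 i) z" if "i < N" for z i
        using psi[OF that] vz[OF 2(1) _ that] by (simp add: wave_zero wave_cnj)
      show "\<exists>w. cnj w = z" for z by (rule exI[of _ "cnj z"]) simp
    qed (use sums \<rho>34 torus_isometry_cnj in auto)
  next
    case 3
    have h3: "sqrt (1 - 2 * h) > 0" unfolding \<alpha>[symmetric] using 3 theta_pos by simp
    then have h4: "h < 1 / 2" by simp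
    \<comment> \<open>Obtained by solving rho_1 = (1 + omega / sqrt (1 - 2h)) / 4; the open range of
      omega amounts to 0 < rho_1 < 1/2. The balance equation then dictates the q2 weights.\<close>
    define \<omega> where "\<omega> = (4 * \<rho> 1 - 1) * sqrt (1 - 2 * h)"
    have \<omega>: "\<omega> / sqrt (1 - 2 * h) = 4 * \<rho> 1 - 1" using h3 by (simp add: \<omega>_def)
    have "\<rho> 3 - \<rho> 4 = - \<kappa> * (\<rho> 1 - \<rho> 2)" using bal q2 by (simp add: \<kappa>_def field_simps)
    also have "\<rho> 1 - \<rho> 2 = (4 * \<rho> 1 - 1) / 2" using sums by (simp add: field_simps)
    finally have "\<rho> 3 - \<rho> 4 = - \<kappa> * (4 * \<rho> 1 - 1) / 2" by simp
    moreover have "\<omega> / sqrt (1 + 2 * h) = \<kappa> * (4 * \<rho> 1 - 1)"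
      unfolding \<omega>_def ratio[symmetric] by simp
    ultimately have \<rho>d: "\<rho> 3 - \<rho> 4 = - (\<omega> / sqrt (1 + 2 * h)) / 2" by simp
    have iv: "{1..4} = {1, 2, 3, 4::nat}" by auto
    obtain E where E: "N = 8" "orthonormal_basis N E"
      "\<And>z i. i < N \<Longrightarrow> complex_of_real (psi z i) = psi7 h \<omega> E z i"
    proof (rule psi7_normal_form[OF h(1) h2, of N psi a b \<rho> \<omega>, unfolded iv])
      show "psi z i = wave (sqrt (1 - 2 * h)) (a 1 i) (b 1 i) z + wave (- sqrt (1 - 2 * h)) (a 2 i) (b 2 i) z
        + wave (sqrt (1 + 2 * h)) (a 3 i) (b 3 i) z + wave (- sqrt (1 + 2 * h)) (a 4 i) (b 4 i) z"
        if "i < N" for z i by (rule psi[OF that])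
      show "\<rho> 1 = (1 + \<omega> / sqrt (1 - 2 * h)) / 4" "\<rho> 2 = (1 - \<omega> / sqrt (1 - 2 * h)) / 4"
        unfolding \<omega> using sums by (auto simp: field_simps)
      show "\<rho> 3 = (1 - \<omega> / sqrt (1 + 2 * h)) / 4" "\<rho> 4 = (1 + \<omega> / sqrt (1 + 2 * h)) / 4"
        using \<rho>d sums by argo+
      show "ip (a p) (a p) = \<rho> p \<and> ip (b p) (b p) = \<rho> p \<and> 0 < \<rho> p" if "p \<in> {1,2,3,4}" for p
        using that eq[OF that] 3 \<rho>34 by (auto simp: \<rho>_def[symmetric])
    qed (use ab aa bb full in auto)
    have "n = 7" using E(1) N_eq by simp
    moreover have "\<omega> < sqrt (1 - 2 * h)" "- sqrt (1 - 2 * h) < \<omega>"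
    proof -
      have "4 * \<rho> 1 - 1 < 1" "- 1 < 4 * \<rho> 1 - 1" using 3 sums by linarith+
      then show "\<omega> < sqrt (1 - 2 * h)" "- sqrt (1 - 2 * h) < \<omega>"
        using h3 mult_strict_right_mono[of "4 * \<rho> 1 - 1" 1 "sqrt (1 - 2 * h)"]
          mult_strict_right_mono[of "- 1" "4 * \<rho> 1 - 1" "sqrt (1 - 2 * h)"]
        unfolding \<omega>_def by simp_all
    qed
    ultimately show thesis
      using concl[OF q(3) th hh torus_isometry_id E(2)] E(3) h4 3 by blast
  qed
qed

end

section \<open>Existence\<close>

lemma sum_lessThan_double: "(\<Sum>i<2 * M. f i) = (\<Sum>p<M. f (2 * p) + f (2 * p
    + 1 :: nat))" for f :: "nat \<Rightarrow> 'a::comm_monoid_add"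
  by (induction M) (auto simp: add.assoc)

lemma pdir_wave:
  "pdir 1 (\<lambda>z i. wave (d i) (A i) (B i) z) = (\<lambda>z i. wave (d i) (B i) (- A i) z)"
  "pdir \<i> (\<lambda>z i. wave (d i) (A i) (B i) z) = (\<lambda>z i. wave (d i) (d i * B i) (- (d i * A i)) z)"
  unfolding fun_eq_iff pdir_def by (auto intro!: DERIV_imp_deriv wave_deriv[simplified])

lemma pds_wave:
  assumes "set ds \<subseteq> {1, \<i>}"
  shows "\<exists>A' B'. pds ds (\<lambda>z i. wave (d i) (A i) (B i) z) = (\<lambda>z i. wave (d i) (A' i) (B' i) z)"
  using assms
proof (induction ds)
  case Nil
  then show ?case by auto
next
  case (Cons e ds)
  then obtain A' B' where "pds ds (\<lambda>z i. wave (d i) (A i) (B i) z) = (\<lambda>z i. wave (d i) (A' i) (B' i) z)"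
    by auto
  then have "pds (e # ds) (\<lambda>z i. wave (d i) (A i) (B i) z) = pdir e (\<lambda>z i. wave (d i) (A' i) (B' i) z)"
    by (simp add: pds_Cons)
  moreover have "e = 1 \<or> e = \<i>" using Cons.prems by auto
  ultimately show ?case using pdir_wave[of d A' B'] by auto
qed

lemma smooth_map_wave: "smooth_map N (\<lambda>z i. wave (d i) (A i) (B i) z)"
  unfolding smooth_map_def
proof (intro allI impI conjI)
  fix ds :: "complex list" and i assume "set ds \<subseteq> {1, \<i>} \<and> i < N"
  then obtain A' B' where *: "pds ds (\<lambda>z i. wave (d i) (A i) (B i) z) = (\<lambda>z i. wave (d i) (A' i) (B' i) z)"
    using pds_wave by blast
  show "continuous_on UNIV (\<lambda>z. pds ds (\<lambda>z i. wave (d i) (A i) (B i) z) z i)"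
    unfolding * unfolding wave_def by (intro continuous_intros)
  fix z e :: complex assume "e \<in> {1, \<i>}"
  then show "(\<lambda>t::real. pds ds (\<lambda>z i. wave (d i) (A i) (B i) z) (z + of_real t * e) i) differentiable (at 0)"
    unfolding * using wave_deriv[of "d i" "A' i" "B' i" z] unfolding real_differentiable_def by blast
qed

lemma wave_lattice:
  assumes "c * \<theta> = of_int m" "w \<in> lattice \<theta>"
  shows "wave c A B (z + w) = wave c A B z"
proof -
  obtain k l where w: "w = Complex (2 * pi * of_int k) (2 * pi * of_int l * \<theta>)"
    using assms(2) by (auto simp: lattice_def)
  have "Re (z + w) + c * Im (z + w) = (Re z + c * Im z) + 2 * pi * of_int k + 2 * pi * of_int l * (c * \<theta>)"
    by (simp add: w algebra_simps)
  also have "\<dots> = (Re z + c * Im z) + 2 * pi * of_int (k + l * m)"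
    unfolding assms(1) by (simp add: algebra_simps)
  finally have *: "Re (z + w) + c * Im (z + w) = (Re z + c * Im z) + 2 * pi * of_int (k + l * m)" .
  have "cis (Re (z + w) + c * Im (z + w)) = cis (Re z + c * Im z)"
    unfolding * cis_mult[symmetric] by (simp only: cis_multiple_2pi Ints_of_int) simp
  then have "cos (Re (z + w) + c * Im (z + w)) = cos (Re z + c * Im z)"
      "sin (Re (z + w) + c * Im (z + w)) = sin (Re z + c * Im z)"
    by (metis cis.sel)+
  then show ?thesis by (simp only: wave_def)
qed

text \<open>Parity in y separates cosines from sines. For the cosines, 0 and pi give C3 = - C1 and
  C1 (cos (r pi) + 1) = 0, with a non-zero bracket as r < 1; for the sines, pi isolates C2 and pi/2
  then gives C4.\<close>

lemma sum_trig_zero: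
  fixes C1 C2 C3 C4 \<alpha> \<beta> :: real
  assumes 0: "\<And>y. C1 * cos (\<alpha> * y) + C2 * sin (\<alpha> * y) + C3 * cos (\<beta> * y) + C4 * sin (\<beta> * y) = 0"
    and ab: "0 \<le> \<alpha>" "\<alpha> < \<beta>"
  shows "C1 = 0" "C3 = 0" "C4 = 0" "\<alpha> > 0 \<Longrightarrow> C2 = 0"
proof -
  have b: "\<beta> > 0" using ab by linarith
  define r where "r = \<alpha> / \<beta>"
  have r: "0 \<le> r" "r < 1" using ab b by (auto simp: r_def)
  have at: "C1 * cos (r * t) + C3 * cos t = 0" "C2 * sin (r * t) + C4 * sin t = 0" for t
  proof -
    have "\<alpha> * (t / \<beta>) = r * t" "\<beta> * (t / \<beta>) = t" "\<alpha> * (- t / \<beta>) = - (r * t)" "\<beta> * (- t / \<beta>) = - t"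
      using b by (auto simp: r_def)
    then have "C1 * cos (r * t) + C2 * sin (r * t) + C3 * cos t + C4 * sin t = 0"
      "C1 * cos (r * t) - C2 * sin (r * t) + C3 * cos t - C4 * sin t = 0"
      using 0[of "t / \<beta>"] 0[of "- t / \<beta>"] by simp_all
    then show "C1 * cos (r * t) + C3 * cos t = 0" "C2 * sin (r * t) + C4 * sin t = 0" by linarith+
  qed
  have C3: "C3 = - C1" using at(1)[of 0] by simp
  have "cos pi < cos (r * pi)" using r by (intro cos_monotone_0_pi) auto
  then have "cos (r * pi) + 1 \<noteq> 0" by simp
  moreover have "C1 * (cos (r * pi) + 1) = 0" using at(1)[of pi] C3 by (simp add: algebra_simps)
  ultimately show "C1 = 0" by simp
  then show "C3 = 0" using C3 by simp
  have 2: "C2 * sin (r * pi) = 0" using at(2)[of pi] by simp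
  show "C2 = 0" if "\<alpha> > 0"
  proof -
    have "r > 0" using that b by (simp add: r_def)
    then have "sin (r * pi) > 0" using r by (intro sin_gt_zero) auto
    then show ?thesis using 2 by simp
  qed
  then have "C2 * sin (r * (pi / 2)) = 0" using ab by (cases "\<alpha> = 0") (auto simp: r_def)
  then show "C4 = 0" using at(2)[of "pi / 2"] unfolding sin_pi_half by linarith
qed

text \<open>The lines x = 0 and x = pi/2 give the sums and differences of paired amplitudes. For
  alpha = 0 the first two waves coincide, so \<open>deg\<close> must rule out a cancellation between
  them.\<close>

lemma wave_independent:
  assumes 0: "\<And>z. wave \<alpha> X1 Y1 z + wave (- \<alpha>) X2 Y2 z + wave \<beta> X3 Y3 z + wave (- \<beta>) X4 Y4 z = 0"
    and ab: "0 \<le> \<alpha>" "\<alpha> < \<beta>" and deg: "\<alpha> = 0 \<Longrightarrow> X2 = 0 \<and> Y2 = 0"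
  shows "X1 = 0 \<and> Y1 = 0 \<and> X2 = 0 \<and> Y2 = 0 \<and> X3 = 0 \<and> Y3 = 0 \<and> X4 = 0 \<and> Y4 = 0"
proof -
  have 1: "(X1 + X2) * cos (\<alpha> * y) + (Y1 - Y2) * sin (\<alpha> * y) + (X3 + X4) * cos (\<beta> * y)
      + (Y3 - Y4) * sin (\<beta> * y) = 0" for y
    using 0[of "Complex 0 y"] by (simp add: wave_def algebra_simps)
  have 2: "(Y1 + Y2) * cos (\<alpha> * y) + (X2 - X1) * sin (\<alpha> * y) + (Y3 + Y4) * cos (\<beta> * y)
      + (X4 - X3) * sin (\<beta> * y) = 0" for y
    using 0[of "Complex (pi / 2) y"] by (simp add: wave_def cos_add sin_add cos_diff sin_diff algebra_simps)
  show ?thesis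
    using sum_trig_zero[OF 1 ab] sum_trig_zero[OF 2 ab] deg ab by (cases "\<alpha> = 0") auto
qed

lemma wave_square: "(wave c A 0 z)\<^sup>2 + (wave c 0 A z)\<^sup>2 = A\<^sup>2"
  using sin_cos_squared_add[of "Re z + c * Im z"]
  by (simp add: wave_def power_mult_distrib flip: distrib_left)

text \<open>Coordinates 2p and 2p + 1 trace a circle of radius |r p| with phase x + c_p y. Then
  \<open>r1\<close> gives |psi| = |psi_x| = 1, \<open>r2\<close> gives psi_x orthogonal to psi_y,
  \<open>r3\<close> gives |psi_y| = 1, and by \<open>ch\<close> the tension field multiplies each
  coordinate by 2h or - 2h.\<close>

lemma cmc_pbh_torus_of_waves:
  fixes c r :: "nat \<Rightarrow> real"
  defines "psi \<equiv> (\<lambda>z i. wave (c (i div 2)) (if even i then r (i div 2) else 0) (if even i then 0 else r (i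
      div 2)) z)"
  assumes \<theta>: "\<theta> > 0" and N: "n + 1 = 2 * M" and h: "h > 0"
    and r1: "(\<Sum>p<M. (r p)\<^sup>2) = 1" and r2: "(\<Sum>p<M. c p * (r p)\<^sup>2) = 0" and r3: "(\<Sum>p<M. (c p)\<^sup>2 * (r p)\<^sup>2) = 1"
    and c: "\<And>p. p < M \<Longrightarrow> \<exists>m::int. c p * \<theta> = of_int m"
    and ch: "\<And>p. p < M \<Longrightarrow> (c p)\<^sup>2 = 1 - 2 * h \<or> (c p)\<^sup>2 = 1 + 2 * h"
    and full: "\<And>v. (\<And>z. (\<Sum>p<M. wave (c p) (r p * v (2 * p)) (r p * v (2 * p + 1)) z) = 0) \<Longrightarrow>
        (\<And>i. i < 2 * M \<Longrightarrow> v i = 0)"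
  shows "cmc_pbh_torus \<theta> n psi h"
proof -
  define A where "A i = (if even i then r (i div 2) else 0)" for i
  define B where "B i = (if even i then 0 else r (i div 2))" for i
  define d where "d i = c (i div 2)" for i
  have psi: "psi = (\<lambda>z i. wave (d i) (A i) (B i) z)" by (simp add: psi_def A_def B_def d_def)
  note P = pds_Cons pdir_wave[of d] psi
  have norm: "vinner (2 * M) (psi z) (psi z) = 1" for z
    unfolding vinner_def sum_lessThan_double
    using r1 by (simp add: psi A_def B_def d_def flip: power2_eq_square) (simp add: wave_square)
  have sq: "wave c 0 (- s) z = - wave c 0 s z" "wave c (x * s) 0 z = x * wave c s 0 z"
    "wave c 0 (x * s) z = x * wave c 0 s z" for c x s z by (simp_all add: wave_def)
  have imm: "torus_immersion \<theta> n psi"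
    unfolding torus_immersion_def N
  proof (intro conjI allI impI)
    show "smooth_map (2 * M) psi" unfolding psi by (rule smooth_map_wave)
    show "vinner (2 * M) (psi z) (psi z) = 1" for z by (rule norm)
    show "psi (z + w) i = psi z i" if "w \<in> lattice \<theta>" "i < 2 * M" for z w i
    proof -
      have "i div 2 < M" using that(2) by presburger
      then obtain m :: int where "c (i div 2) * \<theta> = of_int m" using c by blast
      from wave_lattice[OF this that(1)] show ?thesis by (simp add: psi d_def)
    qed
    have quad: "x * wave c 0 s z * (x' * wave c 0 s z) + x * wave c s 0 z * (x' * wave c s 0 z)
        = x * x' * s\<^sup>2" for x x' c s z
      using wave_square[of c s z] by (simp add: power2_eq_square algebra_simps flip: distrib_left)
    show "vinner (2 * M) (pdir 1 psi z) (pdir 1 psi z) = 1" for z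
      unfolding vinner_def sum_lessThan_double P using r1 quad[of 1 _ _ _ 1]
      by (simp add: A_def B_def d_def sq)
    show "vinner (2 * M) (pdir \<i> psi z) (pdir \<i> psi z) = 1" for z
      unfolding vinner_def sum_lessThan_double P using r3 quad
      by (simp add: A_def B_def d_def sq power2_eq_square)
    show "vinner (2 * M) (pdir 1 psi z) (pdir \<i> psi z) = 0" for z
      unfolding vinner_def sum_lessThan_double P using r2 quad[of 1]
      by (simp add: A_def B_def d_def sq)
    show "\<exists>z. vinner (2 * M) v (psi z) \<noteq> 0" if "\<not> vzero (2 * M) v" for v
    proof (rule ccontr)
      assume "\<not> ?thesis"
      then have "(\<Sum>p<M. wave (c p) (r p * v (2 * p)) (r p * v (2 * p + 1)) z) = 0" for z
        unfolding vinner_def sum_lessThan_double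
        by (simp add: psi A_def B_def d_def wave_def algebra_simps)
      then show False using full[of v] that by (auto simp: vzero_def)
    qed
  qed
  interpret flat_torus_immersion \<theta> n "2 * M" psi
    by unfold_locales (use \<theta> N imm in auto)
  define \<kappa> where "\<kappa> i = 1 - (d i)\<^sup>2" for i
  have \<kappa>: "(\<kappa> i)\<^sup>2 = 4 * h\<^sup>2" if "i < 2 * M" for i
  proof -
    have "i div 2 < M" using that by presburger
    from ch[OF this] show ?thesis by (auto simp: \<kappa>_def d_def power_mult_distrib)
  qed
  have T: "T z i = \<kappa> i * psi z i" for z i
    unfolding T_def by (simp only: P pds_Nil) (simp add: \<kappa>_def wave_def power2_eq_square algebra_simps)
  have TT: "vinner (2 * M) (T z) (T z) = 4 * h\<^sup>2" for z
  proof -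
    have "vinner (2 * M) (T z) (T z) = (\<Sum>i<2 * M. 4 * h\<^sup>2 * (psi z i * psi z i))"
      unfolding vinner_def
    proof (rule sum.cong)
      fix i assume "i \<in> {..<2 * M}"
      then have "(\<kappa> i)\<^sup>2 = 4 * h\<^sup>2" using \<kappa> by simp
      then show "T z i * T z i = 4 * h\<^sup>2 * (psi z i * psi z i)"
        unfolding T by (metis mult.assoc mult.commute power2_eq_square)
    qed simp
    also have "\<dots> = 4 * h\<^sup>2 * vinner (2 * M) (psi z) (psi z)" by (simp add: vinner_def sum_distrib_left)
    finally show ?thesis by (simp add: norm)
  qed
  have dT: "dT [1, 1] z i + dT [\<i>, \<i>] z i = - (1 + (d i)\<^sup>2) * (\<kappa> i * psi z i)" for z i
    unfolding dT_def append.simps by (simp only: P pds_Nil) (simp add: \<kappa>_def wave_def power2_eq_square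
        algebra_simps)
  have tension: "tension (n + 1) psi = T" unfolding N by (simp add: tension_eq fun_eq_iff)
  show ?thesis
    unfolding cmc_pbh_torus_def
  proof (intro conjI allI)
    show "torus_immersion \<theta> n psi" by (rule imm)
    fix z
    have "vinner (2 * M) (meancurv_vec (n + 1) psi z) (meancurv_vec (n + 1) psi z)
        = vinner (2 * M) (\<lambda>i. (1 / 2) * T z i) (\<lambda>i. (1 / 2) * T z i)"
      unfolding meancurv_vec_def tension by simp
    also have "\<dots> = h\<^sup>2" by (simp only: vinner_scale_left vinner_scale_right TT)
    finally show "vnorm (n + 1) (meancurv_vec (n + 1) psi z) = h"
      using h unfolding vnorm_def N by simp
    have "bitension (2 * M) psi z i = 0" if i: "i < 2 * M" for i
    proof -
      \<comment> \<open>The factor - (1 + d^2) + 2 equals kappa = 1 - d^2, so the linear part of the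
        bitension is kappa^2 psi.\<close>
      have "bitension (2 * M) psi z i = ((\<kappa> i)\<^sup>2 - 4 * h\<^sup>2) * psi z i"
        unfolding bitension_eq[OF i] dT TT T by (simp add: \<kappa>_def power2_eq_square algebra_simps)
      then show ?thesis using \<kappa>[OF i] by simp
    qed
    then show "vzero (n + 1) (bitension (n + 1) psi z)" unfolding N by (simp add: vzero_def)
  next
    have "vinner (2 * M) (T 0) (T 0) \<noteq> 0" using TT[of 0] h by simp
    then show "\<exists>z. \<not> vzero (n + 1) (tension (n + 1) psi z)"
      unfolding tension vinner_self_eq_0 unfolding N by (rule exI)
  qed
qed

lemma cmc_pbh_torus_exists:
  fixes q1 q2 :: nat
  assumes \<theta>: "\<theta> > 0" and q: "q1 < q2" and th: "\<theta>\<^sup>2 = (real q1 ^ 2 + real q2 ^ 2) / 2"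
    and n: "n = 5 \<or> n = 7 \<and> q1 > 0"
  shows "\<exists>psi h. h \<in> {0<..<1} \<and> cmc_pbh_torus \<theta> n psi h"
proof -
  define \<alpha> \<beta> where "\<alpha> = q1 / \<theta>" and "\<beta> = q2 / \<theta>"
  have ab: "0 \<le> \<alpha>" "\<alpha> < \<beta>" using q \<theta> by (auto simp: \<alpha>_def \<beta>_def divide_strict_right_mono)
  have int: "\<alpha> * \<theta> = of_int (int q1)" "\<beta> * \<theta> = of_int (int q2)" "- \<alpha> * \<theta> = of_int (- int q1)"
      "- \<beta> * \<theta> = of_int (- int q2)"
    using \<theta> by (simp_all add: \<alpha>_def \<beta>_def)
  have sum2: "\<alpha>\<^sup>2 + \<beta>\<^sup>2 = 2"
  proof -
    have "\<alpha>\<^sup>2 + \<beta>\<^sup>2 = (real q1 ^ 2 + real q2 ^ 2) / \<theta>\<^sup>2"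
        by (simp add: \<alpha>_def \<beta>_def power_divide add_divide_distrib)
    also have "real q1 ^ 2 + real q2 ^ 2 = 2 * \<theta>\<^sup>2" using th by simp
    finally show ?thesis using \<theta> by simp
  qed
  define h where "h = (\<beta>\<^sup>2 - \<alpha>\<^sup>2) / 4"
  have "\<alpha>\<^sup>2 < \<beta>\<^sup>2" using ab by (simp add: power_strict_mono)
  then have h: "0 < h" "h < 1" using sum2 zero_le_power2[of \<alpha>] unfolding h_def by argo+
  have hab: "\<alpha>\<^sup>2 = 1 - 2 * h" "\<beta>\<^sup>2 = 1 + 2 * h" using sum2 by (auto simp: h_def field_simps)
  show ?thesis
  proof (cases "n = 5")
    case True
    define \<kappa> where "\<kappa> = \<alpha> / \<beta>"
    have \<kappa>: "0 \<le> \<kappa>" "\<kappa> < 1" "\<beta> * \<kappa> = \<alpha>" using ab by (auto simp: \<kappa>_def)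
    define c where "c = (\<lambda>p::nat. if p = 0 then \<alpha> else if p = 1 then \<beta> else - \<beta>)"
    \<comment> \<open>The choice kappa = alpha / beta solves the balance alpha / 2 + beta ((1 -
      kappa) / 4 - (1 + kappa) / 4) = 0.\<close>
    define r where "r = (\<lambda>p::nat. if p = 0 then sqrt (1 / 2) else if p
        = 1 then sqrt ((1 - \<kappa>) / 4) else sqrt ((1 + \<kappa>) / 4))"
    have l3: "{..<3::nat} = {0, 1, 2}" by auto
    have e: "(\<Sum>p<3. f p) = f 0 + f 1 + f 2" for f :: "nat \<Rightarrow> real" unfolding l3 by simp
    have cc: "c 0 = \<alpha>" "c 1 = \<beta>" "c 2 = - \<beta>" by (simp_all add: c_def)
    have rr: "(r 0)\<^sup>2 = 1 / 2" "(r 1)\<^sup>2 = (1 - \<kappa>) / 4" "(r 2)\<^sup>2 = (1 + \<kappa>) / 4" "r 0 \<noteq> 0" "r 1 \<noteq> 0" "r 2 \<noteq> 0"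
      using \<kappa> by (simp_all add: r_def)
    have "cmc_pbh_torus \<theta> n (\<lambda>z i. wave (c (i div 2)) (if even i then r (i div 2) else 0) (if even i then
        0 else r (i div 2)) z) h"
    proof (rule cmc_pbh_torus_of_waves[where M = 3])
      show "(\<Sum>p<3. (r p)\<^sup>2) = 1" unfolding e rr by (simp add: field_simps)
      show "(\<Sum>p<3. c p * (r p)\<^sup>2) = 0" unfolding e rr cc \<kappa>(3)[symmetric] by (simp add: field_simps)
      show "(\<Sum>p<3. (c p)\<^sup>2 * (r p)\<^sup>2) = 1" unfolding e rr cc power2_minus hab by (simp add: field_simps)
      show "\<exists>m::int. c p * \<theta> = of_int m" for p using int unfolding c_def by metis
      show "(c p)\<^sup>2 = 1 - 2 * h \<or> (c p)\<^sup>2 = 1 + 2 * h" for p using hab by (simp add: c_def)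
      fix v :: "nat \<Rightarrow> real" and i :: nat
      assume 0: "\<And>z. (\<Sum>p<3. wave (c p) (r p * v (2 * p)) (r p * v (2 * p + 1)) z) = 0" and i: "i < 2 * 3"
      \<comment> \<open>A zero wave fills the slot of frequency - alpha, which also settles the
        degenerate case alpha = 0.\<close>
      have "wave \<alpha> (r 0 * v 0) (r 0 * v 1) z + wave (- \<alpha>) 0 0 z + wave \<beta> (r 1 * v 2) (r 1 * v 3) z
          + wave (- \<beta>) (r 2 * v 4) (r 2 * v 5) z = 0" for z
        using 0[of z] unfolding l3 by (simp add: c_def wave_def[of "- \<alpha>"] eval_nat_numeral)
      from wave_independent[OF this ab] have "v 0 = 0" "v 1 = 0" "v 2 = 0" "v 3 = 0" "v 4 = 0" "v 5 = 0"
        using rr by auto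
      moreover have "i \<in> {0, 1, 2, 3, 4, 5}" using i by auto
      ultimately show "v i = 0" by auto
    qed (use \<theta> h True in auto)
    then show ?thesis using h by auto
  next
    case False
    then have n: "n = 7" "q1 > 0" using n by auto
    then have a: "\<alpha> > 0" using \<theta> by (simp add: \<alpha>_def)
    define c where "c = (\<lambda>p::nat. if p = 0 then \<alpha> else if p = 1 then - \<alpha> else if p = 2 then \<beta> else - \<beta>)"
    \<comment> \<open>Equal weights satisfy the balance trivially; this is the member omega = 0 of
      the family.\<close>
    define r where "r = (\<lambda>p::nat. 1 / 2 :: real)"
    have l4: "{..<4::nat} = {0, 1, 2, 3}" by auto
    have "cmc_pbh_torus \<theta> n (\<lambda>z i. wave (c (i div 2)) (if even i then r (i div 2) else 0) (if even i then
        0 else r (i div 2)) z) h"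
    proof (rule cmc_pbh_torus_of_waves[where M = 4])
      show "(\<Sum>p<4. (r p)\<^sup>2) = 1" unfolding l4 by (simp add: r_def power2_eq_square)
      show "(\<Sum>p<4. c p * (r p)\<^sup>2) = 0" unfolding l4 by (simp add: c_def r_def)
      show "(\<Sum>p<4. (c p)\<^sup>2 * (r p)\<^sup>2) = 1" unfolding l4 using hab by (simp add: c_def r_def field_simps)
      show "\<exists>m::int. c p * \<theta> = of_int m" for p using int unfolding c_def by metis
      show "(c p)\<^sup>2 = 1 - 2 * h \<or> (c p)\<^sup>2 = 1 + 2 * h" for p using hab by (simp add: c_def)
      fix v :: "nat \<Rightarrow> real" and i :: nat
      assume 0: "\<And>z. (\<Sum>p<4. wave (c p) (r p * v (2 * p)) (r p * v (2 * p + 1)) z) = 0" and i: "i < 2 * 4"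
      have "wave \<alpha> (v 0 / 2) (v 1 / 2) z + wave (- \<alpha>) (v 2 / 2) (v 3 / 2) z + wave \<beta> (v 4 / 2) (v 5 / 2) z
          + wave (- \<beta>) (v 6 / 2) (v 7 / 2) z = 0" for z
        using 0[of z] unfolding l4 by (simp add: c_def r_def eval_nat_numeral)
      from wave_independent[OF this ab] have "v 0 = 0" "v 1 = 0" "v 2 = 0" "v 3 = 0" "v 4 = 0" "v 5 = 0"
          "v 6 = 0" "v 7 = 0"
        using a by auto
      moreover have "i \<in> {0, 1, 2, 3, 4, 5, 6, 7}" using i by auto
      ultimately show "v i = 0" by auto
    qed (use \<theta> h n in auto)
    then show ?thesis using h by auto
  qed
qed


lemma cmc_biharmonic_torus_if_cmc_pbh_torus:
  assumes \<theta>: "\<theta> > 0" and h: "h \<in> {0<..<1}" and cmc: "cmc_pbh_torus \<theta> n psi h"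
  shows "cmc_biharmonic_torus \<theta> n (n + 1) psi h"
proof -
  interpret flat_torus_immersion \<theta> n "n + 1" psi
    using \<theta> cmc by unfold_locales (auto simp: cmc_pbh_torus_def)
  have TT: "vinner (n + 1) (T z) (T z) = 4 * h\<^sup>2" for z
  proof -
    have "sqrt (vinner (n + 1) (meancurv_vec (n + 1) psi z) (meancurv_vec (n + 1) psi z)) = h"
      using cmc by (simp only: cmc_pbh_torus_def vnorm_def)
    then have "vinner (n + 1) (meancurv_vec (n + 1) psi z) (meancurv_vec (n + 1) psi z) = h\<^sup>2"
      using vinner_self_nonneg real_sqrt_pow2 by metis
    moreover have "vinner (n + 1) (meancurv_vec (n + 1) psi z) (meancurv_vec (n + 1) psi z)
        = vinner (n + 1) (\<lambda>i. (1 / 2) * T z i) (\<lambda>i. (1 / 2) * T z i)"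
      unfolding meancurv_vec_def tension_eq by simp
    ultimately show ?thesis by (simp only: vinner_scale_left vinner_scale_right)
  qed
  show ?thesis
  proof unfold_locales
    show "0 < h" "h < 1" using h by auto
    show "vinner (n + 1) (T z) (T z) = 4 * h\<^sup>2" for z by (rule TT)
    fix z i assume i: "i < n + 1"
    then have "bitension (n + 1) psi z i = 0" using cmc by (simp only: cmc_pbh_torus_def vzero_def)
    then show "dT [1, 1] z i + dT [\<i>, \<i>] z i + 2 * T z i - 4 * h\<^sup>2 * psi z i = 0"
      unfolding bitension_eq[OF i] TT .
  qed
qed

theorem theorem3p1:
  fixes \<theta> :: real and n :: nat
  assumes "\<theta> > 0"
  shows "((\<exists>psi h. h \<in> {0<..<1} \<and> cmc_pbh_torus \<theta> n psi h) \<longleftrightarrow>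
          (\<exists>q1 q2 :: nat. q1 < q2 \<and> \<theta>\<^sup>2 = (real q1 ^ 2 + real q2 ^ 2) / 2 \<and>
              (n = 5 \<or> (n = 7 \<and> q1 > 0))))
       \<and> (\<forall>psi h. h \<in> {0<..<1} \<and> cmc_pbh_torus \<theta> n psi h \<longrightarrow>
            (\<exists>q1 q2 :: nat. q1 < q2 \<and> \<theta>\<^sup>2 = (real q1 ^ 2 + real q2 ^ 2) / 2 \<and>
                h = (real q2 ^ 2 - real q1 ^ 2) / (2 * (real q1 ^ 2 + real q2 ^ 2)) \<and>
                (n = 5 \<or> (n = 7 \<and> q1 > 0))) \<and>
            (\<exists>g E. torus_isometry \<theta> g \<and> orthonormal_basis (n+1) E \<and>
               ((n = 5 \<and> h \<le> 1/2 \<and>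
                   (\<forall>z. \<forall>i<n+1. complex_of_real (psi (g z) i) = psi5 h E z i)) \<or>
                (n = 7 \<and> h < 1/2 \<and>
                   (\<exists>\<omega>. - sqrt (1 - 2*h) < \<omega> \<and> \<omega> < sqrt (1 - 2*h) \<and>
                      (\<forall>z. \<forall>i<n+1. complex_of_real (psi (g z) i) = psi7 h \<omega> E z i))))))"
    (is "(?ex \<longleftrightarrow> ?arith) \<and> ?class")
proof -
  have cls: ?class
  proof (intro allI impI)
    fix psi h assume *: "h \<in> {0<..<1} \<and> cmc_pbh_torus \<theta> n psi h"
    interpret cmc_biharmonic_torus \<theta> n "n + 1" psi h
      using cmc_biharmonic_torus_if_cmc_pbh_torus[OF assms] * by blast
    obtain q1 q2 :: nat and g E where **: "q1 < q2" "\<theta>\<^sup>2 = (real q1 ^ 2 + real q2 ^ 2) / 2"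
      "h = (real q2 ^ 2 - real q1 ^ 2) / (2 * (real q1 ^ 2 + real q2 ^ 2))"
      "torus_isometry \<theta> g" "orthonormal_basis (n + 1) E"
      "(n = 5 \<and> h \<le> 1 / 2 \<and> (\<forall>z. \<forall>i<n + 1. complex_of_real (psi (g z) i) = psi5 h E z i)) \<or>
       (n = 7 \<and> q1 > 0 \<and> h < 1 / 2 \<and> (\<exists>\<omega>. - sqrt (1 - 2 * h) < \<omega> \<and> \<omega> < sqrt (1 - 2 * h) \<and>
          (\<forall>z. \<forall>i<n + 1. complex_of_real (psi (g z) i) = psi7 h \<omega> E z i)))"
      by (rule classification)
    show "(\<exists>q1 q2 :: nat. q1 < q2 \<and> \<theta>\<^sup>2 = (real q1 ^ 2 + real q2 ^ 2) / 2 \<and>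
                h = (real q2 ^ 2 - real q1 ^ 2) / (2 * (real q1 ^ 2 + real q2 ^ 2)) \<and>
                (n = 5 \<or> (n = 7 \<and> q1 > 0))) \<and>
            (\<exists>g E. torus_isometry \<theta> g \<and> orthonormal_basis (n+1) E \<and>
               ((n = 5 \<and> h \<le> 1/2 \<and>
                   (\<forall>z. \<forall>i<n+1. complex_of_real (psi (g z) i) = psi5 h E z i)) \<or>
                (n = 7 \<and> h < 1/2 \<and>
                   (\<exists>\<omega>. - sqrt (1 - 2*h) < \<omega> \<and> \<omega> < sqrt (1 - 2*h) \<and>
                      (\<forall>z. \<forall>i<n+1. complex_of_real (psi (g z) i) = psi7 h \<omega> E z i)))))"
      using ** by blast
  qed
  moreover have "?ex \<longleftrightarrow> ?arith"
  proof
    assume ?ex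
    then show ?arith using cls by blast
  next
    assume ?arith
    then show ?ex using cmc_pbh_torus_exists[OF assms] by blast
  qed
  ultimately show ?thesis by blast
qed

end
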